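(* Let $p>2$ be a prime number. The modular polynomials $\Phi_{1,p},\Psi_{2,p},\Psi_{3,p}$ for $b'_1,b'_2,b'_3$ satisfy $$\Phi_{1,p}(X,b'_1,b'_2,b'_3)=\Phi_{1,p}(X,b'_1,b'_3,b'_2)\qquad\text{and}\qquad\Psi_{2,p}(X,b'_1,b'_2,b'_3)=\Psi_{3,p}(X,b'_1,b'_3,b'_2).$$ Moreover, the polynomial $L'_p\in\mathbb{Q}[b'_1,b'_2,b'_3]$ is symmetric (in $b'_1,b'_2,b'_3$).
   Context: $\mathcal{H}_2$ is the Siegel upper half-space of symmetric $2\times2$ complex matrices with positive definite imaginary part; $\Gamma_2=\mathrm{Sp}_4(\mathbb{Z})$ acts on it by $\begin{pmatrix}A&B\\C&D\end{pmatrix}\Omega=(A\Omega+B)(C\Omega+D)^{-1}$. For a square matrix $X$, $X_0$ is the vector of its diagonal entries. Put $$\Gamma(2,4)=\left\{\begin{pmatrix}A&B\\C&D\end{pmatrix}\in\Gamma_2:\begin{pmatrix}A&B\\C&D\end{pmatrix}\equiv I_4\bmod 2,\ B_0\equiv C_0\equiv0\bmod4\right\},$$ a normal subgroup of $\Gamma_2$, and let $\Gamma_0(p)$ be the subgroup of $\Gamma_2$ of matrices with $C\equiv0\bmod p$. For $b=(b_0,b_1)\in\{0,1\}^2$ let $\theta_{b_0+2b_1}(\Omega)=\sum_{n\in\mathbb{Z}^2}\exp(i\pi\,{}^tn\Omega n+i\pi\,{}^tn b)$, and for $i=1,2,3$ let $b'_i(\Omega)=\theta_i(\Omega/2)/\theta_0(\Omega/2)$.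 The functions $b'_1,b'_2,b'_3$ are algebraically independent generators of the field of modular functions for $\Gamma(2,4)$. For a function $f$ put $f_p^\gamma(\Omega)=f(p\gamma\Omega)$. Let $C_p$ be a set of representatives of the cosets $(\Gamma(2,4)\cap\Gamma_0(p))\gamma$ in $\Gamma(2,4)$. The modular polynomials for $b'_1,b'_2,b'_3$ are, for $\ell=2,3$, $$\Phi_{1,p}(X)=\prod_{\gamma\in C_p}(X-b_{1,p}'^{\,\gamma}),\qquad \Psi_{\ell,p}(X)=\sum_{\gamma\in C_p}b_{\ell,p}'^{\,\gamma}\prod_{\gamma'\in C_p\setminus\{\gamma\}}(X-b_{1,p}'^{\,\gamma'}).$$ They lie in $\mathbb{Q}(b'_1,b'_2,b'_3)[X]$; one writes $\Phi_{1,p}(X,b'_1,b'_2,b'_3)$ and $\Psi_{\ell,p}(X,b'_1,b'_2,b'_3)$ to display the coefficients as rational fractions in three variables, and interchanging arguments means substituting the variables in these fractions. Let $\mathcal{L}'_p\subset\Gamma(2,4)\backslash\mathcal{H}_2$ be the locus of principally polarized abelian surfaces modulo $\Gamma(2,4)$ that are $(p,p)$-isogenous to a surface with period matrix $\Omega'$ such that $\theta_0(\Omega'/2)=0$; explicitly, it is the set of classes of $\Omega$ for which there is $M\in\Gamma(2,4)$ with $\theta_0(pM\Omega/2)=0$. The polynomial $L'_p$ is the irreducible polynomial in $\mathbb{Q}[b'_1,b'_2,b'_3]$ (determined up to a nonzero constant) describing the locus $\mathcal{L}'_p$. *)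

theory Defs
  imports
    "HOL-Analysis.Analysis"
    "HOL-Number_Theory.Cong"
    "HOL-Computational_Algebra.Polynomial_Factorial"
    "HOL-Computational_Algebra.Field_as_Ring"
begin

text \<open>A 4 x 4 integer matrix is indexed by the sum type \<open>2 + 2\<close>, so that its four 2 x 2 blocks
  are obtained by restricting each index to \<open>Inl\<close> or \<open>Inr\<close>.\<close>

type_synonym mat4 = "int ^ (2 + 2) ^ (2 + 2)"
type_synonym cmat2 = "complex ^ 2 ^ 2"

definition blkA :: "mat4 \<Rightarrow> int ^ 2 ^ 2" where "blkA M = (\<chi> i j. M $ Inl i $ Inl j)"
definition blkB :: "mat4 \<Rightarrow> int ^ 2 ^ 2" where "blkB M = (\<chi> i j. M $ Inl i $ Inr j)"
definition blkC :: "mat4 \<Rightarrow> int ^ 2 ^ 2" where "blkC M = (\<chi> i j. M $ Inr i $ Inl j)"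
definition blkD :: "mat4 \<Rightarrow> int ^ 2 ^ 2" where "blkD M = (\<chi> i j. M $ Inr i $ Inr j)"

definition sympl_form :: mat4 where
  "sympl_form = (\<chi> i j. case (i, j) of
      (Inl k, Inr l) \<Rightarrow> (if k = l then 1 else 0)
    | (Inr k, Inl l) \<Rightarrow> (if k = l then - 1 else 0)
    | _ \<Rightarrow> 0)"

definition Gamma2 :: "mat4 set" where
  "Gamma2 = {M. transpose M ** sympl_form ** M = sympl_form}"

definition Gamma24 :: "mat4 set" where
  "Gamma24 = {M \<in> Gamma2. (\<forall>i j. [M $ i $ j = mat 1 $ i $ j] (mod 2)) \<and>
                (\<forall>i. 4 dvd blkB M $ i $ i \<and> 4 dvd blkC M $ i $ i)}"

definition Gamma0 :: "nat \<Rightarrow> mat4 set" where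
  "Gamma0 p = {M \<in> Gamma2. \<forall>i j. int p dvd blkC M $ i $ j}"

definition siegel_H2 :: "cmat2 set" where
  "siegel_H2 = {\<Omega>. transpose \<Omega> = \<Omega> \<and>
     (\<forall>x :: real ^ 2. x \<noteq> 0 \<longrightarrow> x \<bullet> (map_matrix Im \<Omega> *v x) > 0)}"

definition siegel_act :: "mat4 \<Rightarrow> cmat2 \<Rightarrow> cmat2" where
  "siegel_act M \<Omega> = (map_matrix of_int (blkA M) ** \<Omega> + map_matrix of_int (blkB M)) **
     matrix_inv (map_matrix of_int (blkC M) ** \<Omega> + map_matrix of_int (blkD M))"

text \<open>The index \<open>i = b\<^sub>0 + 2 b\<^sub>1\<close> encodes the vector \<open>(b\<^sub>0, b\<^sub>1)\<close>; in the type \<open>2\<close> the two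
  coordinates are numbered \<open>1\<close> and \<open>2\<close>.\<close>

definition theta_char :: "nat \<Rightarrow> int ^ 2" where
  "theta_char i = vector [int (i mod 2), int (i div 2)]"

definition theta :: "nat \<Rightarrow> cmat2 \<Rightarrow> complex" where
  "theta i \<Omega> = (\<Sum>\<^sub>\<infinity>n\<in>(UNIV :: (int ^ 2) set).
     exp (\<i> * of_real pi * (\<Sum>k\<in>UNIV. \<Sum>l\<in>UNIV. of_int (n $ k) * \<Omega> $ k $ l * of_int (n $ l))
        + \<i> * of_real pi * (\<Sum>k\<in>UNIV. of_int (n $ k * theta_char i $ k))))"

text \<open>The value of \<open>bprime i\<close> at \<open>\<Omega>\<close> is meaningful only on \<open>bprime_dom\<close>; elsewhere it is \<open>0\<close>
  by the convention on division.\<close>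

definition bprime_dom :: "cmat2 set" where
  "bprime_dom = {\<Omega> \<in> siegel_H2. theta 0 ((1 / 2) *\<^sub>R \<Omega>) \<noteq> 0}"

definition bprime :: "nat \<Rightarrow> cmat2 \<Rightarrow> complex" where
  "bprime i \<Omega> = theta i ((1 / 2) *\<^sub>R \<Omega>) / theta 0 ((1 / 2) *\<^sub>R \<Omega>)"

definition bprime_p :: "nat \<Rightarrow> nat \<Rightarrow> mat4 \<Rightarrow> cmat2 \<Rightarrow> complex" where
  "bprime_p p i \<gamma> \<Omega> = bprime i (real p *\<^sub>R siegel_act \<gamma> \<Omega>)"

text \<open>The ring Q[x1, x2, x3] is represented as Q[x1][x2][x3], and Q(x1, x2, x3) as its fraction
  field. A point is a function whose values at \<open>1\<close>, \<open>2\<close>, \<open>3\<close> are the three coordinates.\<close>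

type_synonym qpoly3 = "rat poly poly poly"
type_synonym qfrac3 = "qpoly3 fract"

definition qconst :: "rat \<Rightarrow> qpoly3" where
  "qconst c = [:[:[:c:]:]:]"

definition qvar :: "nat \<Rightarrow> qpoly3" where
  "qvar i = (if i = 1 then [:[:[:0, 1:]:]:] else if i = 2 then [:[:0, 1:]:] else [:0, 1:])"

text \<open>Value of a polynomial at a point of a ring \<open>R\<close>, given the homomorphism \<open>h\<close> from the
  rationals to \<open>R\<close>.\<close>

definition eval3 :: "(rat \<Rightarrow> 'a::comm_ring_1) \<Rightarrow> qpoly3 \<Rightarrow> (nat \<Rightarrow> 'a) \<Rightarrow> 'a" where
  "eval3 h P v =
     poly (map_poly (\<lambda>Q. poly (map_poly (\<lambda>R. poly (map_poly h R) (v 1)) Q) (v 2)) P) (v 3)"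

text \<open>Fractions are evaluated through their representation in lowest terms. Evaluating at three
  elements of \<open>qfrac3\<close> is substitution; evaluating at complex numbers gives the value.\<close>

definition frac_defined_at :: "qfrac3 \<Rightarrow> (nat \<Rightarrow> 'a::field_char_0) \<Rightarrow> bool" where
  "frac_defined_at q v \<longleftrightarrow> eval3 of_rat (snd (quot_of_fract q)) v \<noteq> 0"

definition eval_frac3 :: "qfrac3 \<Rightarrow> (nat \<Rightarrow> 'a::field_char_0) \<Rightarrow> 'a" where
  "eval_frac3 q v =
     eval3 of_rat (fst (quot_of_fract q)) v / eval3 of_rat (snd (quot_of_fract q)) v"

definition swap23 :: "qfrac3 poly \<Rightarrow> qfrac3 poly" where
  "swap23 F = map_poly (\<lambda>q. eval_frac3 q
      ((\<lambda>i. to_fract (qvar i))(2 := to_fract (qvar 3), 3 := to_fract (qvar 2)))) F"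

definition symmetric3 :: "qpoly3 \<Rightarrow> bool" where
  "symmetric3 P \<longleftrightarrow> (\<forall>\<pi>. \<pi> permutes {1, 2, 3} \<longrightarrow> eval3 qconst P (\<lambda>i. qvar (\<pi> i)) = P)"

definition coset_reps :: "nat \<Rightarrow> mat4 set \<Rightarrow> bool" where
  "coset_reps p C \<longleftrightarrow> C \<subseteq> Gamma24 \<and>
     (\<forall>M \<in> Gamma24. \<exists>!\<gamma>. \<gamma> \<in> C \<and> (\<exists>N \<in> Gamma24 \<inter> Gamma0 p. M = N ** \<gamma>))"

definition Phi_at :: "nat \<Rightarrow> mat4 set \<Rightarrow> cmat2 \<Rightarrow> complex poly" where
  "Phi_at p C \<Omega> = (\<Prod>\<gamma>\<in>C. [:- bprime_p p 1 \<gamma> \<Omega>, 1:])"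

definition Psi_at :: "nat \<Rightarrow> mat4 set \<Rightarrow> nat \<Rightarrow> cmat2 \<Rightarrow> complex poly" where
  "Psi_at p C l \<Omega> =
     (\<Sum>\<gamma>\<in>C. smult (bprime_p p l \<gamma> \<Omega>) (\<Prod>\<gamma>'\<in>C - {\<gamma>}. [:- bprime_p p 1 \<gamma>' \<Omega>, 1:]))"

text \<open>\<open>represents p C F G\<close> states the equality \<open>F(X, b'\<^sub>1, b'\<^sub>2, b'\<^sub>3) = G\<close> of polynomials in \<open>X\<close>
  over the meromorphic functions on the Siegel half-space, that is, equality at every point
  outside the poles of both sides.\<close>

definition represents ::
  "nat \<Rightarrow> mat4 set \<Rightarrow> qfrac3 poly \<Rightarrow> (cmat2 \<Rightarrow> complex poly) \<Rightarrow> bool" where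
  "represents p C F G \<longleftrightarrow>
     (\<forall>\<Omega> \<in> bprime_dom.
        (\<forall>\<gamma>\<in>C. real p *\<^sub>R siegel_act \<gamma> \<Omega> \<in> bprime_dom) \<longrightarrow>
        (\<forall>n. frac_defined_at (coeff F n) (\<lambda>i. bprime i \<Omega>)) \<longrightarrow>
        map_poly (\<lambda>q. eval_frac3 q (\<lambda>i. bprime i \<Omega>)) F = G \<Omega>)"

definition is_Phi :: "nat \<Rightarrow> mat4 set \<Rightarrow> qfrac3 poly \<Rightarrow> bool" where
  "is_Phi p C F \<longleftrightarrow> represents p C F (Phi_at p C)"

definition is_Psi :: "nat \<Rightarrow> mat4 set \<Rightarrow> nat \<Rightarrow> qfrac3 poly \<Rightarrow> bool" where
  "is_Psi p C l F \<longleftrightarrow> represents p C F (Psi_at p C l)"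

definition orbit24 :: "cmat2 \<Rightarrow> cmat2 set" where
  "orbit24 \<Omega> = (\<lambda>M. siegel_act M \<Omega>) ` Gamma24"

definition locus :: "nat \<Rightarrow> cmat2 set set" where
  "locus p = {orbit24 \<Omega> | \<Omega>. \<Omega> \<in> siegel_H2 \<and>
     (\<exists>M \<in> Gamma24. theta 0 ((real p / 2) *\<^sub>R siegel_act M \<Omega>) = 0)}"

text \<open>An irreducible equation of the locus in the coordinates \<open>b'\<^sub>1, b'\<^sub>2, b'\<^sub>3\<close>, on the part of the
  quotient where these coordinates are finite.\<close>

definition is_L :: "nat \<Rightarrow> qpoly3 \<Rightarrow> bool" where
  "is_L p L \<longleftrightarrow> irreducible L \<and>
     (\<forall>\<Omega> \<in> bprime_dom. eval3 of_rat L (\<lambda>i. bprime i \<Omega>) = 0 \<longleftrightarrow> orbit24 \<Omega> \<in> locus p)"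

end

theory Submission
  imports Defs "HOL-Complex_Analysis.Conformal_Mappings"
begin

text \<open>
  A matrix \<open>U\<close> in \<open>GL\<^sub>2(\<int>)\<close> acts on \<open>\<H>\<^sub>2\<close> by \<open>\<Omega> \<mapsto> U \<Omega> U\<^sup>T\<close>; reindexing the theta series shows that it
  permutes \<open>b'\<^sub>1, b'\<^sub>2, b'\<^sub>3\<close> through its action on the nonzero characteristics modulo \<open>2\<close>. It normalizes
  \<open>\<Gamma>(2,4)\<close> and \<open>\<Gamma>\<^sub>0(p)\<close>, hence permutes the cosets, and each \<open>b'\<^sub>i (p \<gamma> \<Omega>)\<close> depends only on the coset of
  \<open>\<gamma>\<close> because the \<open>b'\<^sub>i\<close> are invariant under \<open>\<Gamma>(2,4)\<close>. So the two sides of the claimed identities agree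
  at \<open>b'(\<Omega>)\<close>, and they are equal because \<open>b'\<^sub>1, b'\<^sub>2, b'\<^sub>3\<close> are algebraically independent.

  The invariance follows from the functional equation of the theta function, which holds because a
  function with its quasi-periods is unique up to a factor. The independence is read off from the
  growth of the \<open>b'\<^sub>i\<close> at a cusp where they degenerate.

  The polynomials \<open>L\<close> and \<open>L\<close> with two variables exchanged are irreducible and vanish at the same points
  \<open>b'(\<Omega>)\<close>. If they were not associated, elimination of \<open>x\<^sub>3\<close> would give a nonzero polynomial in
  \<open>b'\<^sub>1\<close> and \<open>b'\<^sub>2\<close> that vanishes on the locus, but on the component of the locus that meets the cusp
  these two functions are independent. So \<open>L\<close> is symmetric up to a sign, and an antisymmetric irreducible
  \<open>L\<close> would be a multiple of \<open>x\<^sub>3 - x\<^sub>2\<close>, which is not semi-invariant under the other transpositions.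
\<close>

section \<open>Fourier uniqueness and quasi-periodic functions\<close>

text \<open>Both \<open>represents\<close> and \<open>is_L\<close> speak only of values at points of
  the half-space, so every polynomial identity has to be tested at points, and the obstacle is to
  exhibit enough of them.

  The transformation law of theta is needed only up to a factor common to all four characteristics,
  because the \<open>b'\<close> are quotients. Hence neither the multiplier nor generators of
  Gamma(2,4) have to be computed.

  Points come from a family with parameters \<open>q\<close>, \<open>r\<close>, \<open>v\<close>. A
  matrix of SL_2(Z), embedded by scalar blocks, turns \<open>theta i\<close> at
  \<open>\<Omega> / 2\<close> into second order theta constants, which have expansions in
  \<open>q\<close> and \<open>r\<close>. A shift by the identity matrix moves the constant with
  leading monomial \<open>q * r\<close> into the denominator, so that all three \<open>b'\<close>
  blow up as \<open>q\<close> and \<open>r\<close> tend to 0.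

  The lower left entry \<open>c\<close> obeys two congruences: \<open>c = - 1\<close> modulo 8 gives
  one proportionality factor for all characteristics, and \<open>c = 0\<close> modulo
  \<open>p\<close> lets multiplication by \<open>p\<close> pass through the matrix. They are
  compatible because \<open>p\<close> is odd. The parameter \<open>v\<close> then selects the
  surface: \<open>v = 0\<close> for algebraic independence, \<open>v = 1 / (2 * p)\<close> for the
  locus.\<close>

lemma real_polynomial_on_circle:
  assumes "real_polynomial_function (g :: complex \<Rightarrow> real)"
  shows "\<exists>P N. \<forall>w. norm w = 1 \<longrightarrow> complex_of_real (g w) * w ^ N = poly P w"
  using assms
proof (induction rule: real_polynomial_function.induct)
  case (linear f)
  define a where "a = f 1"
  define b where "b = f \<i>"
  have f: "f w = Re w * a + Im w * b" for w
  proof -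
    have "w = Re w *\<^sub>R 1 + Im w *\<^sub>R \<i>"
      by (simp add: complex_eq_iff)
    then have "f w = f (Re w *\<^sub>R 1 + Im w *\<^sub>R \<i>)" by simp
    also have "\<dots> = Re w * a + Im w * b"
      using linear by (simp add: linear_simps a_def b_def)
    finally show ?thesis .
  qed
  \<comment> \<open>On the circle \<open>cnj w = 1 / w\<close>, so
    \<open>a * Re w + b * Im w\<close> is a Laurent polynomial with exponents -1 and 1;
    \<open>P\<close> is its product with \<open>w\<close>.\<close>
  define P where "P = [:(of_real a + \<i> * of_real b) / 2, 0, (of_real a - \<i> * of_real b) / 2:]"
  have "complex_of_real (f w) * w ^ 1 = poly P w" if "norm w = 1" for w
  proof -
    have "w * cnj w = 1" using that by (simp add: complex_norm_square[symmetric])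
    moreover have "complex_of_real (Re w) = (w + cnj w) / 2"
      by (simp add: complex_eq_iff)
    moreover have "complex_of_real (Im w) = (w - cnj w) / (2 * \<i>)"
      by (simp add: complex_eq_iff)
    ultimately have "complex_of_real (f w) * w
        = ((w + cnj w) / 2 * of_real a + (w - cnj w) / (2 * \<i>) * of_real b) * w"
      unfolding f by simp
    also have "\<dots> = ((w * w + w * cnj w) / 2) * of_real a + ((w * w - w * cnj w) / (2 * \<i>)) * of_real b"
      by (simp add: field_simps)
    also have "\<dots> = poly P w"
      using \<open>w * cnj w = 1\<close> by (simp add: P_def field_simps)
    finally show ?thesis by simp
  qed
  then show ?case by blast
next
  case (const c)
  show ?case by (rule exI[of _ "[:of_real c:]"], rule exI[of _ 0]) simp
next
  case (add f g)
  then obtain P N Q M where P: "\<And>w. norm w = 1 \<Longrightarrow> complex_of_real (f w) * w ^ N = poly P w"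
    and Q: "\<And>w. norm w = 1 \<Longrightarrow> complex_of_real (g w) * w ^ M = poly Q w" by metis
  have "complex_of_real (f w + g w) * w ^ (N + M) = poly (P * monom 1 M + Q * monom 1 N) w"
    if "norm w = 1" for w
    using P[OF that, symmetric] Q[OF that, symmetric]
    by (simp add: poly_monom power_add algebra_simps)
  then show ?case by blast
next
  case (mult f g)
  then obtain P N Q M where P: "\<And>w. norm w = 1 \<Longrightarrow> complex_of_real (f w) * w ^ N = poly P w"
    and Q: "\<And>w. norm w = 1 \<Longrightarrow> complex_of_real (g w) * w ^ M = poly Q w" by metis
  have "complex_of_real (f w * g w) * w ^ (N + M) = poly (P * Q) w" if "norm w = 1" for w
    using P[OF that, symmetric] Q[OF that, symmetric] by (simp add: power_add)
  then show ?case by blast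
qed

section \<open>Fourier coefficients of periodic functions\<close>

lemma periodic_of_int:
  fixes f :: "'a::ring_1 \<Rightarrow> 'b"
  assumes "\<And>x. f (x + 1) = f x"
  shows "f (x + of_int k) = f x"
proof (induction k rule: int_induct[of _ 0])
  case base
  show ?case by simp
next
  case (step1 i)
  then show ?case using assms[of "x + of_int i"] by (simp add: add.assoc)
next
  case (step2 i)
  then show ?case using assms[of "x + of_int (i - 1)"] by (simp add: algebra_simps)
qed

text \<open>\<open>Arg2pi\<close> jumps on the circle, so continuity of \<open>F\<close> is not
  inherited from it. Instead the circle is the image of a compact interval, and preimages of closed
  sets under \<open>F\<close> are images of compact sets.\<close>

lemma continuous_periodic_circle:
  fixes f :: "real \<Rightarrow> 'a::t2_space"
  assumes cont: "continuous_on UNIV f" and per: "\<And>x. f (x + 1) = f x"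
  obtains F where "continuous_on (sphere 0 1) F" "\<And>x. F (cis (2 * pi * x)) = f x"
proof -
  define F where "F w = f (Arg2pi w / (2 * pi))" for w
  have F: "F (cis (2 * pi * x)) = f x" for x
  proof -
    let ?y = "Arg2pi (cis (2 * pi * x)) / (2 * pi)"
    have "cis (2 * pi * ?y) = cis (2 * pi * x)"
      using Arg2pi_eq[of "cis (2 * pi * x)"] by (simp add: cis_conv_exp)
    then obtain k :: int where "2 * pi * ?y = 2 * pi * x + of_int (2 * k) * pi"
      using sin_cos_eq_iff[of "2 * pi * ?y" "2 * pi * x"] by (auto simp: complex_eq_iff algebra_simps)
    then have "?y = x + of_int k" by (simp add: field_simps)
    then show ?thesis unfolding F_def by (simp add: periodic_of_int per)
  qed
  have circ: "sphere 0 1 = (\<lambda>x. cis (2 * pi * x)) ` {0..1}"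
  proof (intro set_eqI iffI)
    fix w :: complex assume "w \<in> sphere 0 1"
    then have "w = cis (2 * pi * (Arg2pi w / (2 * pi)))"
      using Arg2pi_eq[of w] by (simp add: cis_conv_exp)
    moreover have "Arg2pi w / (2 * pi) \<in> {0..1}"
      using Arg2pi_ge_0[of w] Arg2pi_lt_2pi[of w] by (simp add: field_simps)
    ultimately show "w \<in> (\<lambda>x. cis (2 * pi * x)) ` {0..1}" by blast
  qed auto
  have "continuous_on (sphere 0 1) F"
  proof (subst continuous_on_closed_vimage)
    show "closed (sphere (0::complex) 1)" by simp
    show "\<forall>B. closed B \<longrightarrow> closed (F -` B \<inter> sphere 0 1)"
    proof (intro allI impI)
      fix B :: "'a set" assume "closed B"
      then have "closed (f -` B \<inter> {0..1})"
        by (metis cont closed_atLeastAtMost closed_Int closed_vimage)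
      then have "compact (f -` B \<inter> {0..1})"
        by (meson Int_lower2 bounded_closed_interval bounded_subset compact_eq_bounded_closed)
      then have "compact ((\<lambda>x. cis (2 * pi * x)) ` (f -` B \<inter> {0..1}))"
        by (intro compact_continuous_image) (auto intro!: continuous_intros)
      moreover have "F -` B \<inter> sphere 0 1 = (\<lambda>x. cis (2 * pi * x)) ` (f -` B \<inter> {0..1})"
        unfolding circ using F by auto
      ultimately show "closed (F -` B \<inter> sphere 0 1)"
        by (simp add: compact_imp_closed)
    qed
  qed
  with F that show ?thesis by blast
qed

text \<open>Vanishing coefficients make \<open>f\<close> orthogonal to all trigonometric
  polynomials, which by Stone-Weierstrass approximate \<open>cnj f\<close> uniformly; hence the
  integral of the squared norm of \<open>f\<close> is zero.\<close>

lemma fourier_unique: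
  fixes f :: "real \<Rightarrow> complex"
  assumes cont: "continuous_on UNIV f" and per: "\<And>x. f (x + 1) = f x"
    and coeff0: "\<And>k::int. integral {0..1} (\<lambda>x. f x * cis (2 * pi * (of_int k * x))) = 0"
  shows "f x = 0"
proof -
  have contI: "continuous_on {0..1} f" using cont continuous_on_subset by blast
  obtain F where FC: "continuous_on (sphere 0 1) F" and F: "\<And>x. F (cis (2 * pi * x)) = f x"
    using continuous_periodic_circle[OF cont per] by metis
  have ortho: "integral {0..1} (\<lambda>x. f x * of_real (g (cis (2 * pi * x)))) = 0"
    if poly: "real_polynomial_function g" for g :: "complex \<Rightarrow> real"
  proof -
    obtain P N where P: "\<And>w. norm w = 1 \<Longrightarrow> complex_of_real (g w) * w ^ N = poly P w"
      by (metis real_polynomial_on_circle[OF poly])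
    have eq: "f x * of_real (g (cis (2 * pi * x)))
        = (\<Sum>i\<le>degree P. coeff P i * (f x * cis (2 * pi * (of_int (int i - int N) * x))))" for x
    proof -
      let ?w = "cis (2 * pi * x)"
      have "of_real (g ?w) = poly P ?w / ?w ^ N"
        using P[of ?w] by (simp add: field_simps)
      also have "\<dots> = (\<Sum>i\<le>degree P. coeff P i * (?w ^ i / ?w ^ N))"
        by (simp add: poly_altdef sum_divide_distrib)
      also have "\<dots> = (\<Sum>i\<le>degree P. coeff P i * cis (2 * pi * (of_int (int i - int N) * x)))"
        by (intro sum.cong refl) (simp only: Complex.DeMoivre cis_divide, simp add: algebra_simps)
      finally show ?thesis by (simp add: sum_distrib_left algebra_simps)
    qed
    have int: "(\<lambda>x. coeff P i * (f x * cis (2 * pi * (of_int (int i - int N) * x)))) integrable_on {0..1}" for i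
      by (intro integrable_continuous_real continuous_intros contI)
    have "integral {0..1} (\<lambda>x. f x * of_real (g (cis (2 * pi * x))))
        = (\<Sum>i\<le>degree P. integral {0..1} (\<lambda>x. coeff P i * (f x * cis (2 * pi * (of_int (int i - int N) * x)))))"
      unfolding eq by (rule integral_sum) (use int in auto)
    also have "\<dots> = 0"
      by (simp only: integral_mult_right coeff0 mult_zero_right sum.neutral_const)
    finally show ?thesis .
  qed
  have "integral {0..1} (\<lambda>x. (norm (f x))\<^sup>2) = 0"
  proof (rule ccontr)
    assume nz: "integral {0..1} (\<lambda>x. (norm (f x))\<^sup>2) \<noteq> 0"
    obtain B where B: "\<And>x. x \<in> {0..1} \<Longrightarrow> norm (f x) \<le> B" and "B > 0"
      using compact_imp_bounded[OF compact_continuous_image[OF contI compact_Icc]]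
      unfolding bounded_pos ball_simps by metis
    let ?I = "integral {0..1} (\<lambda>x. (norm (f x))\<^sup>2)"
    \<comment> \<open>With this error the final bound \<open>B * (2 * e)\<close> is half of the
      absolute value of the integral, which is the contradiction.\<close>
    define e where "e = \<bar>?I\<bar> / (4 * B)"
    have "e > 0" using nz \<open>B > 0\<close> by (simp add: e_def)
    have "compact (sphere (0::complex) 1)" by simp
    obtain g where g: "real_polynomial_function g" "\<And>w. w \<in> sphere 0 1 \<Longrightarrow> \<bar>Re (F w) - g w\<bar> < e"
      using Stone_Weierstrass_real_polynomial_function[of "sphere 0 1" "\<lambda>w. Re (F w)" e]
        FC \<open>e > 0\<close> continuous_on_Re by (metis compact_sphere)
    obtain h where h: "real_polynomial_function h" "\<And>w. w \<in> sphere 0 1 \<Longrightarrow> \<bar>Im (F w) - h w\<bar> < e"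
      using Stone_Weierstrass_real_polynomial_function[of "sphere 0 1" "\<lambda>w. Im (F w)" e]
        FC \<open>e > 0\<close> continuous_on_Im by (metis compact_sphere)
    let ?G = "\<lambda>x. complex_of_real (g (cis (2 * pi * x)))"
    let ?H = "\<lambda>x. complex_of_real (h (cis (2 * pi * x)))"
    have cg: "continuous_on {0..1} ?G"
      using g(1) by (intro continuous_intros continuous_on_compose2[OF continuous_on_polymonial_function[of g UNIV]])
        (auto simp: real_polynomial_function_eq)
    have ch: "continuous_on {0..1} ?H"
      using h(1) by (intro continuous_intros continuous_on_compose2[OF continuous_on_polymonial_function[of h UNIV]])
        (auto simp: real_polynomial_function_eq)
    have "complex_of_real ?I = integral {0..1} (\<lambda>x. of_real ((norm (f x))\<^sup>2))"
      by (intro integral_unique[symmetric] has_integral_of_real integrable_integral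
          integrable_continuous_real continuous_intros contI)
    also have "\<dots> = integral {0..1} (\<lambda>x. f x * cnj (f x))"
      unfolding complex_norm_square ..
    \<comment> \<open>Subtracting the approximation of \<open>cnj f\<close> costs nothing, since
      \<open>f\<close> is orthogonal to both of its parts.\<close>
    also have "\<dots> = integral {0..1} (\<lambda>x. f x * (cnj (f x) - (?G x - \<i> * ?H x)))"
    proof -
      have "integral {0..1} (\<lambda>x. f x * (cnj (f x) - (?G x - \<i> * ?H x)))
        = integral {0..1} (\<lambda>x. f x * cnj (f x) - f x * ?G x + \<i> * (f x * ?H x))"
        by (simp add: algebra_simps)
      also have "\<dots> = integral {0..1} (\<lambda>x. f x * cnj (f x)) - integral {0..1} (\<lambda>x. f x * ?G x)
           + integral {0..1} (\<lambda>x. \<i> * (f x * ?H x))"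
        by (subst integral_add integral_diff;
            (intro integrable_continuous_real continuous_intros contI cg ch)?)+ simp
      finally show ?thesis using ortho[OF g(1)] ortho[OF h(1)] by simp
    qed
    also have "norm \<dots> \<le> B * (2 * e) * (1 - 0)"
    proof (rule integral_bound)
      show "continuous_on {0..1} (\<lambda>x. f x * (cnj (f x) - (?G x - \<i> * ?H x)))"
        by (intro continuous_intros contI cg ch)
      fix t :: real assume t: "t \<in> {0..1}"
      let ?w = "cis (2 * pi * t)"
      have "norm (cnj (f t) - (?G t - \<i> * ?H t)) \<le> \<bar>Re (f t) - g ?w\<bar> + \<bar>Im (f t) - h ?w\<bar>"
        using cmod_le[of "cnj (f t) - (?G t - \<i> * ?H t)"] by simp
      also have "\<dots> \<le> 2 * e"
        using g(2)[of ?w] h(2)[of ?w] F[of t] by simp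
      finally show "norm (f t * (cnj (f t) - (?G t - \<i> * ?H t))) \<le> B * (2 * e)"
        unfolding norm_mult using B[OF t] \<open>B > 0\<close> by (intro mult_mono) auto
    qed simp
    finally have "\<bar>?I\<bar> \<le> B * (2 * e)" by simp
    then show False using nz \<open>B > 0\<close> by (simp add: e_def)
  qed
  moreover have "continuous_on {0..1} (\<lambda>x. (norm (f x))\<^sup>2)"
    by (intro continuous_intros contI)
  ultimately have "\<forall>x\<in>{0..1}. (norm (f x))\<^sup>2 = 0"
    using integral_eq_0_iff[of 0 1 "\<lambda>x. (norm (f x))\<^sup>2"] by simp
  then have z: "f x = 0" if "x \<in> {0..1}" for x using that by simp
  have "f x = f (frac x)"
    using periodic_of_int[of f "frac x" "\<lfloor>x\<rfloor>", OF per] by (simp add: frac_def)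
  then show ?thesis using z[of "frac x"] frac_lt_1[of x] by simp
qed

text \<open>A primitive \<open>F\<close> of a function of period 1 satisfies
  \<open>F (z + 1) - F z = c\<close> for a constant \<open>c\<close>, and this constant is the mean
  over every horizontal segment of length 1.\<close>

lemma entire_periodic_mean_shift:
  assumes "g holomorphic_on UNIV" and per: "\<And>z. g (z + 1) = g z"
  shows "integral {0..1} (\<lambda>x. g (of_real x + w)) = integral {0..1} (\<lambda>x. g (of_real x))"
proof -
  obtain F where F: "\<And>z. (F has_field_derivative g z) (at z)"
    using holomorphic_convex_primitive'[OF _ _ assms(1)] by auto
  have D: "((\<lambda>z. F (z + 1) - F z) has_field_derivative 0) (at z)" for z
  proof -
    have "((\<lambda>z. F (z + 1) - F z) has_field_derivative g (z + 1) * (1 + 0) - g z) (at z)"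
      by (intro derivative_intros DERIV_chain2[OF F] F)
    then show ?thesis by (simp add: per)
  qed
  obtain c where c: "\<And>z. F (z + 1) - F z = c"
    using has_field_derivative_zero_constant[of UNIV "\<lambda>z. F (z + 1) - F z"] D by auto
  have "integral {0..1} (\<lambda>x. g (of_real x + w)) = c" for w
  proof -
    have "((\<lambda>x. F (of_real x + w)) has_vector_derivative g (of_real x + w)) (at x within {0..1})"
      for x :: real
    proof -
      have "((\<lambda>z. F (z + w)) has_field_derivative g (of_real x + w) * (1 + 0)) (at (of_real x))"
        by (intro derivative_intros DERIV_chain2[OF F])
      then show ?thesis
        using has_vector_derivative_real_field has_vector_derivative_at_within by fastforce
    qed
    then have "((\<lambda>x. g (of_real x + w)) has_integral (F (of_real 1 + w) - F (of_real 0 + w))) {0..1}"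
      by (intro fundamental_theorem_of_calculus) auto
    then show ?thesis using c[of w] by (simp add: integral_unique add.commute)
  qed
  from this[of w] this[of 0] show ?thesis by simp
qed

text \<open>The shift is undone one variable at a time; exchanging the integrals puts each variable
  innermost in turn.\<close>

lemma entire_periodic_mean2_shift:
  fixes g :: "complex \<Rightarrow> complex \<Rightarrow> complex"
  assumes hol1: "\<And>y. (\<lambda>x. g x y) holomorphic_on UNIV"
    and hol2: "\<And>x. (\<lambda>y. g x y) holomorphic_on UNIV"
    and cont: "continuous_on UNIV (\<lambda>(x, y). g x y)"
    and per1: "\<And>x y. g (x + 1) y = g x y" and per2: "\<And>x y. g x (y + 1) = g x y"
  shows "integral {0..1} (\<lambda>s. integral {0..1} (\<lambda>t. g (of_real s + a) (of_real t + b)))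
       = integral {0..1} (\<lambda>s. integral {0..1} (\<lambda>t. g (of_real s) (of_real t)))"
proof -
  have cg: "continuous_on A (\<lambda>(s, t). g (of_real s + a) (of_real t))" for A :: "(real \<times> real) set" and a
    unfolding case_prod_unfold
    by (intro continuous_on_compose2[OF cont[unfolded case_prod_unfold], of _ "\<lambda>p. (_ p, _ p)", simplified])
      (intro continuous_intros)+
  have swap: "integral {0..1} (\<lambda>s. integral {0..1} (\<lambda>t. g (of_real s + a) (of_real t)))
     = integral {0..1} (\<lambda>t. integral {0..1} (\<lambda>s. g (of_real s + a) (of_real t)))" for a
    using integral_swap_continuous[of 0 0 1 1 "\<lambda>s t. g (of_real s + a) (of_real t)"] cg by simp
  have "integral {0..1} (\<lambda>s. integral {0..1} (\<lambda>t. g (of_real s + a) (of_real t + b)))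
      = integral {0..1} (\<lambda>s. integral {0..1} (\<lambda>t. g (of_real s + a) (of_real t)))"
    by (intro integral_cong entire_periodic_mean_shift hol2 per2)
  also have "\<dots> = integral {0..1} (\<lambda>t. integral {0..1} (\<lambda>s. g (of_real s) (of_real t)))"
    unfolding swap by (intro integral_cong entire_periodic_mean_shift hol1 per1)
  also have "\<dots> = integral {0..1} (\<lambda>s. integral {0..1} (\<lambda>t. g (of_real s) (of_real t)))"
    using swap[of 0] by simp
  finally show ?thesis .
qed

text \<open>For fixed \<open>l\<close> the partial coefficient \<open>a l\<close> is a periodic
  function of \<open>s\<close> all of whose coefficients vanish, so it is zero; then the
  one-variable statement applies to \<open>f s\<close>.\<close>

lemma fourier_unique2:
  fixes f :: "real \<Rightarrow> real \<Rightarrow> complex"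
  assumes cont: "continuous_on UNIV (\<lambda>(x, y). f x y)"
    and per1: "\<And>x y. f (x + 1) y = f x y" and per2: "\<And>x y. f x (y + 1) = f x y"
    and coeff0: "\<And>k l::int. integral {0..1} (\<lambda>s. integral {0..1} (\<lambda>t.
       f s t * cis (2 * pi * (of_int k * s + of_int l * t)))) = 0"
  shows "f x y = 0"
proof -
  have c1: "continuous_on UNIV (f s)" for s
    using continuous_on_compose2[OF cont, of UNIV "\<lambda>t. (s, t)"]
    by (simp add: continuous_on_Pair)
  have c2: "continuous_on UNIV (\<lambda>s. f s t)" for t
    using continuous_on_compose2[OF cont, of UNIV "\<lambda>s. (s, t)"]
    by (simp add: continuous_on_Pair)
  define a where "a l s = integral {0..1} (\<lambda>t. f s t * cis (2 * pi * (of_int l * t)))" for l :: int and s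
  have "a l s = 0" for l s
  proof (rule fourier_unique)
    have "continuous_on (UNIV \<times> {0..1}) (\<lambda>(s, t). f s t * cis (2 * pi * (of_int l * t)))"
      using cont unfolding case_prod_unfold
      by (intro continuous_intros) (auto intro: continuous_on_subset)
    then show "continuous_on UNIV (a l)"
      unfolding a_def using integral_continuous_on_param[of UNIV 0 1 "\<lambda>s t. f s t * cis (2 * pi * (of_int l * t))"]
      by simp
    show "a l (x + 1) = a l x" for x by (simp add: a_def per1)
    fix k :: int
    have "f s t * cis (2 * pi * (of_int k * s + of_int l * t))
        = (f s t * cis (2 * pi * (of_int l * t))) * cis (2 * pi * (of_int k * s))" for s t
      unfolding mult.assoc cis_mult by (simp add: algebra_simps)
    then show "integral {0..1} (\<lambda>x. a l x * cis (2 * pi * (of_int k * x))) = 0"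
      using coeff0[of k l] by (simp only: a_def integral_mult_left)
  qed
  then show ?thesis
    unfolding a_def by (intro fourier_unique[of "f x"] c1 per2)
qed

text \<open>Shifting the torus by the lattice vector of \<open>(k, l)\<close> turns the Fourier coefficient of index
  \<open>(- k, - l)\<close> into a multiple of the mean.\<close>

lemma quasi_periodic_eq_0_of_mean:
  fixes \<phi> :: "complex \<Rightarrow> complex \<Rightarrow> complex"
  assumes hol1: "\<And>y. (\<lambda>x. \<phi> x y) holomorphic_on UNIV"
    and hol2: "\<And>x. (\<lambda>y. \<phi> x y) holomorphic_on UNIV"
    and cont: "continuous_on UNIV (\<lambda>(x, y). \<phi> x y)"
    and per1: "\<And>x y. \<phi> (x + 1) y = \<phi> x y" and per2: "\<And>x y. \<phi> x (y + 1) = \<phi> x y"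
    and quasi: "\<And>(k::int) (l::int). \<exists>c. \<forall>x y. \<phi> (x + P k l) (y + Q k l)
        = c * exp (- 2 * of_real pi * \<i> * (of_int k * x + of_int l * y)) * \<phi> x y"
    and mean: "integral {0..1} (\<lambda>s. integral {0..1} (\<lambda>t. \<phi> (of_real s) (of_real t))) = 0"
  shows "\<phi> x y = 0"
proof -
  have coeff: "integral {0..1} (\<lambda>s. integral {0..1} (\<lambda>t. \<phi> (of_real s + a) (of_real t + b)
      * cis (2 * pi * (of_int k * s + of_int l * t)))) = 0" for a b and k l :: int
  proof -
    define e where "e x y = exp (2 * of_real pi * \<i> * (of_int k * x + of_int l * y))" for x y :: complex
    define g where "g x y = \<phi> x y * e x y" for x y
    have e1: "e (x + 1) y = e x y" and e2: "e x (y + 1) = e x y" for x y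
    proof -
      have "e (x + 1) y = e x y * exp (2 * of_real pi * \<i> * of_int k)"
        unfolding e_def exp_add[symmetric] by (simp add: algebra_simps)
      then show "e (x + 1) y = e x y"
        using exp_integer_2pi[of "of_int k"] by (simp add: algebra_simps)
      have "e x (y + 1) = e x y * exp (2 * of_real pi * \<i> * of_int l)"
        unfolding e_def exp_add[symmetric] by (simp add: algebra_simps)
      then show "e x (y + 1) = e x y"
        using exp_integer_2pi[of "of_int l"] by (simp add: algebra_simps)
    qed
    have ec: "e (of_real s) (of_real t) = cis (2 * pi * (of_int k * s + of_int l * t))" for s t
      unfolding e_def cis_conv_exp by (simp add: algebra_simps)
    have eadd: "e (x + x') (y + y') = e x y * e x' y'" for x x' y y'
      unfolding e_def exp_add[symmetric] by (simp add: algebra_simps)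
    have shift: "integral {0..1} (\<lambda>s. integral {0..1} (\<lambda>t. g (of_real s + a) (of_real t + b)))
       = integral {0..1} (\<lambda>s. integral {0..1} (\<lambda>t. g (of_real s) (of_real t)))" for a b
    proof (rule entire_periodic_mean2_shift)
      show "(\<lambda>x. g x y) holomorphic_on UNIV" for y
        unfolding g_def e_def by (intro holomorphic_intros hol1)
      show "g x holomorphic_on UNIV" for x
        unfolding g_def e_def by (intro holomorphic_intros hol2)
      show "continuous_on UNIV (\<lambda>(x, y). g x y)"
        unfolding g_def e_def using cont unfolding case_prod_unfold by (intro continuous_intros)
    qed (simp_all add: g_def per1 per2 e1 e2)
    obtain c where c: "\<And>x y. \<phi> (x + P k l) (y + Q k l)
         = c * exp (- 2 * of_real pi * \<i> * (of_int k * x + of_int l * y)) * \<phi> x y"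
      using quasi[of k l] by blast
    have "g (x + P k l) (y + Q k l) = c * e (P k l) (Q k l) * \<phi> x y" for x y
    proof -
      have "exp (- 2 * of_real pi * \<i> * (of_int k * x + of_int l * y)) * e x y = 1"
        unfolding e_def exp_add[symmetric] by simp
      then show ?thesis unfolding g_def c eadd by (simp add: algebra_simps)
    qed
    then have "integral {0..1} (\<lambda>s. integral {0..1} (\<lambda>t. g (of_real s + P k l) (of_real t + Q k l))) = 0"
      by (simp add: mean)
    then have z: "integral {0..1} (\<lambda>s. integral {0..1} (\<lambda>t. g (of_real s + a) (of_real t + b))) = 0"
      unfolding shift .
    have "g (of_real s + a) (of_real t + b) = e a b * (\<phi> (of_real s + a) (of_real t + b)
      * cis (2 * pi * (of_int k * s + of_int l * t)))" for s t
      unfolding g_def eadd ec by simp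
    moreover have "e a b \<noteq> 0" by (simp add: e_def)
    ultimately show ?thesis using z by simp
  qed
  \<comment> \<open>The coefficients vanish on every translate of the real torus, and each complex
    point lies on one of these translates.\<close>
  have "\<phi> (of_real s + x) (of_real t + y) = 0" for s t
  proof (rule fourier_unique2[of "\<lambda>s t. \<phi> (of_real s + x) (of_real t + y)"])
    show "continuous_on UNIV (\<lambda>(s, t). \<phi> (of_real s + x) (of_real t + y))"
      unfolding case_prod_unfold
      by (intro continuous_on_compose2[OF cont[unfolded case_prod_unfold], of _ "\<lambda>p. (_ p, _ p)", simplified])
        (intro continuous_intros)+
    show "\<phi> (of_real (s + 1) + x) (of_real t + y) = \<phi> (of_real s + x) (of_real t + y)" for s t
      using per1[of "of_real s + x" "of_real t + y"] by (simp add: algebra_simps)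
    show "\<phi> (of_real s + x) (of_real (t + 1) + y) = \<phi> (of_real s + x) (of_real t + y)" for s t
      using per2[of "of_real s + x" "of_real t + y"] by (simp add: algebra_simps)
  qed (rule coeff)
  from this[of 0 0] show ?thesis by simp
qed

section \<open>The Riemann theta function of genus two\<close>

text \<open>Bilinear over the complex numbers as well: without conjugation the exponents of the
  theta series stay holomorphic.\<close>

definition bdot :: "'a::comm_ring_1 ^ 2 \<Rightarrow> 'a ^ 2 \<Rightarrow> 'a" where
  "bdot u v = u $ 1 * v $ 1 + u $ 2 * v $ 2"

definition cvec :: "int ^ 2 \<Rightarrow> complex ^ 2" where
  "cvec n = (\<chi> k. of_int (n $ k))"

definition theta_term :: "complex ^ 2 \<Rightarrow> cmat2 \<Rightarrow> int ^ 2 \<Rightarrow> complex" where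
  "theta_term z \<tau> n = exp (\<i> * of_real pi * bdot (cvec n) (\<tau> *v cvec n)
     + 2 * of_real pi * \<i> * bdot (cvec n) z)"

definition riemann_theta :: "complex ^ 2 \<Rightarrow> cmat2 \<Rightarrow> complex" where
  "riemann_theta z \<tau> = (\<Sum>\<^sub>\<infinity>n. theta_term z \<tau> n)"

section \<open>Convergence and holomorphy of the theta series\<close>

lemma siegel_H2_iff:
  "\<tau> \<in> siegel_H2 \<longleftrightarrow> \<tau> $ 1 $ 2 = \<tau> $ 2 $ 1 \<and> Im (\<tau> $ 1 $ 1) > 0 \<and>
     (Im (\<tau> $ 1 $ 2))\<^sup>2 < Im (\<tau> $ 1 $ 1) * Im (\<tau> $ 2 $ 2)"
proof -
  define a b b' c where "a = Im (\<tau> $ 1 $ 1)" and "b = Im (\<tau> $ 1 $ 2)" and "b' = Im (\<tau> $ 2 $ 1)"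
    and "c = Im (\<tau> $ 2 $ 2)"
  have sym: "transpose \<tau> = \<tau> \<longleftrightarrow> \<tau> $ 1 $ 2 = \<tau> $ 2 $ 1"
    by (auto simp: transpose_def vec_eq_iff forall_2)
  have quad: "x \<bullet> (map_matrix Im \<tau> *v x) = a * (x $ 1)\<^sup>2 + (b + b') * (x $ 1 * x $ 2) + c * (x $ 2)\<^sup>2"
    for x :: "real ^ 2"
    by (simp add: inner_vec_def matrix_vector_mult_def sum_2 map_matrix_def a_def b_def b'_def c_def
        power2_eq_square algebra_simps)
  have "(\<forall>x::real ^ 2. x \<noteq> 0 \<longrightarrow> x \<bullet> (map_matrix Im \<tau> *v x) > 0) \<longleftrightarrow> a > 0 \<and> b\<^sup>2 < a * c" if "b = b'"
  proof (intro iffI conjI allI impI)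
    assume pos: "\<forall>x::real ^ 2. x \<noteq> 0 \<longrightarrow> x \<bullet> (map_matrix Im \<tau> *v x) > 0"
    show "a > 0"
      using pos[rule_format, of "vector [1, 0]"] unfolding quad
      by (simp add: vec_eq_iff forall_2)
    \<comment> \<open>At this vector the quadratic form takes the value \<open>a\<close> times the
      determinant.\<close>
    then have "(vector [- b, a] :: real ^ 2) \<noteq> 0" by (simp add: vec_eq_iff forall_2)
    from pos[rule_format, OF this] have "0 < a * (a * c - b\<^sup>2)"
      unfolding quad using that by (simp add: power2_eq_square algebra_simps)
    with \<open>a > 0\<close> show "b\<^sup>2 < a * c" by (simp add: zero_less_mult_iff)
  next
    fix x :: "real ^ 2"
    assume *: "a > 0 \<and> b\<^sup>2 < a * c" and "x \<noteq> 0"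
    have "0 < (a * x $ 1 + b * x $ 2)\<^sup>2 + (a * c - b\<^sup>2) * (x $ 2)\<^sup>2"
    proof (cases "x $ 2 = 0")
      case True
      with \<open>x \<noteq> 0\<close> have "x $ 1 \<noteq> 0" by (auto simp: vec_eq_iff forall_2)
      then show ?thesis using True * by simp
    next
      case False
      then have "0 < (a * c - b\<^sup>2) * (x $ 2)\<^sup>2" using * by simp
      then show ?thesis by (simp add: add_nonneg_pos)
    qed
    also have "\<dots> = a * (x \<bullet> (map_matrix Im \<tau> *v x))"
      unfolding quad using that by (simp add: power2_eq_square algebra_simps)
    finally show "x \<bullet> (map_matrix Im \<tau> *v x) > 0" using * by (simp add: zero_less_mult_iff)
  qed
  then show ?thesis unfolding siegel_H2_def mem_Collect_eq sym a_def b_def b'_def c_def by metis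
qed

lemma summable_on_exp_abs_int: "(\<lambda>n::int. exp (- \<bar>of_int n\<bar> :: real)) summable_on UNIV"
proof -
  have nat: "(\<lambda>n::nat. exp (- real n)) summable_on UNIV"
  proof -
    have "summable (\<lambda>n. exp (- 1 :: real) ^ n)" by (intro summable_geometric) simp
    then have "summable (\<lambda>n. norm (exp (- real n)))" by (simp add: exp_of_nat_mult[symmetric])
    then show ?thesis by (rule norm_summable_imp_summable_on)
  qed
  have 1: "(\<lambda>n::int. exp (- \<bar>of_int n\<bar> :: real)) summable_on range int"
    using nat by (subst summable_on_reindex) (auto simp: o_def)
  have 2: "(\<lambda>n::int. exp (- \<bar>of_int n\<bar> :: real)) summable_on range (\<lambda>n. - int n)"
    using nat by (subst summable_on_reindex) (auto simp: o_def inj_on_def)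
  have "UNIV = range int \<union> range (\<lambda>n. - int n)"
    by (auto simp: image_iff) (metis int_cases2)
  with summable_on_union[OF 1 2] show ?thesis by simp
qed

lemma summable_on_exp_abs_int2:
  "(\<lambda>n::int ^ 2. exp (- \<bar>of_int (n $ 1)\<bar> - \<bar>of_int (n $ 2)\<bar> :: real)) summable_on UNIV"
proof -
  let ?g = "\<lambda>n::int. exp (- \<bar>of_int n\<bar> :: real)"
  have "(\<lambda>p. norm (?g (fst p) * ?g (snd p))) summable_on Sigma UNIV (\<lambda>_. UNIV)"
  proof (subst Infinite_Sum.abs_summable_on_Sigma_iff, intro conjI ballI)
    show "(\<lambda>y. norm (?g (fst (x, y)) * ?g (snd (x, y)))) summable_on UNIV" for x
      using summable_on_cmult_right[OF summable_on_exp_abs_int, of "?g x"] by (simp add: abs_mult)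
    have "(\<lambda>x. ?g x * infsum ?g UNIV) summable_on UNIV"
      by (rule summable_on_cmult_left[OF summable_on_exp_abs_int])
    moreover have "infsum ?g UNIV \<ge> 0" by (intro infsum_nonneg) simp
    ultimately show "(\<lambda>x. norm (infsum (\<lambda>y. norm (?g (fst (x, y)) * ?g (snd (x, y)))) UNIV)) summable_on UNIV"
      by (simp add: abs_mult infsum_cmult_right')
  qed
  then have "(\<lambda>p. ?g (fst p) * ?g (snd p)) summable_on UNIV"
    by (simp add: abs_mult)
  moreover have "bij_betw (\<lambda>n::int ^ 2. (n $ 1, n $ 2)) UNIV UNIV"
    by (rule bij_betw_byWitness[where f' = "\<lambda>p. vector [fst p, snd p]"])
      (auto simp: vec_eq_iff forall_2)
  ultimately have "(\<lambda>n::int ^ 2. ?g (n $ 1) * ?g (n $ 2)) summable_on UNIV"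
    using summable_on_reindex_bij_betw[of "\<lambda>n::int ^ 2. (n $ 1, n $ 2)" UNIV UNIV "\<lambda>p. ?g (fst p) * ?g (snd p)"]
    by simp
  then show ?thesis by (simp only: exp_add[symmetric] add_uminus_conv_diff)
qed

lemma norm_theta_term:
  "norm (theta_term z \<tau> n) = exp (- pi * (Im (\<tau> $ 1 $ 1) * (of_int (n $ 1))\<^sup>2
      + (Im (\<tau> $ 1 $ 2) + Im (\<tau> $ 2 $ 1)) * (of_int (n $ 1) * of_int (n $ 2))
      + Im (\<tau> $ 2 $ 2) * (of_int (n $ 2))\<^sup>2)
      - 2 * pi * (of_int (n $ 1) * Im (z $ 1) + of_int (n $ 2) * Im (z $ 2)))"
  unfolding theta_term_def norm_exp_eq_Re
  by (simp add: bdot_def cvec_def matrix_vector_mult_def sum_2 power2_eq_square algebra_simps)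

text \<open>One summable bound has to serve a whole neighbourhood of \<open>\<tau>\<^sub>0\<close>
  and a whole polydisc of \<open>z\<close>; it yields holomorphy and continuity, and it justifies
  termwise integration.\<close>

lemma theta_term_majorant:
  assumes "\<tau>\<^sub>0 \<in> siegel_H2" "R \<ge> 0"
  shows "\<exists>d>0. \<exists>M. M summable_on UNIV \<and> (\<forall>\<tau> z n. (\<forall>k l. norm (\<tau> $ k $ l - \<tau>\<^sub>0 $ k $ l) \<le> d) \<longrightarrow>
       (\<forall>k. norm (z $ k) \<le> R) \<longrightarrow> norm (theta_term z \<tau> n) \<le> M n)"
proof -
  define a b c where "a = Im (\<tau>\<^sub>0 $ 1 $ 1)" and "b = Im (\<tau>\<^sub>0 $ 1 $ 2)" and "c = Im (\<tau>\<^sub>0 $ 2 $ 2)"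
  have b': "Im (\<tau>\<^sub>0 $ 2 $ 1) = b" and "a > 0" and ac: "b\<^sup>2 < a * c"
    using assms(1) by (auto simp: siegel_H2_iff a_def b_def c_def)
  have "0 < a * c" using ac zero_le_power2[of b] by linarith
  then have "c > 0" using \<open>a > 0\<close> by (simp add: zero_less_mult_iff)
  \<comment> \<open>Determinant over trace, a lower bound for the smaller eigenvalue of the
    imaginary part of \<open>\<tau>\<^sub>0\<close>.\<close>
  define e where "e = (a * c - b\<^sup>2) / (a + c)"
  have "e > 0" unfolding e_def using ac \<open>a > 0\<close> \<open>c > 0\<close> by simp
  have "a - e > 0"
  proof -
    have "a * (a + c) - (a * c - b\<^sup>2) = a * a + b\<^sup>2" by (simp add: algebra_simps)
    moreover have "a * a > 0" using \<open>a > 0\<close> by simp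
    ultimately have "a * (a + c) - (a * c - b\<^sup>2) > 0" using zero_le_power2[of b] by linarith
    then show ?thesis unfolding e_def using \<open>a > 0\<close> \<open>c > 0\<close> by (simp add: field_simps)
  qed
  have disc: "(a - e) * (c - e) - b\<^sup>2 = e\<^sup>2"
  proof -
    have "e * (a + c) = a * c - b\<^sup>2" unfolding e_def using \<open>a > 0\<close> \<open>c > 0\<close> by simp
    then show ?thesis by (simp add: power2_eq_square algebra_simps)
  qed
  have pos: "a * x\<^sup>2 + 2 * b * (x * y) + c * y\<^sup>2 \<ge> e * (x\<^sup>2 + y\<^sup>2)" for x y
  proof -
    have "(a - e) * (a * x\<^sup>2 + 2 * b * (x * y) + c * y\<^sup>2 - e * (x\<^sup>2 + y\<^sup>2))
        = ((a - e) * x + b * y)\<^sup>2 + ((a - e) * (c - e) - b\<^sup>2) * y\<^sup>2"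
      by (simp add: power2_eq_square algebra_simps)
    also have "\<dots> \<ge> 0" unfolding disc by simp
    finally show ?thesis using \<open>a - e > 0\<close> by (simp add: zero_le_mult_iff)
  qed
  \<comment> \<open>Moving every entry by at most \<open>d\<close> changes the form by at most
    \<open>2 * d * (x\<^sup>2 + y\<^sup>2)\<close>, which uses up half of \<open>e\<close>; the
    other half gives \<open>C\<close>.\<close>
  define d where "d = e / 4"
  define C where "C = pi * e / 2"
  have "d > 0" "C > 0" using \<open>e > 0\<close> by (auto simp: d_def C_def)
  define D where "D = 2 * pi * R"
  \<comment> \<open>\<open>K\<close> is the maximum of
    \<open>(D + 1) * \<bar>x\<bar> - C * x\<^sup>2\<close>, found by completing the square; the
    additional 1 leaves the decay \<open>exp (- \<bar>x\<bar>)\<close>.\<close>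
  define K where "K = (D + 1)\<^sup>2 / (4 * C)"
  have sq: "- C * x\<^sup>2 + D * \<bar>x\<bar> \<le> K - \<bar>x\<bar>" for x
  proof -
    have "0 \<le> (2 * C * \<bar>x\<bar> - (D + 1))\<^sup>2" by simp
    also have "\<dots> = 4 * C * (C * x\<^sup>2 - (D + 1) * \<bar>x\<bar>) + (D + 1)\<^sup>2"
      by (simp add: power2_eq_square algebra_simps)
    finally show ?thesis unfolding K_def using \<open>C > 0\<close> by (simp add: field_simps)
  qed
  define M where "M n = exp (2 * K) * exp (- \<bar>of_int (n $ 1)\<bar> - \<bar>of_int (n $ 2)\<bar>)" for n :: "int ^ 2"
  have "M summable_on UNIV"
    unfolding M_def by (intro summable_on_cmult_right summable_on_exp_abs_int2)
  moreover have "norm (theta_term z \<tau> n) \<le> M n"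
    if \<tau>: "\<And>k l. norm (\<tau> $ k $ l - \<tau>\<^sub>0 $ k $ l) \<le> d" and z: "\<And>k. norm (z $ k) \<le> R" for \<tau> z n
  proof -
    define x y :: real where "x = of_int (n $ 1)" and "y = of_int (n $ 2)"
    have Im: "\<bar>Im (\<tau> $ k $ l) - Im (\<tau>\<^sub>0 $ k $ l)\<bar> \<le> d" for k l
      using \<tau>[of k l] abs_Im_le_cmod[of "\<tau> $ k $ l - \<tau>\<^sub>0 $ k $ l"] by simp
    have t11: "Im (\<tau> $ 1 $ 1) * x\<^sup>2 \<ge> a * x\<^sup>2 - d * x\<^sup>2"
      using mult_right_mono[of "a - d" "Im (\<tau> $ 1 $ 1)" "x\<^sup>2"] Im[of 1 1]
      by (simp add: a_def algebra_simps)
    have t22: "Im (\<tau> $ 2 $ 2) * y\<^sup>2 \<ge> c * y\<^sup>2 - d * y\<^sup>2"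
      using mult_right_mono[of "c - d" "Im (\<tau> $ 2 $ 2)" "y\<^sup>2"] Im[of 2 2]
      by (simp add: c_def algebra_simps)
    have "\<bar>(Im (\<tau> $ 1 $ 2) + Im (\<tau> $ 2 $ 1) - 2 * b) * (x * y)\<bar> \<le> (2 * d) * \<bar>x * y\<bar>"
      unfolding abs_mult[of _ "x * y"] using Im[of 1 2] Im[of 2 1] b'
      by (intro mult_right_mono) (auto simp: b_def)
    also have "\<dots> \<le> d * (x\<^sup>2 + y\<^sup>2)"
      using mult_left_mono[OF sum_squares_bound[of "\<bar>x\<bar>" "\<bar>y\<bar>"], of d] \<open>d > 0\<close>
      by (simp add: abs_mult algebra_simps)
    finally have t12: "(Im (\<tau> $ 1 $ 2) + Im (\<tau> $ 2 $ 1)) * (x * y) \<ge> 2 * b * (x * y) - d * (x\<^sup>2 + y\<^sup>2)"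
      by (simp add: algebra_simps)
    have "Im (\<tau> $ 1 $ 1) * x\<^sup>2 + (Im (\<tau> $ 1 $ 2) + Im (\<tau> $ 2 $ 1)) * (x * y) + Im (\<tau> $ 2 $ 2) * y\<^sup>2
        \<ge> e * (x\<^sup>2 + y\<^sup>2) - 2 * d * (x\<^sup>2 + y\<^sup>2)"
      using t11 t22 t12 pos[of x y] by (simp add: algebra_simps)
    then have "pi * (Im (\<tau> $ 1 $ 1) * x\<^sup>2 + (Im (\<tau> $ 1 $ 2) + Im (\<tau> $ 2 $ 1)) * (x * y) + Im (\<tau> $ 2 $ 2) * y\<^sup>2)
        \<ge> pi * (e / 2 * (x\<^sup>2 + y\<^sup>2))"
      by (intro mult_left_mono) (auto simp: d_def algebra_simps)
    moreover have "- (2 * pi * (x * Im (z $ 1) + y * Im (z $ 2))) \<le> D * \<bar>x\<bar> + D * \<bar>y\<bar>"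
    proof -
      have "\<bar>x * Im (z $ 1) + y * Im (z $ 2)\<bar> \<le> \<bar>x\<bar> * R + \<bar>y\<bar> * R"
        using z[of 1] z[of 2] abs_Im_le_cmod[of "z $ 1"] abs_Im_le_cmod[of "z $ 2"]
        by (intro order_trans[OF abs_triangle_ineq] add_mono) (auto simp: abs_mult intro!: mult_left_mono)
      then have "- (x * Im (z $ 1) + y * Im (z $ 2)) \<le> \<bar>x\<bar> * R + \<bar>y\<bar> * R" by linarith
      then have "2 * pi * - (x * Im (z $ 1) + y * Im (z $ 2)) \<le> 2 * pi * (\<bar>x\<bar> * R + \<bar>y\<bar> * R)"
        by (intro mult_left_mono) auto
      then show ?thesis by (simp add: D_def algebra_simps)
    qed
    ultimately have "norm (theta_term z \<tau> n) \<le> exp ((- C * x\<^sup>2 + D * \<bar>x\<bar>) + (- C * y\<^sup>2 + D * \<bar>y\<bar>))"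
      unfolding norm_theta_term x_def[symmetric] y_def[symmetric] exp_le_cancel_iff
      by (simp add: C_def algebra_simps)
    also have "\<dots> \<le> exp ((K - \<bar>x\<bar>) + (K - \<bar>y\<bar>))"
      using sq[of x] sq[of y] by simp
    also have "\<dots> = M n"
      unfolding M_def x_def y_def exp_add[symmetric] by (simp add: algebra_simps)
    finally show ?thesis .
  qed
  ultimately show ?thesis using \<open>d > 0\<close> by metis
qed

lemma holomorphic_theta_term:
  assumes "\<And>k. (\<lambda>t. z t $ k) holomorphic_on S" "\<And>k l. (\<lambda>t. \<tau> t $ k $ l) holomorphic_on S"
  shows "(\<lambda>t. theta_term (z t) (\<tau> t) n) holomorphic_on S"
  unfolding theta_term_def bdot_def cvec_def matrix_vector_mult_def sum_2 using assms
  by (auto intro!: holomorphic_intros)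

text \<open>Stated along a holomorphic curve \<open>t \<mapsto> (z t, \<tau> t)\<close>, so that
  one-variable function theory covers the dependence on \<open>z\<close> as well as on
  \<open>\<tau>\<close>. The majorant makes the partial sums converge locally uniformly.\<close>

lemma holomorphic_riemann_theta:
  assumes "open S"
    and z: "\<And>k. (\<lambda>t. z t $ k) holomorphic_on S"
    and \<tau>: "\<And>k l. (\<lambda>t. \<tau> t $ k $ l) holomorphic_on S"
    and H2: "\<And>t. t \<in> S \<Longrightarrow> \<tau> t \<in> siegel_H2"
  shows "(\<lambda>t. riemann_theta (z t) (\<tau> t)) holomorphic_on S"
proof -
  have "\<exists>r>0. (\<lambda>t. riemann_theta (z t) (\<tau> t)) holomorphic_on ball t0 r" if t0: "t0 \<in> S" for t0
  proof -
    define R where "R = norm (z t0) + 1"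
    have "R \<ge> 0" by (simp add: R_def)
    obtain d M where "d > 0" and M: "M summable_on UNIV" "\<forall>\<tau>' z' n. (\<forall>k l. norm (\<tau>' $ k $ l - \<tau> t0 $ k $ l) \<le> d) \<longrightarrow>
       (\<forall>k. norm (z' $ k) \<le> R) \<longrightarrow> norm (theta_term z' \<tau>' n) \<le> M n"
      using theta_term_majorant[OF H2[OF t0] \<open>R \<ge> 0\<close>] by blast
    have zc: "((\<lambda>t. z t $ k) \<longlongrightarrow> z t0 $ k) (nhds t0)" for k
    proof -
      have "continuous_on S (\<lambda>t. z t $ k)" by (rule holomorphic_on_imp_continuous_on[OF z])
      then have "isCont (\<lambda>t. z t $ k) t0" unfolding continuous_on_eq_continuous_at[OF \<open>open S\<close>] using t0 by blast
      then show ?thesis unfolding isCont_def by (rule tendsto_at_iff_tendsto_nhds[THEN iffD1])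
    qed
    have \<tau>c: "((\<lambda>t. \<tau> t $ k $ l) \<longlongrightarrow> \<tau> t0 $ k $ l) (nhds t0)" for k l
    proof -
      have "continuous_on S (\<lambda>t. \<tau> t $ k $ l)" by (rule holomorphic_on_imp_continuous_on[OF \<tau>])
      then have "isCont (\<lambda>t. \<tau> t $ k $ l) t0" unfolding continuous_on_eq_continuous_at[OF \<open>open S\<close>] using t0 by blast
      then show ?thesis unfolding isCont_def by (rule tendsto_at_iff_tendsto_nhds[THEN iffD1])
    qed
    have ez: "eventually (\<lambda>t. norm (z t $ k) \<le> R) (nhds t0)" for k
    proof -
      have "eventually (\<lambda>t. dist (z t $ k) (z t0 $ k) < 1) (nhds t0)"
        by (rule tendstoD[OF zc]) simp
      then show ?thesis
      proof eventually_elim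
        case (elim t)
        then show ?case
          using Finite_Cartesian_Product.norm_nth_le[of "z t0" k] norm_triangle_sub[of "z t $ k" "z t0 $ k"]
          by (simp add: R_def dist_norm)
      qed
    qed
    have e\<tau>: "eventually (\<lambda>t. norm (\<tau> t $ k $ l - \<tau> t0 $ k $ l) \<le> d) (nhds t0)" for k l
    proof -
      have "eventually (\<lambda>t. dist (\<tau> t $ k $ l) (\<tau> t0 $ k $ l) < d) (nhds t0)"
        by (rule tendstoD[OF \<tau>c \<open>d > 0\<close>])
      then show ?thesis by eventually_elim (simp add: dist_norm)
    qed
    have "eventually (\<lambda>t. t \<in> S) (nhds t0)"
      using \<open>open S\<close> t0 by (simp add: eventually_nhds_in_open)
    then have "eventually (\<lambda>t. t \<in> S \<and> (\<forall>k. norm (z t $ k) \<le> R) \<and>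
        (\<forall>k l. norm (\<tau> t $ k $ l - \<tau> t0 $ k $ l) \<le> d)) (nhds t0)"
      unfolding forall_2 using ez e\<tau> by (intro eventually_conj) auto
    then obtain r where "r > 0" and r: "\<And>t. dist t t0 < r \<Longrightarrow> t \<in> S \<and> (\<forall>k. norm (z t $ k) \<le> R) \<and>
        (\<forall>k l. norm (\<tau> t $ k $ l - \<tau> t0 $ k $ l) \<le> d)"
      unfolding eventually_nhds_metric by blast
    have sub: "cball t0 (r / 2) \<subseteq> S" and bd: "\<And>t n. t \<in> cball t0 (r / 2) \<Longrightarrow> norm (theta_term (z t) (\<tau> t) n) \<le> M n"
      using r \<open>r > 0\<close> by (auto simp: dist_commute intro!: M(2)[rule_format])
    have hol: "(\<lambda>t. theta_term (z t) (\<tau> t) n) holomorphic_on S" for n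
      by (rule holomorphic_theta_term) (use z \<tau> in auto)
    have u: "uniform_limit (cball t0 (r / 2)) (\<lambda>X t. \<Sum>n\<in>X. theta_term (z t) (\<tau> t) n)
        (\<lambda>t. riemann_theta (z t) (\<tau> t)) (finite_subsets_at_top UNIV)"
      unfolding riemann_theta_def
      by (rule Weierstrass_m_test_general[OF bd M(1)])
    obtain "(\<lambda>t. riemann_theta (z t) (\<tau> t)) holomorphic_on ball t0 (r / 2)"
    proof (rule holomorphic_uniform_limit[OF _ u])
      have "(\<lambda>t. \<Sum>n\<in>X. theta_term (z t) (\<tau> t) n) holomorphic_on cball t0 (r / 2)" for X
        by (intro holomorphic_on_sum holomorphic_on_subset[OF hol sub])
      then show "\<forall>\<^sub>F X in finite_subsets_at_top UNIV.
         continuous_on (cball t0 (r / 2)) (\<lambda>t. \<Sum>n\<in>X. theta_term (z t) (\<tau> t) n) \<and>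
         (\<lambda>t. \<Sum>n\<in>X. theta_term (z t) (\<tau> t) n) holomorphic_on ball t0 (r / 2)"
        using holomorphic_on_subset[OF _ ball_subset_cball]
        by (intro always_eventually allI conjI holomorphic_on_imp_continuous_on) blast+
    qed auto
    then show ?thesis using \<open>r > 0\<close> by (intro exI[of _ "r / 2"]) auto
  qed
  then show ?thesis
    unfolding holomorphic_on_def
    by (metis holomorphic_on_def holomorphic_on_imp_differentiable_at open_ball centre_in_ball field_differentiable_at_within)
qed

text \<open>Joint continuity in the two coordinates of \<open>z\<close> is what exchanging the
  integrals over the torus requires.\<close>

lemma continuous_riemann_theta:
  assumes "\<tau> \<in> siegel_H2"
  shows "continuous_on UNIV (\<lambda>z. riemann_theta z \<tau>)"
proof -
  have "isCont (\<lambda>z. riemann_theta z \<tau>) z0" for z0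
  proof -
    have "norm z0 + 1 \<ge> 0" by simp
    obtain d M where "d > 0" and M: "M summable_on UNIV" "\<forall>\<tau>' z' n. (\<forall>k l. norm (\<tau>' $ k $ l - \<tau> $ k $ l) \<le> d) \<longrightarrow>
       (\<forall>k. norm (z' $ k) \<le> norm z0 + 1) \<longrightarrow> norm (theta_term z' \<tau>' n) \<le> M n"
      using theta_term_majorant[OF assms \<open>norm z0 + 1 \<ge> 0\<close>] by blast
    have "continuous_on (ball z0 1) (\<lambda>z. riemann_theta z \<tau>)"
      unfolding riemann_theta_def
    proof (rule uniform_limit_theorem[OF _ Weierstrass_m_test_general[OF _ M(1)]])
      show "norm (theta_term z \<tau> n) \<le> M n" if "z \<in> ball z0 1" for z n
      proof (rule M(2)[rule_format])
        fix k
        have "norm (z $ k) \<le> norm z" by (rule Finite_Cartesian_Product.norm_nth_le)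
        also have "\<dots> \<le> norm z0 + 1"
          using that norm_triangle_sub[of z z0] by (simp add: dist_norm norm_minus_commute)
        finally show "norm (z $ k) \<le> norm z0 + 1" .
      qed (use \<open>d > 0\<close> in auto)
      show "\<forall>\<^sub>F X in finite_subsets_at_top UNIV. continuous_on (ball z0 1) (\<lambda>z. \<Sum>n\<in>X. theta_term z \<tau> n)"
        unfolding theta_term_def bdot_def
        by (intro always_eventually allI continuous_intros)
    qed simp
    then show ?thesis by (simp add: continuous_on_eq_continuous_at)
  qed
  then show ?thesis by (simp add: continuous_at_imp_continuous_on)
qed

section \<open>Quasi-periods of theta and uniqueness\<close>

lemma bdot_simps:
  "bdot (u + v) w = bdot u w + bdot v w" "bdot u (v + w) = bdot u v + bdot u w"
  "bdot (- u) w = - bdot u w" "bdot u (- w) = - bdot u w"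
  "bdot (u - v) w = bdot u w - bdot v w" "bdot u (v - w) = bdot u v - bdot u w"
  by (simp_all add: bdot_def algebra_simps)

lemma bdot_commute: "bdot u v = bdot v u"
  by (simp add: bdot_def algebra_simps)

lemma bdot_matrix: "bdot u (A *v v) = bdot (transpose A *v u) v"
  by (simp add: bdot_def matrix_vector_mult_def transpose_def sum_2 algebra_simps)

lemma bdot_symmetric: "transpose A = A \<Longrightarrow> bdot u (A *v v) = bdot v (A *v u)"
  by (metis bdot_matrix bdot_commute)

lemma cvec_simps:
  "cvec (m + n) = cvec m + cvec n" "cvec (- m) = - cvec m" "cvec (m - n) = cvec m - cvec n"
  "cvec 0 = 0" "cvec m $ k = of_int (m $ k)"
  by (simp_all add: cvec_def vec_eq_iff)

lemma bdot_cvec: "bdot (cvec m) (cvec n) = of_int (bdot m n)"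
  by (simp add: bdot_def cvec_def)

lemma riemann_theta_quasi:
  assumes "transpose \<tau> = \<tau>"
  shows "riemann_theta (z + \<tau> *v cvec m) \<tau>
    = exp (- \<i> * of_real pi * bdot (cvec m) (\<tau> *v cvec m) - 2 * of_real pi * \<i> * bdot (cvec m) z)
      * riemann_theta z \<tau>"
proof -
  let ?c = "exp (- \<i> * of_real pi * bdot (cvec m) (\<tau> *v cvec m) - 2 * of_real pi * \<i> * bdot (cvec m) z)"
  have "theta_term (z + \<tau> *v cvec m) \<tau> n = ?c * theta_term z \<tau> (n + m)" for n
    unfolding theta_term_def exp_add[symmetric]
    using bdot_symmetric[OF assms, of "cvec m" "cvec n"]
    by (simp add: bdot_simps cvec_simps matrix_vector_right_distrib algebra_simps)
  then have "riemann_theta (z + \<tau> *v cvec m) \<tau> = ?c * (\<Sum>\<^sub>\<infinity>n. theta_term z \<tau> (n + m))"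
    unfolding riemann_theta_def infsum_cmult_right'[symmetric] by (rule infsum_cong)
  also have "(\<Sum>\<^sub>\<infinity>n. theta_term z \<tau> (n + m)) = riemann_theta z \<tau>"
    unfolding riemann_theta_def
    by (rule infsum_reindex_bij_betw[of "\<lambda>n. n + m" UNIV UNIV])
      (rule bij_betw_byWitness[where f' = "\<lambda>n. n - m"]; simp)
  finally show ?thesis .
qed

lemma riemann_theta_periodic: "riemann_theta (z + cvec m) \<tau> = riemann_theta z \<tau>"
proof -
  have "theta_term (z + cvec m) \<tau> n = theta_term z \<tau> n" for n
  proof -
    have "theta_term (z + cvec m) \<tau> n = theta_term z \<tau> n * exp (2 * of_real pi * \<i> * of_int (bdot n m))"
      unfolding theta_term_def exp_add[symmetric]
      by (simp add: bdot_simps bdot_cvec algebra_simps)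
    also have "exp (2 * of_real pi * \<i> * of_int (bdot n m)) = 1"
      using exp_integer_2pi[of "of_int (bdot n m)"] by (simp add: algebra_simps)
    finally show ?thesis by simp
  qed
  then show ?thesis by (simp add: riemann_theta_def)
qed

lemma integral_exp_int:
  "integral {0..1} (\<lambda>x. exp (2 * of_real pi * \<i> * (of_int k * of_real x))) = (if k = 0 then 1 else 0)"
proof (cases "k = 0")
  case False
  let ?c = "2 * of_real pi * \<i> * of_int k :: complex"
  have "((\<lambda>x. exp (?c * of_real x) / ?c) has_vector_derivative exp (?c * of_real x)) (at x within {0..1})"
    for x :: real
  proof -
    have "((\<lambda>z. exp (?c * z) / ?c) has_field_derivative exp (?c * of_real x)) (at (of_real x))"
      using False by (auto intro!: derivative_eq_intros)
    then show ?thesis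
      using has_vector_derivative_real_field has_vector_derivative_at_within by fastforce
  qed
  then have "((\<lambda>x. exp (?c * of_real x)) has_integral exp (?c * of_real 1) / ?c - exp (?c * of_real 0) / ?c) {0..1}"
    by (intro fundamental_theorem_of_calculus) auto
  moreover have "exp ?c = 1"
    using exp_integer_2pi[of "of_int k"] by (simp add: algebra_simps)
  ultimately show ?thesis using False by (simp add: integral_unique algebra_simps)
qed simp

abbreviation cvec2 :: "complex \<Rightarrow> complex \<Rightarrow> complex ^ 2" where
  "cvec2 x y \<equiv> \<chi> k. if k = 1 then x else y"

lemma continuous_cvec2:
  assumes "continuous_on A f" "continuous_on A g"
  shows "continuous_on A (\<lambda>x. cvec2 (f x) (g x))"
proof (rule continuous_on_vec_lambda)
  show "continuous_on A (\<lambda>x. if k = 1 then f x else g x)" for k :: 2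
    using assms by (cases "k = 1") simp_all
qed

text \<open>The mean over the real torus is the Fourier coefficient of index 0, that is, the term
  \<open>n = 0\<close>. The value normalizes the uniqueness statement and shows that theta is not
  identically zero.\<close>

lemma riemann_theta_mean:
  assumes "\<tau> \<in> siegel_H2"
  shows "integral {0..1} (\<lambda>s. integral {0..1} (\<lambda>t. riemann_theta (cvec2 (of_real s) (of_real t)) \<tau>)) = 1"
proof -
  define q where "q n = exp (\<i> * of_real pi * bdot (cvec n) (\<tau> *v cvec n))" for n
  define E where "E n s t = q n * exp (2 * of_real pi * \<i> * (of_int (n $ 1) * of_real s))
     * exp (2 * of_real pi * \<i> * (of_int (n $ 2) * of_real t))" for n :: "int ^ 2" and s t :: real
  have E: "theta_term (cvec2 (of_real s) (of_real t)) \<tau> n = E n s t" for n s t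
    unfolding theta_term_def E_def q_def exp_add[symmetric]
    by (simp add: bdot_def cvec_simps algebra_simps)
  define T where "T s t = riemann_theta (cvec2 (of_real s) (of_real t)) \<tau>" for s t
  have contT: "continuous_on A (\<lambda>(s, t). T s t)" for A
    unfolding T_def case_prod_unfold
    by (rule continuous_on_compose2[OF continuous_riemann_theta[OF assms] continuous_cvec2])
      (auto intro!: continuous_intros)
  have contT1: "continuous_on A (T s)" for A s
    using continuous_on_compose2[OF contT[of UNIV], of A "\<lambda>t. (s, t)"] by (simp add: continuous_on_Pair)
  have contE: "continuous_on A (E n s)" for A n s
    unfolding E_def by (intro continuous_intros)
  have contT2: "continuous_on {0..1} (\<lambda>s. integral {0..1} (T s))"
    using integral_continuous_on_param[of "{0..1}" 0 1 T] contT by simp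
  have norm_le: "norm (integral {0..1} (\<lambda>s. integral {0..1} (T s)) - 1) \<le> e" if "e > 0" for e
  proof -
    obtain d M where "d > 0" and M: "M summable_on UNIV" "\<forall>\<tau>' z' n. (\<forall>k l. norm (\<tau>' $ k $ l - \<tau> $ k $ l) \<le> d) \<longrightarrow>
       (\<forall>k. norm (z' $ k) \<le> 1) \<longrightarrow> norm (theta_term z' \<tau>' n) \<le> M n"
      using theta_term_majorant[OF assms zero_le_one] by blast
    have "uniform_limit ({0..1} \<times> {0..1}) (\<lambda>X p. \<Sum>n\<in>X. E n (fst p) (snd p)) (\<lambda>p. T (fst p) (snd p))
        (finite_subsets_at_top UNIV)"
      unfolding T_def riemann_theta_def E
    proof (rule Weierstrass_m_test_general[OF _ M(1)])
      show "norm (E n (fst p) (snd p)) \<le> M n" if "p \<in> {0..1} \<times> {0..1}" for n p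
        unfolding E[symmetric] by (rule M(2)[rule_format]) (use that \<open>d > 0\<close> in auto)
    qed
    from uniform_limitD[OF this \<open>e > 0\<close>]
    obtain X0 where X0: "finite X0" and X: "\<And>X. finite X \<Longrightarrow> X0 \<subseteq> X \<Longrightarrow>
        \<forall>p\<in>{0..1} \<times> {0..1}. dist (\<Sum>n\<in>X. E n (fst p) (snd p)) (T (fst p) (snd p)) < e"
      unfolding eventually_finite_subsets_at_top by auto
    \<comment> \<open>The index 0 is included by force, since its term carries the whole
      mean.\<close>
    define X1 where "X1 = insert 0 X0"
    define S where "S s t = (\<Sum>n\<in>X1. E n s t)" for s t
    have fin: "finite X1" using X0 by (simp add: X1_def)
    have close: "norm (T s t - S s t) \<le> e" if "s \<in> {0..1}" "t \<in> {0..1}" for s t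
      using X[of X1] fin that unfolding X1_def[symmetric] S_def
      by (force simp: X1_def dist_norm norm_minus_commute)
    have contS: "continuous_on A (S s)" for A s
      unfolding S_def E_def by (intro continuous_intros)
    have inner: "integral {0..1} (S s) = (\<Sum>n\<in>X1. q n * exp (2 * of_real pi * \<i> * (of_int (n $ 1) * of_real s))
        * (if n $ 2 = 0 then 1 else 0))" for s
    proof -
      have "integral {0..1} (S s) = (\<Sum>n\<in>X1. integral {0..1} (E n s))"
        unfolding S_def by (rule integral_sum[OF fin]) (intro integrable_continuous_real contE)
      then show ?thesis
        unfolding E_def by (simp only: integral_mult_right integral_exp_int)
    qed
    have contS2: "continuous_on {0..1} (\<lambda>s. integral {0..1} (S s))"
      unfolding inner by (intro continuous_intros)
    have "integral {0..1} (\<lambda>s. integral {0..1} (S s))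
        = (\<Sum>n\<in>X1. q n * (if n $ 1 = 0 then 1 else 0) * (if n $ 2 = 0 then 1 else 0))"
      unfolding inner
      by (subst integral_sum[OF fin]) (auto simp: integral_exp_int intro!: integrable_continuous_real continuous_intros)
    also have "\<dots> = (\<Sum>n\<in>X1. if n = 0 then 1 else 0)"
      by (intro sum.cong refl) (auto simp: vec_eq_iff forall_2 q_def bdot_def cvec_simps)
    also have "\<dots> = 1" using fin by (simp add: X1_def)
    finally have one: "integral {0..1} (\<lambda>s. integral {0..1} (S s)) = 1" .
    have "integral {0..1} (\<lambda>s. integral {0..1} (T s)) - 1
        = integral {0..1} (\<lambda>s. integral {0..1} (T s) - integral {0..1} (S s))"
      unfolding one[symmetric]
      by (rule integral_diff[symmetric]; intro integrable_continuous_real contT2 contS2)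
    also have "\<dots> = integral {0..1} (\<lambda>s. integral {0..1} (\<lambda>t. T s t - S s t))"
      by (intro integral_cong integral_diff[symmetric] integrable_continuous_real contT1 contS)
    also have "norm \<dots> \<le> e * (1 - 0)"
    proof (rule integral_bound)
      show "continuous_on {0..1} (\<lambda>s. integral {0..1} (\<lambda>t. T s t - S s t))"
        using continuous_on_diff[OF contT2 contS2]
        by (subst integral_diff) (auto intro!: integrable_continuous_real contT1 contS)
      fix s :: real assume s: "s \<in> {0..1}"
      have "norm (integral {0..1} (\<lambda>t. T s t - S s t)) \<le> e * (1 - 0)"
        by (rule integral_bound) (use s close in \<open>auto intro!: continuous_intros contT1 contS\<close>)
      then show "norm (integral {0..1} (\<lambda>t. T s t - S s t)) \<le> e" by simp
    qed simp
    finally show ?thesis by simp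
  qed
  have "norm (integral {0..1} (\<lambda>s. integral {0..1} (T s)) - 1) \<le> 0"
    by (rule field_le_epsilon) (use norm_le in simp)
  then show ?thesis by (simp add: T_def[abs_def])
qed

lemma cvec2_eta: "cvec2 (z $ 1) (z $ 2) = z"
  by (simp add: vec_eq_iff forall_2)

text \<open>With \<open>\<kappa>\<close> the mean of \<open>\<phi>\<close>, the difference of
  \<open>\<phi>\<close> and \<open>\<kappa>\<close> times theta has the same quasi-periods and mean
  0, because theta has mean 1. Such a difference is zero.\<close>

lemma riemann_theta_unique:
  assumes \<tau>: "\<tau> \<in> siegel_H2"
    and hol1: "\<And>y. (\<lambda>x. \<phi> (cvec2 x y)) holomorphic_on UNIV"
    and hol2: "\<And>x. (\<lambda>y. \<phi> (cvec2 x y)) holomorphic_on UNIV"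
    and cont: "continuous_on UNIV \<phi>"
    and per: "\<And>z m. \<phi> (z + cvec m) = \<phi> z"
    and quasi: "\<And>z m. \<phi> (z + \<tau> *v cvec m)
      = exp (- \<i> * of_real pi * bdot (cvec m) (\<tau> *v cvec m) - 2 * of_real pi * \<i> * bdot (cvec m) z) * \<phi> z"
  obtains \<kappa> where "\<And>z. \<phi> z = \<kappa> * riemann_theta z \<tau>"
proof -
  have sym: "transpose \<tau> = \<tau>" using \<tau> by (simp add: siegel_H2_def)
  define \<kappa> where "\<kappa> = integral {0..1} (\<lambda>s. integral {0..1} (\<lambda>t. \<phi> (cvec2 (of_real s) (of_real t))))"
  define \<psi> where "\<psi> x y = \<phi> (cvec2 x y) - \<kappa> * riemann_theta (cvec2 x y) \<tau>" for x y
  have H: "(\<lambda>t. riemann_theta (cvec2 (f t) (g t)) \<tau>) holomorphic_on UNIV"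
    if "f holomorphic_on UNIV" "g holomorphic_on UNIV" for f g
  proof (rule holomorphic_riemann_theta)
    show "(\<lambda>t. cvec2 (f t) (g t) $ k) holomorphic_on UNIV" for k
      using that by (cases "k = 1") simp_all
  qed (use \<tau> in auto)
  have contc: "continuous_on A (\<lambda>p. F (cvec2 (f p) (g p)))"
    if "continuous_on UNIV F" "continuous_on A f" "continuous_on A g"
    for A f g and F :: "complex ^ 2 \<Rightarrow> complex"
    by (rule continuous_on_compose2[OF that(1) continuous_cvec2[OF that(2,3)]]) auto
  have "\<psi> x y = 0" for x y
  proof (rule quasi_periodic_eq_0_of_mean[where \<phi> = \<psi> and P = "\<lambda>k l. (\<tau> *v cvec (vector [k, l])) $ 1"
        and Q = "\<lambda>k l. (\<tau> *v cvec (vector [k, l])) $ 2"])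
    show "(\<lambda>x. \<psi> x y) holomorphic_on UNIV" "\<psi> x holomorphic_on UNIV" for x y
      unfolding \<psi>_def[abs_def] by (intro holomorphic_intros hol1 hol2 H)+
    show "continuous_on UNIV (\<lambda>(x, y). \<psi> x y)"
      unfolding \<psi>_def case_prod_unfold
      by (intro continuous_intros contc cont continuous_riemann_theta \<tau>)
    have shift: "cvec2 (x + 1) y = cvec2 x y + cvec (vector [1, 0])"
      "cvec2 x (y + 1) = cvec2 x y + cvec (vector [0, 1])" for x y
      by (simp_all add: vec_eq_iff forall_2 cvec_simps)
    show "\<psi> (x + 1) y = \<psi> x y" "\<psi> x (y + 1) = \<psi> x y" for x y
      unfolding \<psi>_def shift by (simp_all add: per riemann_theta_periodic)
    fix k l :: int
    let ?m = "vector [k, l] :: int ^ 2"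
    have sh: "cvec2 (x + (\<tau> *v cvec ?m) $ 1) (y + (\<tau> *v cvec ?m) $ 2) = cvec2 x y + \<tau> *v cvec ?m" for x y
      by (simp add: vec_eq_iff forall_2)
    have eq: "exp (- \<i> * of_real pi * bdot (cvec ?m) (\<tau> *v cvec ?m) - 2 * of_real pi * \<i> * bdot (cvec ?m) (cvec2 x y))
        = exp (- \<i> * of_real pi * bdot (cvec ?m) (\<tau> *v cvec ?m))
        * exp (- 2 * of_real pi * \<i> * (of_int k * x + of_int l * y))" for x y
      unfolding exp_add[symmetric]
      by (rule arg_cong[of _ _ exp]) (simp add: bdot_def[of _ "cvec2 x y"] cvec_simps algebra_simps)
    have "\<psi> (x + (\<tau> *v cvec ?m) $ 1) (y + (\<tau> *v cvec ?m) $ 2)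
        = exp (- \<i> * of_real pi * bdot (cvec ?m) (\<tau> *v cvec ?m))
        * exp (- 2 * of_real pi * \<i> * (of_int k * x + of_int l * y)) * \<psi> x y" for x y
      unfolding \<psi>_def sh quasi riemann_theta_quasi[OF sym] eq by (simp add: algebra_simps)
    then show "\<exists>c. \<forall>x y. \<psi> (x + (\<tau> *v cvec ?m) $ 1) (y + (\<tau> *v cvec ?m) $ 2)
        = c * exp (- 2 * of_real pi * \<i> * (of_int k * x + of_int l * y)) * \<psi> x y" by blast
  next
    define f where "f s t = \<phi> (cvec2 (of_real s) (of_real t))" for s t
    define g where "g s t = riemann_theta (cvec2 (of_real s) (of_real t)) \<tau>" for s t
    have cf: "continuous_on A (\<lambda>(s, t). f s t)" and cg: "continuous_on A (\<lambda>(s, t). g s t)" for A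
      unfolding f_def g_def case_prod_unfold
      by (intro continuous_intros contc cont continuous_riemann_theta \<tau>)+
    have cf1: "continuous_on A (f s)" and cg1: "continuous_on A (g s)" for A s
      unfolding f_def g_def
      by (intro continuous_intros contc cont continuous_riemann_theta \<tau>)+
    have cf2: "continuous_on {0..1} (\<lambda>s. integral {0..1} (f s))"
      using integral_continuous_on_param[of "{0..1}" 0 1 f] cf by simp
    have cg2: "continuous_on {0..1} (\<lambda>s. integral {0..1} (g s))"
      using integral_continuous_on_param[of "{0..1}" 0 1 g] cg by simp
    have "integral {0..1} (\<lambda>s. integral {0..1} (\<lambda>t. f s t - \<kappa> * g s t))
        = integral {0..1} (\<lambda>s. integral {0..1} (f s) - \<kappa> * integral {0..1} (g s))"
      by (subst integral_diff) (auto intro!: integrable_continuous_real continuous_intros cf1 cg1)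
    also have "\<dots> = integral {0..1} (\<lambda>s. integral {0..1} (f s)) - \<kappa> * integral {0..1} (\<lambda>s. integral {0..1} (g s))"
      by (subst integral_diff) (auto intro!: integrable_continuous_real continuous_intros cf2 cg2)
    also have "\<dots> = 0"
      using riemann_theta_mean[OF \<tau>] by (simp add: \<kappa>_def f_def[abs_def] g_def[abs_def])
    finally show "integral {0..1} (\<lambda>s. integral {0..1} (\<lambda>t. \<psi> (of_real s) (of_real t))) = 0"
      by (simp add: \<psi>_def f_def g_def)
  qed
  then show ?thesis
    using that[of \<kappa>] unfolding \<psi>_def by (metis cvec2_eta eq_iff_diff_eq_0)
qed

lemma riemann_theta_nonzero:
  assumes "\<tau> \<in> siegel_H2"
  obtains z where "riemann_theta z \<tau> \<noteq> 0"
  using riemann_theta_mean[OF assms] by fastforce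

section \<open>The symplectic group and its action\<close>

declare transpose_matrix_vector [simp del] vector_transpose_matrix [simp del]

section \<open>Block calculus and symplectic relations\<close>

lemma sum_UNIV_Plus:
  "(\<Sum>k\<in>(UNIV :: ('a::finite + 'b::finite) set). f k) = (\<Sum>k\<in>UNIV. f (Inl k)) + (\<Sum>k\<in>UNIV. f (Inr k))"
  using sum.Plus[of "UNIV :: 'a set" "UNIV :: 'b set" f] by (simp add: o_def)

definition mat4_of_blocks :: "int ^ 2 ^ 2 \<Rightarrow> int ^ 2 ^ 2 \<Rightarrow> int ^ 2 ^ 2 \<Rightarrow> int ^ 2 ^ 2 \<Rightarrow> mat4" where
  "mat4_of_blocks A B C D = (\<chi> i j. case i of
      Inl k \<Rightarrow> (case j of Inl l \<Rightarrow> A $ k $ l | Inr l \<Rightarrow> B $ k $ l)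
    | Inr k \<Rightarrow> (case j of Inl l \<Rightarrow> C $ k $ l | Inr l \<Rightarrow> D $ k $ l))"

lemma blk_mat4_of_blocks [simp]:
  "blkA (mat4_of_blocks A B C D) = A" "blkB (mat4_of_blocks A B C D) = B"
  "blkC (mat4_of_blocks A B C D) = C" "blkD (mat4_of_blocks A B C D) = D"
  by (simp_all add: mat4_of_blocks_def blkA_def blkB_def blkC_def blkD_def)

lemma mat4_eq_iff:
  "M = N \<longleftrightarrow> blkA M = blkA N \<and> blkB M = blkB N \<and> blkC M = blkC N \<and> blkD M = blkD N"
proof
  assume "blkA M = blkA N \<and> blkB M = blkB N \<and> blkC M = blkC N \<and> blkD M = blkD N"
  then have "M $ i $ j = N $ i $ j" for i j
    by (cases i; cases j) (auto simp: blkA_def blkB_def blkC_def blkD_def vec_eq_iff)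
  then show "M = N" by (simp add: vec_eq_iff)
qed simp

lemma blk_mult:
  "blkA (M ** N) = blkA M ** blkA N + blkB M ** blkC N"
  "blkB (M ** N) = blkA M ** blkB N + blkB M ** blkD N"
  "blkC (M ** N) = blkC M ** blkA N + blkD M ** blkC N"
  "blkD (M ** N) = blkC M ** blkB N + blkD M ** blkD N"
  by (simp_all add: vec_eq_iff blkA_def blkB_def blkC_def blkD_def matrix_matrix_mult_def sum_UNIV_Plus)

lemma blk_transpose:
  "blkA (transpose M) = transpose (blkA M)" "blkB (transpose M) = transpose (blkC M)"
  "blkC (transpose M) = transpose (blkB M)" "blkD (transpose M) = transpose (blkD M)"
  by (simp_all add: blkA_def blkB_def blkC_def blkD_def transpose_def)

lemma blk_one:
  "blkA (mat 1) = mat 1" "blkB (mat 1) = 0" "blkC (mat 1) = 0" "blkD (mat 1) = mat 1"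
  by (simp_all add: blkA_def blkB_def blkC_def blkD_def mat_def vec_eq_iff)

lemma blk_sympl_form:
  "blkA sympl_form = 0" "blkB sympl_form = mat 1" "blkC sympl_form = - mat 1" "blkD sympl_form = 0"
  by (simp_all add: blkA_def blkB_def blkC_def blkD_def mat_def vec_eq_iff sympl_form_def)

lemma matrix_mult_minus:
  fixes A :: "'a::ring_1 ^ 'n ^ 'm"
  shows "(- A) ** B = - (A ** B)" "A ** (- C) = - (A ** C)"
  by (simp_all add: matrix_matrix_mult_def vec_eq_iff sum_negf)

lemma matrix_mult_zero:
  fixes A :: "'a::semiring_1 ^ 'n ^ 'm"
  shows "0 ** A = 0" "A ** 0 = 0"
  by (simp_all add: matrix_matrix_mult_def vec_eq_iff)

lemma matrix_mult_add_left:
  fixes A :: "'a::semiring_1 ^ 'n ^ 'm"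
  shows "(A + B) ** C = A ** C + B ** C"
  by (simp add: matrix_matrix_mult_def vec_eq_iff distrib_right sum.distrib)

lemma matrix_inv_mult:
  fixes A :: "'a::semiring_1 ^ 'n ^ 'n"
  assumes "invertible A"
  shows "A ** matrix_inv A = mat 1" "matrix_inv A ** A = mat 1"
  using someI_ex[OF assms[unfolded invertible_def]] by (simp_all add: matrix_inv_def)

lemma transpose_arith:
  "transpose (A + B) = transpose A + transpose B" "transpose (A - B) = transpose A - transpose (B :: 'a::ab_group_add ^ 'n ^ 'm)"
  "transpose (- B) = - transpose B" "transpose 0 = 0"
  by (simp_all add: transpose_def vec_eq_iff)

lemma Gamma2_iff:
  "M \<in> Gamma2 \<longleftrightarrow> transpose (blkA M) ** blkC M = transpose (blkC M) ** blkA M \<and>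
     transpose (blkB M) ** blkD M = transpose (blkD M) ** blkB M \<and>
     transpose (blkA M) ** blkD M - transpose (blkC M) ** blkB M = mat 1"
  (is "_ \<longleftrightarrow> ?A \<and> ?B \<and> ?C")
proof -
  have "M \<in> Gamma2 \<longleftrightarrow> ?A \<and> ?C \<and> transpose (blkB M) ** blkC M - transpose (blkD M) ** blkA M = - mat 1 \<and> ?B"
    unfolding Gamma2_def mem_Collect_eq mat4_eq_iff
    by (auto simp: blk_mult blk_transpose blk_sympl_form matrix_mult_minus matrix_mult_zero)
  \<comment> \<open>The lower left block of the condition is minus the transpose of the upper right
    one.\<close>
  moreover have "transpose (blkB M) ** blkC M - transpose (blkD M) ** blkA M = - mat 1" if ?C
  proof -
    have "transpose (transpose (blkA M) ** blkD M - transpose (blkC M) ** blkB M) = transpose (mat 1)"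
      using that by simp
    then have "transpose (blkD M) ** blkA M - transpose (blkB M) ** blkC M = mat 1"
      by (simp add: transpose_arith matrix_transpose_mul)
    then show ?thesis by (metis minus_diff_eq)
  qed
  ultimately show ?thesis by blast
qed

lemma int_matrix_left_right_inverse:
  fixes A B :: "int ^ 'n ^ 'n"
  assumes "A ** B = mat 1"
  shows "B ** A = mat 1"
proof -
  let ?r = "map_matrix real_of_int :: int ^ 'n ^ 'n \<Rightarrow> real ^ 'n ^ 'n"
  have mult: "?r (X ** Y) = ?r X ** ?r Y" for X Y
    by (simp add: map_matrix_def matrix_matrix_mult_def vec_eq_iff)
  have one: "?r (mat 1) = mat 1"
    by (simp add: map_matrix_def mat_def vec_eq_iff)
  have inj: "?r X = ?r Y \<Longrightarrow> X = Y" for X Y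
    by (simp add: map_matrix_def vec_eq_iff)
  have "?r A ** ?r B = mat 1" using assms mult one by metis
  then have "?r B ** ?r A = mat 1" by (simp add: matrix_left_right_inverse)
  then show ?thesis using inj mult one by metis
qed

text \<open>For the form \<open>J\<close> this is the inverse of \<open>J\<close> times the
  transpose of \<open>M\<close> times \<open>J\<close>, hence integral.\<close>

definition sympl_inv :: "mat4 \<Rightarrow> mat4" where
  "sympl_inv M = mat4_of_blocks (transpose (blkD M)) (- transpose (blkB M)) (- transpose (blkC M)) (transpose (blkA M))"

lemma sympl_inv_left: "M \<in> Gamma2 \<Longrightarrow> sympl_inv M ** M = mat 1"
proof -
  assume M: "M \<in> Gamma2"
  have "transpose (transpose (blkA M) ** blkD M - transpose (blkC M) ** blkB M) = transpose (mat 1)"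
    using M by (simp add: Gamma2_iff)
  then have "transpose (blkD M) ** blkA M - transpose (blkB M) ** blkC M = mat 1"
    by (simp add: transpose_arith matrix_transpose_mul)
  with M show ?thesis
    by (auto simp: mat4_eq_iff blk_mult blk_one sympl_inv_def Gamma2_iff matrix_mult_minus algebra_simps)
qed

lemma sympl_inv_right: "M \<in> Gamma2 \<Longrightarrow> M ** sympl_inv M = mat 1"
  by (rule int_matrix_left_right_inverse[OF sympl_inv_left])

lemma Gamma2_mult:
  assumes "M \<in> Gamma2" "N \<in> Gamma2"
  shows "M ** N \<in> Gamma2"
proof -
  have "transpose (M ** N) ** sympl_form ** (M ** N) = transpose N ** (transpose M ** sympl_form ** M) ** N"
    by (simp only: matrix_transpose_mul matrix_mul_assoc)
  with assms show ?thesis by (simp add: Gamma2_def)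
qed

lemma sympl_inv_Gamma2:
  assumes "M \<in> Gamma2"
  shows "sympl_inv M \<in> Gamma2"
proof -
  let ?X = "sympl_inv M"
  have "transpose ?X ** sympl_form ** ?X = transpose ?X ** (transpose M ** sympl_form ** M) ** ?X"
    using assms by (simp add: Gamma2_def)
  also have "\<dots> = transpose (M ** ?X) ** sympl_form ** (M ** ?X)"
    by (simp only: matrix_transpose_mul matrix_mul_assoc)
  also have "\<dots> = sympl_form" by (simp add: sympl_inv_right[OF assms])
  finally show ?thesis by (simp add: Gamma2_def)
qed

text \<open>These are the relations of the transposed matrix; they express that
  \<open>sympl_inv M\<close> is an inverse on the right too.\<close>

lemma Gamma2_row_relations:
  assumes "M \<in> Gamma2"
  shows "blkA M ** transpose (blkB M) = blkB M ** transpose (blkA M)"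
    "blkC M ** transpose (blkD M) = blkD M ** transpose (blkC M)"
    "blkA M ** transpose (blkD M) - blkB M ** transpose (blkC M) = mat 1"
    "blkD M ** transpose (blkA M) - blkC M ** transpose (blkB M) = mat 1"
  using sympl_inv_right[OF assms]
  by (auto simp: mat4_eq_iff blk_mult blk_one sympl_inv_def matrix_mult_minus algebra_simps)

section \<open>The action on the half-space\<close>

abbreviation cmat :: "int ^ 2 ^ 2 \<Rightarrow> cmat2" where
  "cmat A \<equiv> map_matrix of_int A"

lemma cmat_simps:
  "cmat (A ** B) = cmat A ** cmat B" "cmat (A + B) = cmat A + cmat B" "cmat (A - B) = cmat A - cmat B"
  "cmat (- A) = - cmat A" "cmat (mat 1) = mat 1" "cmat (transpose A) = transpose (cmat A)" "cmat 0 = 0"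
  by (simp_all add: map_matrix_def matrix_matrix_mult_def vec_eq_iff mat_def transpose_def)

lemma cmat_cvec: "cmat A *v cvec m = cvec (A *v m)"
  by (simp add: map_matrix_def matrix_vector_mult_def vec_eq_iff cvec_def)

text \<open>Numerator and denominator of the action are kept apart, so that a point \<open>T\<close>
  is recognized as the image by \<open>T ** siegel_Q M \<Omega> = siegel_P M \<Omega>\<close>,
  without an inverse.\<close>

definition siegel_P :: "mat4 \<Rightarrow> cmat2 \<Rightarrow> cmat2" where
  "siegel_P M \<Omega> = cmat (blkA M) ** \<Omega> + cmat (blkB M)"

definition siegel_Q :: "mat4 \<Rightarrow> cmat2 \<Rightarrow> cmat2" where
  "siegel_Q M \<Omega> = cmat (blkC M) ** \<Omega> + cmat (blkD M)"

lemma siegel_act_PQ: "siegel_act M \<Omega> = siegel_P M \<Omega> ** matrix_inv (siegel_Q M \<Omega>)"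
  by (simp add: siegel_act_def siegel_P_def siegel_Q_def)

lemma bdot_matrix_left: "bdot (A *v u) v = bdot u (transpose A *v v)"
  by (metis bdot_matrix transpose_transpose)

text \<open>Invariance of the symplectic form, where \<open>(x, u)\<close> and \<open>(y, v)\<close>
  are the two halves of a pair of vectors in complex 4-space.\<close>

lemma symplectic_pairing:
  assumes "M \<in> Gamma2"
  shows "bdot (cmat (blkA M) *v x + cmat (blkB M) *v u) (cmat (blkC M) *v y + cmat (blkD M) *v v)
      - bdot (cmat (blkC M) *v x + cmat (blkD M) *v u) (cmat (blkA M) *v y + cmat (blkB M) *v v)
    = bdot x v - bdot u y"
proof -
  let ?A = "cmat (blkA M)" and ?B = "cmat (blkB M)" and ?C = "cmat (blkC M)" and ?D = "cmat (blkD M)"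
  have AC: "transpose ?A ** ?C = transpose ?C ** ?A" and BD: "transpose ?B ** ?D = transpose ?D ** ?B"
    and AD: "transpose ?A ** ?D = transpose ?C ** ?B + mat 1"
    using assms unfolding Gamma2_iff cmat_simps[symmetric] by (simp_all add: algebra_simps)
  have "transpose (transpose ?A ** ?D) = transpose (transpose ?C ** ?B + mat 1)"
    using AD by simp
  then have DA: "transpose ?D ** ?A = transpose ?B ** ?C + mat 1"
    by (simp add: transpose_arith matrix_transpose_mul)
  show ?thesis
    by (simp add: bdot_simps bdot_matrix_left matrix_vector_mul_assoc AC BD AD DA
        matrix_vector_mult_add_rdistrib)
qed

definition vcnj :: "complex ^ 2 \<Rightarrow> complex ^ 2" where
  "vcnj w = (\<chi> k. cnj (w $ k))"

lemma vcnj_simps: "vcnj (u + v) = vcnj u + vcnj v" "vcnj (cmat A *v w) = cmat A *v vcnj w"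
  "cnj (bdot u v) = bdot (vcnj u) (vcnj v)" "vcnj (vcnj u) = u"
  by (simp_all add: vcnj_def vec_eq_iff matrix_vector_mult_def map_matrix_def bdot_def)

text \<open>The denominator \<open>siegel_Q\<close> is a complex matrix, so positivity has to be
  tested on complex vectors. For symmetric \<open>\<tau>\<close> the real and imaginary parts of
  \<open>w\<close> contribute separately.\<close>

lemma siegel_H2_iff_herm:
  "\<tau> \<in> siegel_H2 \<longleftrightarrow> transpose \<tau> = \<tau> \<and> (\<forall>w. w \<noteq> 0 \<longrightarrow> Im (bdot (vcnj w) (\<tau> *v w)) > 0)"
proof (cases "transpose \<tau> = \<tau>")
  case True
  have "transpose \<tau> $ 2 $ 1 = \<tau> $ 1 $ 2" by (simp add: transpose_def)
  then have s: "\<tau> $ 2 $ 1 = \<tau> $ 1 $ 2" unfolding True .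
  define q where "q x = x \<bullet> (map_matrix Im \<tau> *v x)" for x :: "real ^ 2"
  have q: "Im (bdot (vcnj w) (\<tau> *v w)) = q (\<chi> k. Re (w $ k)) + q (\<chi> k. Im (w $ k))" for w
    by (simp add: q_def inner_vec_def sum_2 matrix_vector_mult_def map_matrix_def bdot_def vcnj_def s algebra_simps)
  have q0: "q 0 = 0" by (simp add: q_def)
  have "(\<forall>x. x \<noteq> 0 \<longrightarrow> q x > 0) \<longleftrightarrow> (\<forall>w. w \<noteq> 0 \<longrightarrow> Im (bdot (vcnj w) (\<tau> *v w)) > 0)"
  proof safe
    fix w :: "complex ^ 2"
    assume pos: "\<forall>x. x \<noteq> 0 \<longrightarrow> q x > 0" and "w \<noteq> 0"
    have nn: "q x \<ge> 0" for x using pos q0 by (cases "x = 0") (auto simp: less_imp_le)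
    have "(\<chi> k. Re (w $ k)) \<noteq> 0 \<or> (\<chi> k. Im (w $ k)) \<noteq> 0"
      using \<open>w \<noteq> 0\<close> by (auto simp: vec_eq_iff complex_eq_iff)
    then show "Im (bdot (vcnj w) (\<tau> *v w)) > 0"
      unfolding q using pos nn by (metis add_nonneg_pos add_pos_nonneg)
  next
    fix x :: "real ^ 2"
    assume pos: "\<forall>w. w \<noteq> 0 \<longrightarrow> Im (bdot (vcnj w) (\<tau> *v w)) > 0" and "x \<noteq> 0"
    then have "(\<chi> k. complex_of_real (x $ k)) \<noteq> 0" by (auto simp: vec_eq_iff)
    then have "Im (bdot (vcnj (\<chi> k. complex_of_real (x $ k))) (\<tau> *v (\<chi> k. complex_of_real (x $ k)))) > 0"
      using pos by blast
    then show "q x > 0" unfolding q by (simp add: q0 zero_vec_def[symmetric])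
  qed
  then show ?thesis by (simp add: siegel_H2_def True q_def)
qed (simp add: siegel_H2_def)

text \<open>The pairing is applied to \<open>(\<tau> w, w)\<close> and its complex conjugate, which
  is possible because \<open>M\<close> is real. Both the invertibility of the denominator and the
  positivity of the image point follow from this one identity.\<close>

lemma siegel_Q_herm:
  assumes "M \<in> Gamma2" "transpose \<tau> = \<tau>"
  shows "Im (bdot (vcnj (siegel_Q M \<tau> *v w)) (siegel_P M \<tau> *v w)) = Im (bdot (vcnj w) (\<tau> *v w))"
proof -
  let ?x = "\<tau> *v w"
  let ?p = "siegel_P M \<tau> *v w" and ?q = "siegel_Q M \<tau> *v w"
  have P: "?p = cmat (blkA M) *v ?x + cmat (blkB M) *v w"
    and Q: "?q = cmat (blkC M) *v ?x + cmat (blkD M) *v w"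
    by (simp_all add: siegel_P_def siegel_Q_def matrix_vector_mult_add_rdistrib matrix_vector_mul_assoc)
  have "bdot ?p (vcnj ?q) - bdot ?q (vcnj ?p) = bdot ?x (vcnj w) - bdot w (vcnj ?x)"
    unfolding P Q vcnj_simps by (rule symplectic_pairing[OF assms(1)])
  moreover have "bdot ?q (vcnj ?p) = cnj (bdot ?p (vcnj ?q))" "bdot w (vcnj ?x) = cnj (bdot ?x (vcnj w))"
    by (simp_all add: vcnj_simps bdot_commute)
  ultimately have "Im (bdot ?p (vcnj ?q)) = Im (bdot ?x (vcnj w))"
    by (simp add: complex_eq_iff)
  then show ?thesis by (simp add: bdot_commute)
qed

lemma invertible_siegel_Q:
  assumes "M \<in> Gamma2" "\<tau> \<in> siegel_H2"
  shows "invertible (siegel_Q M \<tau>)"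
proof -
  have "w = 0" if "siegel_Q M \<tau> *v w = 0" for w
  proof (rule ccontr)
    assume "w \<noteq> 0"
    then have "Im (bdot (vcnj w) (\<tau> *v w)) > 0" using assms(2) by (simp add: siegel_H2_iff_herm)
    moreover have "Im (bdot (vcnj w) (\<tau> *v w)) = 0"
      using siegel_Q_herm[OF assms(1), of \<tau> w] assms(2) that
      by (simp add: siegel_H2_def bdot_def vcnj_def)
    ultimately show False by simp
  qed
  then show ?thesis
    using matrix_left_invertible_ker[of "siegel_Q M \<tau>"] invertible_left_inverse by metis
qed

lemma siegel_act_Q:
  assumes "M \<in> Gamma2" "\<tau> \<in> siegel_H2"
  shows "siegel_act M \<tau> ** siegel_Q M \<tau> = siegel_P M \<tau>"
proof -
  have "siegel_act M \<tau> ** siegel_Q M \<tau> = siegel_P M \<tau> ** (matrix_inv (siegel_Q M \<tau>) ** siegel_Q M \<tau>)"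
    by (simp add: siegel_act_PQ matrix_mul_assoc)
  then show ?thesis
    by (simp add: matrix_inv_mult invertible_siegel_Q[OF assms])
qed

lemma invertible_vector_eqI:
  fixes Q :: "cmat2"
  assumes "invertible Q"
  obtains u where "w = Q *v u"
proof -
  have "w = Q *v (matrix_inv Q *v w)"
    using assms by (simp add: matrix_vector_mul_assoc matrix_inv_mult)
  then show ?thesis by (rule that)
qed

lemma bdot_ext:
  assumes "\<And>u v. bdot u (A *v v) = bdot u (B *v v)"
  shows "A = (B :: cmat2)"
proof -
  have "A $ i $ j = B $ i $ j" for i j
    using assms[of "axis i 1" "axis j 1"] exhaust_2[of i] exhaust_2[of j]
    by (auto simp: bdot_def axis_def matrix_vector_mult_def sum_2)
  then show ?thesis by (simp add: vec_eq_iff)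
qed

text \<open>Every vector has the form \<open>?Q *v u\<close>, and there the hermitian form of the
  image equals that of \<open>\<tau>\<close> at \<open>u\<close>. Symmetry holds because the
  symplectic pairing vanishes on the vectors \<open>(\<tau> u, u)\<close>.\<close>

lemma siegel_act_H2:
  assumes "M \<in> Gamma2" "\<tau> \<in> siegel_H2"
  shows "siegel_act M \<tau> \<in> siegel_H2"
proof -
  let ?P = "siegel_P M \<tau>" and ?Q = "siegel_Q M \<tau>" and ?T = "siegel_act M \<tau>"
  have sym: "transpose \<tau> = \<tau>" using assms(2) by (simp add: siegel_H2_def)
  note inv = invertible_siegel_Q[OF assms]
  have TQ: "?T *v (?Q *v u) = ?P *v u" for u
    by (simp add: matrix_vector_mul_assoc siegel_act_Q[OF assms])
  have PQ: "bdot (?P *v u) (?Q *v v) = bdot (?Q *v u) (?P *v v)" for u v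
    using symplectic_pairing[OF assms(1), of "\<tau> *v u" u "\<tau> *v v" v] bdot_symmetric[OF sym, of u v]
    by (simp add: siegel_P_def siegel_Q_def matrix_vector_mult_add_rdistrib matrix_vector_mul_assoc bdot_commute)
  have "transpose ?T = ?T"
  proof (rule bdot_ext)
    fix u v
    obtain u' where u: "u = ?Q *v u'" by (rule invertible_vector_eqI[OF inv])
    obtain v' where v: "v = ?Q *v v'" by (rule invertible_vector_eqI[OF inv])
    show "bdot u (transpose ?T *v v) = bdot u (?T *v v)"
      unfolding bdot_matrix_left[symmetric] unfolding u v TQ by (rule PQ)
  qed
  moreover have "Im (bdot (vcnj w) (?T *v w)) > 0" if "w \<noteq> 0" for w
  proof -
    obtain u where u: "w = ?Q *v u" by (rule invertible_vector_eqI[OF inv])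
    then have "u \<noteq> 0" using that by auto
    then have "Im (bdot (vcnj u) (\<tau> *v u)) > 0" using assms(2) by (simp add: siegel_H2_iff_herm)
    then show ?thesis
      unfolding u TQ siegel_Q_herm[OF assms(1) sym] .
  qed
  ultimately show ?thesis by (simp add: siegel_H2_iff_herm)
qed

lemma siegel_act_eqI:
  assumes "M \<in> Gamma2" "\<tau> \<in> siegel_H2" "T ** siegel_Q M \<tau> = siegel_P M \<tau>"
  shows "siegel_act M \<tau> = T"
proof -
  have "siegel_act M \<tau> = T ** (siegel_Q M \<tau> ** matrix_inv (siegel_Q M \<tau>))"
    by (simp add: siegel_act_PQ assms(3)[symmetric] matrix_mul_assoc)
  then show ?thesis by (simp add: matrix_inv_mult invertible_siegel_Q[OF assms(1,2)])
qed

text \<open>Numerator and denominator of the product factor through the common right factor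
  \<open>siegel_Q N \<tau>\<close>, the cocycle relation.\<close>

lemma siegel_act_mult:
  assumes "M \<in> Gamma2" "N \<in> Gamma2" "\<tau> \<in> siegel_H2"
  shows "siegel_act (M ** N) \<tau> = siegel_act M (siegel_act N \<tau>)"
proof (rule siegel_act_eqI[OF Gamma2_mult[OF assms(1,2)] assms(3)])
  let ?s = "siegel_act N \<tau>"
  have s: "?s \<in> siegel_H2" by (rule siegel_act_H2[OF assms(2,3)])
  have "siegel_Q (M ** N) \<tau> = cmat (blkC M) ** siegel_P N \<tau> + cmat (blkD M) ** siegel_Q N \<tau>"
    and "siegel_P (M ** N) \<tau> = cmat (blkA M) ** siegel_P N \<tau> + cmat (blkB M) ** siegel_Q N \<tau>"
    by (simp_all add: siegel_Q_def siegel_P_def blk_mult cmat_simps matrix_mul_assoc matrix_add_ldistrib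
        matrix_mult_add_left algebra_simps)
  then have "siegel_Q (M ** N) \<tau> = siegel_Q M ?s ** siegel_Q N \<tau>"
    and "siegel_P (M ** N) \<tau> = siegel_P M ?s ** siegel_Q N \<tau>"
    unfolding siegel_act_Q[OF assms(2,3), symmetric]
    by (simp_all add: siegel_Q_def[of M] siegel_P_def[of M] matrix_mul_assoc matrix_mult_add_left)
  then show "siegel_act M ?s ** siegel_Q (M ** N) \<tau> = siegel_P (M ** N) \<tau>"
    by (simp add: matrix_mul_assoc siegel_act_Q[OF assms(1) s])
qed

lemma siegel_act_one:
  assumes "\<tau> \<in> siegel_H2"
  shows "siegel_act (mat 1) \<tau> = \<tau>"
  by (rule siegel_act_eqI[OF _ assms])
    (simp_all add: Gamma2_def siegel_P_def siegel_Q_def blk_one cmat_simps matrix_mult_zero)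

section \<open>The functional equation of the theta function\<close>

lemma exp_even_shift:
  assumes "even j"
  shows "exp (x - \<i> * of_real pi * of_int j) = exp x"
proof -
  obtain k where "j = 2 * k" using assms by blast
  then have "exp (x - \<i> * of_real pi * of_int j) = exp x * exp (2 * of_real pi * \<i> * of_int (- k))"
    unfolding exp_add[symmetric] by (simp add: algebra_simps)
  also have "exp (2 * of_real pi * \<i> * of_int (- k)) = 1"
    using exp_integer_2pi[of "of_int (- k)"] by (simp add: algebra_simps)
  finally show ?thesis by simp
qed

text \<open>Off-diagonal entries are counted twice, so only the diagonal matters; hence the
  functional equation imposes parity on diagonals alone.\<close>

lemma even_quadratic_form:
  fixes S :: "int ^ 2 ^ 2"
  assumes "transpose S = S" "\<And>i. even (S $ i $ i)"
  shows "even (bdot m (S *v m))"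
proof -
  have "transpose S $ 2 $ 1 = S $ 1 $ 2" by (simp add: transpose_def)
  then have s: "S $ 2 $ 1 = S $ 1 $ 2" unfolding assms(1) .
  have "bdot m (S *v m) = S $ 1 $ 1 * (m $ 1)\<^sup>2 + S $ 2 $ 2 * (m $ 2)\<^sup>2 + 2 * (S $ 1 $ 2 * m $ 1 * m $ 2)"
    by (simp add: bdot_def matrix_vector_mult_def sum_2 s power2_eq_square algebra_simps)
  then show ?thesis using assms(2) by simp
qed

lemma exp_mult_eq_mod_2pi_i:
  assumes "E1 + E2 = E0 - \<i> * of_real pi * of_int j" "even j"
  shows "exp E1 * exp E2 = exp (E0 :: complex)"
  unfolding exp_add[symmetric] assms(1) by (rule exp_even_shift[OF assms(2)])

lemma riemann_theta_lattice:
  assumes "transpose \<tau> = \<tau>"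
  shows "riemann_theta (z + (\<tau> *v cvec n + cvec l)) \<tau>
    = exp (- \<i> * of_real pi * bdot (cvec n) (\<tau> *v cvec n) - 2 * of_real pi * \<i> * bdot (cvec n) (z + cvec l))
      * riemann_theta z \<tau>"
proof -
  have "z + (\<tau> *v cvec n + cvec l) = (z + cvec l) + \<tau> *v cvec n" by simp
  then show ?thesis
    by (simp only: riemann_theta_quasi[OF assms] riemann_theta_periodic)
qed

lemma cvec_transpose: "transpose (cmat A) *v cvec m = cvec (transpose A *v m)"
  by (metis cmat_cvec cmat_simps(6))

text \<open>With \<open>R\<close> the transposed denominator, the left side, as a function of
  \<open>w\<close>, has the quasi-periods of theta at \<open>siegel_act M \<tau>\<close>, so
  uniqueness supplies \<open>\<kappa>\<close>. The even diagonals of \<open>A B\<^sup>T\<close> and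
  \<open>C D\<^sup>T\<close> prevent a shift of characteristic.\<close>

lemma theta_functional_equation:
  assumes M: "M \<in> Gamma2" and \<tau>: "\<tau> \<in> siegel_H2"
    and evenAB: "\<And>i. even ((blkA M ** transpose (blkB M)) $ i $ i)"
    and evenCD: "\<And>i. even ((blkC M ** transpose (blkD M)) $ i $ i)"
  obtains \<kappa> where "\<kappa> \<noteq> 0" "\<And>w. exp (\<i> * of_real pi * bdot w (cmat (blkC M) *v (transpose (siegel_Q M \<tau>) *v w)))
      * riemann_theta (transpose (siegel_Q M \<tau>) *v w) \<tau> = \<kappa> * riemann_theta w (siegel_act M \<tau>)"
proof -
  define A B C D where "A = blkA M" "B = blkB M" "C = blkC M" "D = blkD M"
  note defs = this
  define T where "T = siegel_act M \<tau>"
  define R where "R = transpose (siegel_Q M \<tau>)"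
  have symm: "transpose \<tau> = \<tau>" using \<tau> by (simp add: siegel_H2_def)
  have T: "T \<in> siegel_H2" unfolding T_def by (rule siegel_act_H2[OF M \<tau>])
  then have symT: "transpose T = T" by (simp add: siegel_H2_def)
  have R: "R = \<tau> ** transpose (cmat C) + transpose (cmat D)"
    by (simp add: R_def siegel_Q_def transpose_arith matrix_transpose_mul symm defs)
  have Rv: "R *v x = \<tau> *v (transpose (cmat C) *v x) + transpose (cmat D) *v x" for x
    unfolding R by (simp add: matrix_vector_mult_add_rdistrib matrix_vector_mul_assoc)
  have "R ** T = transpose (siegel_P M \<tau>)"
    unfolding siegel_act_Q[OF M \<tau>, symmetric] matrix_transpose_mul R_def T_def[symmetric] symT ..
  then have RT: "R *v (T *v x) = \<tau> *v (transpose (cmat A) *v x) + transpose (cmat B) *v x" for x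
    by (simp add: matrix_vector_mul_assoc siegel_P_def transpose_arith matrix_transpose_mul symm defs
        matrix_vector_mult_add_rdistrib)
  define S where "S = cmat C ** R"
  have CD: "cmat C ** transpose (cmat D) = cmat D ** transpose (cmat C)"
    using Gamma2_row_relations(2)[OF M] by (metis cmat_simps(1,6) defs(3,4))
  have AD: "cmat A ** transpose (cmat D) = cmat B ** transpose (cmat C) + mat 1"
  proof -
    have "A ** transpose D = B ** transpose C + mat 1"
      using Gamma2_row_relations(3)[OF M] unfolding defs by (simp add: algebra_simps)
    then show ?thesis by (metis cmat_simps(1,2,5,6))
  qed
  have S': "S = transpose R ** transpose (cmat C)"
    by (simp add: S_def R transpose_arith matrix_transpose_mul symm matrix_add_ldistrib matrix_mult_add_left
        matrix_mul_assoc CD)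
  then have symS: "transpose S = S"
    by (simp add: S_def matrix_transpose_mul)
  have Sv: "bdot x (S *v y) = bdot (transpose (cmat C) *v x) (R *v y)" for x y
    by (simp add: S_def bdot_matrix_left matrix_vector_mul_assoc)
  have Sv': "bdot x (S *v y) = bdot (R *v x) (transpose (cmat C) *v y)" for x y
    by (simp add: S' bdot_matrix_left matrix_vector_mul_assoc)
  have S_sum: "bdot (w + t) (S *v (w + t)) = bdot w (S *v w) + 2 * bdot t (S *v w) + bdot t (S *v t)" for w t
    using bdot_symmetric[OF symS, of w t] by (simp add: bdot_simps matrix_vector_right_distrib)
  define \<psi> where "\<psi> w = exp (\<i> * of_real pi * bdot w (S *v w)) * riemann_theta (R *v w) \<tau>" for w
  \<comment> \<open>\<open>R\<close> carries both kinds of period \<open>t\<close> into the lattice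
    of \<open>\<tau>\<close>: integral ones through \<open>C\<close> and \<open>D\<close>, the
    others through \<open>A\<close> and \<open>B\<close>. The parameters are
    \<open>a = b = 0\<close> in the first case and the exponents of theta at \<open>T\<close> in the
    second; \<open>bdot n l\<close> even removes a sign.\<close>
  have shift: "\<psi> (w + t) = exp (- \<i> * of_real pi * a - 2 * of_real pi * \<i> * b) * \<psi> w"
    if Rt: "R *v t = \<tau> *v cvec n + cvec l" and ev: "even (bdot n l)"
      and tw: "bdot t (S *v w) = bdot (cvec n) (R *v w) - b"
      and tt: "bdot t (S *v t) = bdot (cvec n) (\<tau> *v cvec n) + bdot (cvec n) (cvec l) - a" for w t n l a b
  proof -
    have "\<psi> (w + t) = (exp (\<i> * of_real pi * bdot (w + t) (S *v (w + t)))
        * exp (- \<i> * of_real pi * bdot (cvec n) (\<tau> *v cvec n) - 2 * of_real pi * \<i> * bdot (cvec n) (R *v w + cvec l)))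
        * riemann_theta (R *v w) \<tau>"
      unfolding \<psi>_def matrix_vector_right_distrib[of R] Rt riemann_theta_lattice[OF symm] by simp
    also have "exp (\<i> * of_real pi * bdot (w + t) (S *v (w + t)))
        * exp (- \<i> * of_real pi * bdot (cvec n) (\<tau> *v cvec n) - 2 * of_real pi * \<i> * bdot (cvec n) (R *v w + cvec l))
        = exp (\<i> * of_real pi * bdot w (S *v w) + (- \<i> * of_real pi * a - 2 * of_real pi * \<i> * b))"
      by (rule exp_mult_eq_mod_2pi_i[OF _ ev]) (simp add: S_sum bdot_symmetric[OF symS, of w t] tw tt bdot_simps
          bdot_cvec[symmetric] matrix_vector_right_distrib algebra_simps)
    finally show ?thesis unfolding \<psi>_def exp_add by simp
  qed
  have per: "\<psi> (w + cvec m) = \<psi> w" for w m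
  proof -
    have "\<psi> (w + cvec m) = exp (- \<i> * of_real pi * 0 - 2 * of_real pi * \<i> * 0) * \<psi> w"
    proof (rule shift)
      show Rm: "R *v cvec m = \<tau> *v cvec (transpose C *v m) + cvec (transpose D *v m)"
        unfolding Rv by (simp add: cvec_transpose)
      have "transpose (C ** transpose D) = C ** transpose D"
        using Gamma2_row_relations(2)[OF M] by (simp add: matrix_transpose_mul defs)
      then have "even (bdot m ((C ** transpose D) *v m))"
        by (rule even_quadratic_form) (simp add: evenCD defs)
      then show "even (bdot (transpose C *v m) (transpose D *v m))"
        by (simp add: bdot_matrix_left matrix_vector_mul_assoc)
      show "bdot (cvec m) (S *v w) = bdot (cvec (transpose C *v m)) (R *v w) - 0"
        by (simp add: Sv cvec_transpose)
      show "bdot (cvec m) (S *v cvec m) = bdot (cvec (transpose C *v m)) (\<tau> *v cvec (transpose C *v m))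
          + bdot (cvec (transpose C *v m)) (cvec (transpose D *v m)) - 0"
        unfolding Sv Rm by (simp add: cvec_transpose bdot_simps)
    qed
    then show ?thesis by simp
  qed
  have quasi: "\<psi> (w + T *v cvec m)
      = exp (- \<i> * of_real pi * bdot (cvec m) (T *v cvec m) - 2 * of_real pi * \<i> * bdot (cvec m) w) * \<psi> w" for w m
  proof (rule shift)
    have \<tau>_left: "bdot (\<tau> *v x) y = bdot x (\<tau> *v y)" for x y
      using bdot_matrix_left[of \<tau> x y] unfolding symm .
    let ?t = "T *v cvec m" and ?n = "transpose A *v m" and ?l = "transpose B *v m"
    show Rt: "R *v ?t = \<tau> *v cvec ?n + cvec ?l"
      unfolding RT by (simp add: cvec_transpose)
    have "transpose (A ** transpose B) = A ** transpose B"
      using Gamma2_row_relations(1)[OF M] by (simp add: matrix_transpose_mul defs)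
    then have "even (bdot m ((A ** transpose B) *v m))"
      by (rule even_quadratic_form) (simp add: evenAB defs)
    then show "even (bdot ?n ?l)"
      by (simp add: bdot_matrix_left matrix_vector_mul_assoc)
    \<comment> \<open>The relation between \<open>A D\<^sup>T\<close> and
      \<open>B C\<^sup>T\<close>, in the form in which it enters the exponents.\<close>
    have key: "bdot (cvec ?l) (transpose (cmat C) *v x) - bdot (cvec ?n) (transpose (cmat D) *v x) = - bdot (cvec m) x" for x
      unfolding cvec_transpose[symmetric]
      by (simp add: bdot_matrix_left matrix_vector_mul_assoc AD matrix_vector_mult_add_rdistrib bdot_simps)
    show "bdot ?t (S *v w) = bdot (cvec ?n) (R *v w) - bdot (cvec m) w"
      unfolding Sv' Rt Rv[of w] using key[of w] \<tau>_left[of "cvec ?n" "transpose (cmat C) *v w"]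
      by (simp add: bdot_simps algebra_simps)
    have "bdot (cvec ?n) (R *v ?t) = bdot (cvec ?n) (\<tau> *v (transpose (cmat C) *v ?t)) + bdot (cvec ?n) (transpose (cmat D) *v ?t)"
      unfolding Rv by (simp add: bdot_simps)
    then have "bdot (cvec ?n) (\<tau> *v (transpose (cmat C) *v ?t)) = bdot (cvec ?n) (\<tau> *v cvec ?n) + bdot (cvec ?n) (cvec ?l)
         - bdot (cvec ?n) (transpose (cmat D) *v ?t)"
      unfolding Rt by (simp add: bdot_simps algebra_simps)
    with key[of ?t] show "bdot ?t (S *v ?t) = bdot (cvec ?n) (\<tau> *v cvec ?n) + bdot (cvec ?n) (cvec ?l) - bdot (cvec m) ?t"
      unfolding Sv' Rt bdot_simps(1) \<tau>_left by algebra
  qed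
  have hol: "(\<lambda>t. \<psi> (cvec2 (f t) (g t))) holomorphic_on UNIV"
    if "f holomorphic_on UNIV" "g holomorphic_on UNIV" for f g
    unfolding \<psi>_def
  proof (intro holomorphic_intros holomorphic_riemann_theta)
    show "(\<lambda>t. bdot (cvec2 (f t) (g t)) (S *v cvec2 (f t) (g t))) holomorphic_on UNIV"
      unfolding bdot_def matrix_vector_mult_def sum_2 using that by (auto intro!: holomorphic_intros)
    show "(\<lambda>t. (R *v cvec2 (f t) (g t)) $ k) holomorphic_on UNIV" for k
      unfolding matrix_vector_mult_def sum_2 using that by (auto intro!: holomorphic_intros)
  qed (use \<tau> in auto)
  have cont: "continuous_on UNIV \<psi>"
    unfolding \<psi>_def
  proof (intro continuous_intros continuous_on_compose2[OF continuous_riemann_theta[OF \<tau>]])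
    show "continuous_on UNIV (\<lambda>x. bdot x (S *v x))"
      unfolding bdot_def by (intro continuous_intros)
  qed auto
  obtain \<kappa> where \<kappa>: "\<And>z. \<psi> z = \<kappa> * riemann_theta z T"
  proof (rule riemann_theta_unique[OF T, of \<psi>])
    show "(\<lambda>x. \<psi> (cvec2 x y)) holomorphic_on UNIV" "(\<lambda>y. \<psi> (cvec2 x y)) holomorphic_on UNIV" for x y
      by (intro hol holomorphic_intros)+
  qed (simp_all only: cont per quasi)
  \<comment> \<open>\<open>R\<close> is invertible, so some \<open>w\<close> is sent to a point
    where theta does not vanish; this excludes \<open>\<kappa> = 0\<close>.\<close>
  obtain z where z: "riemann_theta z \<tau> \<noteq> 0" by (rule riemann_theta_nonzero[OF \<tau>])
  have "invertible R" 
    unfolding R_def invertible_def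
    by (rule exI[of _ "transpose (matrix_inv (siegel_Q M \<tau>))"])
      (simp add: matrix_transpose_mul[symmetric] matrix_inv_mult invertible_siegel_Q[OF M \<tau>])
  then obtain w where "z = R *v w" by (rule invertible_vector_eqI)
  then have "\<psi> w \<noteq> 0" using z by (simp add: \<psi>_def)
  then have "\<kappa> \<noteq> 0" using \<kappa>[of w] by auto
  then show ?thesis
  proof (rule that)
    fix w
    show "exp (\<i> * of_real pi * bdot w (cmat (blkC M) *v (transpose (siegel_Q M \<tau>) *v w)))
      * riemann_theta (transpose (siegel_Q M \<tau>) *v w) \<tau> = \<kappa> * riemann_theta w (siegel_act M \<tau>)"
      using \<kappa>[of w] unfolding \<psi>_def S_def R_def T_def defs by (simp add: matrix_vector_mul_assoc)
  qed
qed

section \<open>Polynomials in three variables\<close>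

lemma map_poly_hom_add:
  assumes "h 0 = 0" "\<And>a b. h (a + b) = h a + h b"
  shows "map_poly h (p + q) = map_poly h p + map_poly h q"
  by (rule poly_eqI) (simp add: coeff_map_poly assms)

lemma map_poly_hom_mult:
  fixes h :: "'a::comm_ring_1 \<Rightarrow> 'b::comm_ring_1"
  assumes "h 0 = 0" "\<And>a b. h (a + b) = h a + h b" "\<And>a b. h (a * b) = h a * h b"
  shows "map_poly h (p * q) = map_poly h p * map_poly h q"
proof (rule poly_eqI)
  fix n
  have "h (sum f A) = (\<Sum>a\<in>A. h (f a))" for f and A :: "nat set"
    by (induction A rule: infinite_finite_induct) (simp_all add: assms)
  then show "coeff (map_poly h (p * q)) n = coeff (map_poly h p * map_poly h q) n"
    by (simp add: coeff_map_poly coeff_mult assms)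
qed

text \<open>Homomorphisms are a predicate on functions, so that evaluations, substitutions,
  embeddings of constants and \<open>to_fract\<close> can be composed and compared.\<close>

definition is_hom :: "('a::comm_ring_1 \<Rightarrow> 'b::comm_ring_1) \<Rightarrow> bool" where
  "is_hom h \<longleftrightarrow> h 0 = 0 \<and> h 1 = 1 \<and> (\<forall>a b. h (a + b) = h a + h b) \<and> (\<forall>a b. h (a * b) = h a * h b)"

lemma is_hom_simps:
  assumes "is_hom h"
  shows "h 0 = 0" "h 1 = 1" "h (a + b) = h a + h b" "h (a * b) = h a * h b"
    "h (- a) = - h a" "h (a - b) = h a - h b" "h (a ^ n) = h a ^ n"
proof -
  show *: "h 0 = 0" "h 1 = 1" "h (a + b) = h a + h b" "h (a * b) = h a * h b" for a b
    using assms by (auto simp: is_hom_def)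
  have "h (- a) + h a = 0" for a using *(3)[of "- a" a] *(1) by simp
  then show 1: "h (- a) = - h a" for a by (simp add: eq_neg_iff_add_eq_0)
  show "h (a - b) = h a - h b" using *(3)[of a "- b"] 1 by simp
  show "h (a ^ n) = h a ^ n" by (induction n) (simp_all add: *)
qed

lemma is_hom_poly_map:
  assumes "is_hom h"
  shows "is_hom (\<lambda>p. poly (map_poly h p) x)"
  unfolding is_hom_def using is_hom_simps[OF assms]
  by (simp add: map_poly_hom_add map_poly_hom_mult map_poly_1)

lemma is_hom_eval3:
  assumes "is_hom h"
  shows "is_hom (\<lambda>P. eval3 h P v)"
  unfolding eval3_def by (intro is_hom_poly_map assms)

lemma is_hom_of_rat: "is_hom (of_rat :: rat \<Rightarrow> 'a::field_char_0)"
  by (simp add: is_hom_def of_rat_add of_rat_mult)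

lemma is_hom_qconst: "is_hom qconst"
  by (simp add: is_hom_def qconst_def one_pCons)

lemma is_hom_to_fract: "is_hom (to_fract :: 'a::idom \<Rightarrow> 'a fract)"
  by (simp add: is_hom_def)

lemma eval3_qconst: "is_hom h \<Longrightarrow> eval3 h (qconst c) v = h c"
  by (simp add: eval3_def qconst_def map_poly_pCons is_hom_simps)

lemma eval3_qvar:
  assumes "is_hom h" "i \<in> {1, 2, 3}"
  shows "eval3 h (qvar i) v = v i"
  using assms(2) by (auto simp: eval3_def qvar_def map_poly_pCons is_hom_simps[OF assms(1)])

lemma is_hom_comp: "is_hom f \<Longrightarrow> is_hom g \<Longrightarrow> is_hom (\<lambda>x. f (g x))"
  by (simp add: is_hom_def)

lemma is_hom_id: "is_hom (\<lambda>x. x)"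
  by (simp add: is_hom_def)

lemma is_hom_pCons0:  "is_hom (\<lambda>a. [:a:])"
  by (simp add: is_hom_def one_pCons)

lemma poly_hom_eq:
  assumes f: "is_hom f" and g: "is_hom g"
    and c: "\<And>a. f [:a:] = g [:a:]" and x: "f [:0, 1:] = g [:0, 1:]"
  shows "f p = g p"
proof (induction p)
  case (pCons a p)
  have *: "pCons a p = [:a:] + [:0, 1:] * p" by simp
  show ?case unfolding * is_hom_simps(3,4)[OF f] is_hom_simps(3,4)[OF g] using pCons c x by simp
qed (simp add: is_hom_simps[OF f] is_hom_simps[OF g])

text \<open>The uniqueness half of the universal property of the polynomial ring; identities between
  evaluations and substitutions are reduced to constants and variables by it.\<close>

lemma qpoly3_hom_eq:
  fixes f g :: "qpoly3 \<Rightarrow> 'a::comm_ring_1"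
  assumes f: "is_hom f" and g: "is_hom g"
    and c: "\<And>c. f (qconst c) = g (qconst c)" and x: "\<And>i. i \<in> {1, 2, 3} \<Longrightarrow> f (qvar i) = g (qvar i)"
  shows "f P = g P"
proof (rule poly_hom_eq[OF f g])
  show "f [:0, 1:] = g [:0, 1:]" using x[of 3] by (simp add: qvar_def)
  have f1: "is_hom (\<lambda>a. f [:a:])" and g1: "is_hom (\<lambda>a. g [:a:])"
    using is_hom_comp[OF f is_hom_pCons0] is_hom_comp[OF g is_hom_pCons0] by auto
  fix a :: "rat poly poly"
  show "f [:a:] = g [:a:]"
  proof (rule poly_hom_eq[OF f1 g1])
    show "f [:[:0, 1:]:] = g [:[:0, 1:]:]" using x[of 2] by (simp add: qvar_def)
    have f2: "is_hom (\<lambda>a. f [:[:a:]:])" and g2: "is_hom (\<lambda>a. g [:[:a:]:])"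
      using is_hom_comp[OF f1 is_hom_pCons0] is_hom_comp[OF g1 is_hom_pCons0] by auto
    fix a :: "rat poly"
    show "f [:[:a:]:] = g [:[:a:]:]"
      by (rule poly_hom_eq[OF f2 g2])
        (use x[of 1] c in \<open>auto simp: qvar_def qconst_def\<close>)
  qed
qed

section \<open>Substitution of variables\<close>

definition qsubst :: "(nat \<Rightarrow> nat) \<Rightarrow> qpoly3 \<Rightarrow> qpoly3" where
  "qsubst \<pi> P = eval3 qconst P (\<lambda>i. qvar (\<pi> i))"

lemma is_hom_qsubst: "is_hom (qsubst \<pi>)"
  unfolding qsubst_def by (rule is_hom_eval3[OF is_hom_qconst])

lemma qsubst_qvar: "i \<in> {1, 2, 3} \<Longrightarrow> qsubst \<pi> (qvar i) = qvar (\<pi> i)"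
  unfolding qsubst_def by (rule eval3_qvar[OF is_hom_qconst])

lemma qsubst_qconst: "qsubst \<pi> (qconst c) = qconst c"
  unfolding qsubst_def by (rule eval3_qconst[OF is_hom_qconst])

lemma eval3_qsubst:
  assumes "is_hom h" "\<pi> \<in> {1, 2, 3} \<rightarrow> {1, 2, 3}"
  shows "eval3 h (qsubst \<pi> P) v = eval3 h P (v \<circ> \<pi>)"
proof (rule qpoly3_hom_eq[where f = "\<lambda>P. eval3 h (qsubst \<pi> P) v" and g = "\<lambda>P. eval3 h P (v \<circ> \<pi>)"])
  show "is_hom (\<lambda>P. eval3 h (qsubst \<pi> P) v)"
    by (rule is_hom_comp[OF is_hom_eval3[OF assms(1)] is_hom_qsubst])
  show "is_hom (\<lambda>P. eval3 h P (v \<circ> \<pi>))" by (rule is_hom_eval3[OF assms(1)])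
  show "eval3 h (qsubst \<pi> (qconst c)) v = eval3 h (qconst c) (v \<circ> \<pi>)" for c
    by (simp add: qsubst_qconst eval3_qconst assms(1))
  fix i :: nat assume i: "i \<in> {1, 2, 3}"
  then have "\<pi> i \<in> {1, 2, 3}" using assms(2) by blast
  then show "eval3 h (qsubst \<pi> (qvar i)) v = eval3 h (qvar i) (v \<circ> \<pi>)"
    using i by (simp only: qsubst_qvar eval3_qvar[OF assms(1)] o_apply)
qed

lemma qsubst_comp:
  assumes "\<rho> \<in> {1, 2, 3} \<rightarrow> {1, 2, 3}"
  shows "qsubst \<pi> (qsubst \<rho> P) = qsubst (\<pi> \<circ> \<rho>) P"
  unfolding qsubst_def[of \<pi>] eval3_qsubst[OF is_hom_qconst assms] by (simp add: qsubst_def o_def)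

lemma qsubst_id: "qsubst id P = P"
  by (rule qpoly3_hom_eq[OF is_hom_qsubst is_hom_id]) (simp_all add: qsubst_qconst qsubst_qvar)

lemma to_fract_qsubst:
  assumes "\<pi> \<in> {1, 2, 3} \<rightarrow> {1, 2, 3}"
  shows "eval3 of_rat P (\<lambda>i. to_fract (qvar (\<pi> i))) = to_fract (qsubst \<pi> P)"
proof (rule qpoly3_hom_eq[where f = "\<lambda>P. eval3 of_rat P (\<lambda>i. to_fract (qvar (\<pi> i)))"
      and g = "\<lambda>P. to_fract (qsubst \<pi> P)"])
  show "is_hom (\<lambda>P. eval3 of_rat P (\<lambda>i. to_fract (qvar (\<pi> i))))"
    by (rule is_hom_eval3[OF is_hom_of_rat])
  show "is_hom (\<lambda>P. to_fract (qsubst \<pi> P))"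
    by (rule is_hom_comp[OF is_hom_to_fract is_hom_qsubst])
  have of_rat: "is_hom (\<lambda>c. to_fract (qconst c))"
    by (rule is_hom_comp[OF is_hom_to_fract is_hom_qconst])
  \<comment> \<open>Two embeddings of the rationals into the fraction field must be compared. They
    agree on integers, hence on quotients.\<close>
  have nat: "of_rat (of_nat n) = to_fract (qconst (of_nat n))" for n
    by (induction n) (simp_all add: is_hom_simps[OF of_rat] of_rat_add)
  have int: "of_rat (of_int k) = to_fract (qconst (of_int k))" for k
    using nat by (cases k rule: int_cases2) (simp_all add: is_hom_simps[OF of_rat] of_rat_minus)
  show "eval3 of_rat (qconst c) (\<lambda>i. to_fract (qvar (\<pi> i))) = to_fract (qsubst \<pi> (qconst c))" for c
  proof -
    obtain a b where c: "c = of_int a / of_int b" and b: "b \<noteq> 0"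
      by (cases c) (auto simp: Fract_of_int_quotient)
    have "c * of_int b = of_int a" using c b by simp
    have "to_fract (qconst c) * of_rat (of_int b) = to_fract (qconst (c * of_int b))"
      unfolding int is_hom_simps(4)[OF of_rat] ..
    also have "\<dots> = of_rat (c * of_int b)"
      unfolding \<open>c * of_int b = of_int a\<close> by (rule int[symmetric])
    also have "\<dots> = of_rat c * (of_rat (of_int b) :: qfrac3)" by (rule of_rat_mult)
    finally have "to_fract (qconst c) * of_rat (of_int b) = of_rat c * (of_rat (of_int b) :: qfrac3)" .
    moreover have "(of_rat (of_int b) :: qfrac3) \<noteq> 0" using b by simp
    ultimately have "to_fract (qconst c) = of_rat c" using mult_right_cancel by blast
    then show ?thesis by (simp add: eval3_qconst is_hom_of_rat qsubst_qconst)
  qed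
  show "eval3 of_rat (qvar i) (\<lambda>i. to_fract (qvar (\<pi> i))) = to_fract (qsubst \<pi> (qvar i))" if "i \<in> {1, 2, 3}" for i
    by (simp only: eval3_qvar[OF is_hom_of_rat that] qsubst_qvar[OF that])
qed

text \<open>A nonzero element of least degree in the ideal generated by \<open>p\<close> and \<open>q\<close> divides both of them
  up to a constant factor, by pseudo-division.\<close>

lemma irreducible_elimination:
  fixes p q :: "'a::{factorial_ring_gcd,semiring_gcd_mult_normalize} poly"
  assumes p: "irreducible p" and q: "irreducible q" and nd: "\<not> p dvd q"
  obtains a b r where "r \<noteq> 0" "a * p + b * q = [:r:]"
proof -
  define I where "I = {a * p + b * q |a b. True}"
  have I_diff: "u - v * w \<in> I" if "u \<in> I" "w \<in> I" for u v w
  proof -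
    obtain a b c d where "u = a * p + b * q" "w = c * p + d * q" using \<open>u \<in> I\<close> \<open>w \<in> I\<close> by (auto simp: I_def)
    then have "u - v * w = (a - v * c) * p + (b - v * d) * q" by (simp add: algebra_simps)
    then show ?thesis unfolding I_def by blast
  qed
  have "p \<noteq> 0" "q \<noteq> 0" using p q by auto
  have pI: "p \<in> I" unfolding I_def by (auto intro: exI[of _ 1] exI[of _ 0])
  have qI: "q \<in> I" unfolding I_def by (auto intro: exI[of _ 1] exI[of _ 0])
  define n where "n = (LEAST n. \<exists>d\<in>I. d \<noteq> 0 \<and> degree d = n)"
  have "\<exists>d\<in>I. d \<noteq> 0 \<and> degree d = n"
    unfolding n_def by (rule LeastI[of _ "degree p"]) (use pI \<open>p \<noteq> 0\<close> in auto)
  then obtain d where d: "d \<in> I" "d \<noteq> 0" "degree d = n" by blast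
  have least: "u = 0" if "u \<in> I" "degree u < n" for u
    using not_less_Least[of "degree u" "\<lambda>n. \<exists>d\<in>I. d \<noteq> 0 \<and> degree d = n"] that unfolding n_def by blast
  have "degree d = 0"
  proof (rule ccontr)
    assume "degree d \<noteq> 0"
    have div: "\<exists>c e. c \<noteq> 0 \<and> smult c u = d * e" if "u \<in> I" for u
    proof -
      obtain c e where ce: "c \<noteq> 0" "smult c u = d * e + pseudo_mod u d"
        using pseudo_mod(1)[OF \<open>d \<noteq> 0\<close>, of u] by blast
      have "smult c u - e * d \<in> I"
      proof -
        have "smult c u \<in> I" using I_diff[OF pI pI, of 1] I_diff[of 0 u "- [:c:]"] \<open>u \<in> I\<close> by simp
        then show ?thesis using I_diff d(1) by blast
      qed
      then have "pseudo_mod u d \<in> I" using ce(2) by (simp add: algebra_simps)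
      then have "pseudo_mod u d = 0"
        using pseudo_mod(2)[OF \<open>d \<noteq> 0\<close>, of u] least d(3) by blast
      with ce show ?thesis by auto
    qed
    obtain c e where ce: "c \<noteq> 0" "smult c p = d * e" using div[OF pI] by blast
    obtain c' e' where ce': "c' \<noteq> 0" "smult c' q = d * e'" using div[OF qI] by blast
    have prime: "prime_elem p" using p by (simp add: prime_elem_iff_irreducible)
    have "p dvd d * e" unfolding ce(2)[symmetric] by (rule dvd_smult) simp
    \<comment> \<open>Otherwise cancelling \<open>p\<close> would leave \<open>d\<close>, of
      positive degree, as a divisor of the nonzero constant \<open>[:c:]\<close>.\<close>
    moreover have "\<not> p dvd e"
    proof
      assume "p dvd e"
      then obtain f where f: "e = p * f" by blast
      have "p * (d * f) = p * [:c:]" using ce(2) f by (simp add: algebra_simps)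
      then have "d * f = [:c:]" using \<open>p \<noteq> 0\<close> by (simp only: mult_cancel_left) simp
      then have "d dvd [:c:]" by (metis dvd_triv_left)
      then have "degree d \<le> degree [:c:]" by (rule dvd_imp_degree_le) (use ce(1) in simp)
      then show False using \<open>degree d \<noteq> 0\<close> by simp
    qed
    \<comment> \<open>Now \<open>p\<close> divides a constant multiple of \<open>q\<close> but not
      \<open>q\<close>, so it divides the constant. Then \<open>p\<close> has degree 0, and as a
      nonzero member of \<open>I\<close> it forces \<open>n = 0\<close>.\<close>
    ultimately have "p dvd d" using prime prime_elem_dvd_mult_iff by blast
    then have "p dvd smult c' q" unfolding ce'(2) by simp
    then have "p dvd [:c':] * q" by simp
    then have "p dvd [:c':]" using prime nd prime_elem_dvd_mult_iff by blast
    then have "degree p = 0" using ce'(1) dvd_imp_degree_le[of p "[:c':]"] by simp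
    then have "n = 0"
      using least[OF pI] \<open>p \<noteq> 0\<close> by auto
    then show False using \<open>degree d \<noteq> 0\<close> d(3) by simp
  qed
  then obtain r where r: "d = [:r:]" by (metis degree_0_id degree_eq_zeroE)
  obtain a b where "d = a * p + b * q" using d(1) by (auto simp: I_def)
  with that[of r a b] r d(2) show ?thesis by auto
qed

section \<open>Theta constants\<close>

definition half_cvec :: "int ^ 2 \<Rightarrow> complex ^ 2" where
  "half_cvec b = (\<chi> k. of_int (b $ k) / 2)"

lemma half_cvec_add: "half_cvec b + half_cvec b = cvec b"
  unfolding vec_eq_iff by (simp add: half_cvec_def cvec_def)

lemma half_cvec_shift: "half_cvec (b + m + m) = half_cvec b + cvec m"
  unfolding vec_eq_iff by (simp add: half_cvec_def cvec_def add_divide_distrib)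

lemma cmat_half_cvec: "cmat A *v half_cvec b = half_cvec (A *v b)"
  by (simp add: map_matrix_def matrix_vector_mult_def vec_eq_iff half_cvec_def sum_divide_distrib)

lemma theta_eq_riemann_theta: "theta i \<Omega> = riemann_theta (half_cvec (theta_char i)) \<Omega>"
proof -
  have "\<i> * of_real pi * (\<Sum>k\<in>UNIV. \<Sum>l\<in>UNIV. of_int (n $ k) * \<Omega> $ k $ l * of_int (n $ l))
        + \<i> * of_real pi * (\<Sum>k\<in>UNIV. of_int (n $ k * theta_char i $ k))
      = \<i> * of_real pi * bdot (cvec n) (\<Omega> *v cvec n)
        + 2 * of_real pi * \<i> * bdot (cvec n) (half_cvec (theta_char i))" for n
    by (simp add: bdot_def cvec_def half_cvec_def matrix_vector_mult_def sum_2 algebra_simps)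
  then show ?thesis by (simp add: theta_def riemann_theta_def theta_term_def)
qed

lemma matrix_mult_scaleR:
  fixes A B :: "cmat2"
  shows "(r *\<^sub>R A) ** B = r *\<^sub>R (A ** B)" "A ** (r *\<^sub>R B) = r *\<^sub>R (A ** B)" "(r *\<^sub>R A) *v x = r *\<^sub>R (A *v x)"
    "A *v (r *\<^sub>R x) = r *\<^sub>R (A *v x)"
  by (simp_all add: matrix_matrix_mult_def matrix_vector_mult_def vec_eq_iff scaleR_sum_right)

lemma siegel_H2_scaleR: "\<tau> \<in> siegel_H2 \<Longrightarrow> r > 0 \<Longrightarrow> r *\<^sub>R \<tau> \<in> siegel_H2"
  by (auto simp: siegel_H2_iff power_mult_distrib power2_eq_square)

lemma Gamma24D:
  assumes "N \<in> Gamma24"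
  shows "N \<in> Gamma2" "[blkA N $ i $ j = mat 1 $ i $ j] (mod 2)" "even (blkB N $ i $ j)" "even (blkC N $ i $ j)"
    "[blkD N $ i $ j = mat 1 $ i $ j] (mod 2)" "4 dvd blkB N $ i $ i" "4 dvd blkC N $ i $ i"
proof -
  have *: "[N $ k $ l = mat 1 $ k $ l] (mod 2)" for k l using assms by (simp add: Gamma24_def)
  have m: "(mat 1 :: mat4) $ Inl i $ Inl j = mat 1 $ i $ j" "(mat 1 :: mat4) $ Inr i $ Inr j = mat 1 $ i $ j"
    "(mat 1 :: mat4) $ Inl i $ Inr j = 0" "(mat 1 :: mat4) $ Inr i $ Inl j = 0"
    by (simp_all add: mat_def)
  show "[blkA N $ i $ j = mat 1 $ i $ j] (mod 2)" "[blkD N $ i $ j = mat 1 $ i $ j] (mod 2)"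
    using *[of "Inl i" "Inl j"] *[of "Inr i" "Inr j"] by (simp_all add: m blkA_def blkD_def)
  show "even (blkB N $ i $ j)" "even (blkC N $ i $ j)"
    using *[of "Inl i" "Inr j"] *[of "Inr i" "Inl j"]
    by (simp_all add: m blkB_def blkC_def cong_0_iff)
  show "N \<in> Gamma2" "4 dvd blkB N $ i $ i" "4 dvd blkC N $ i $ i"
    using assms by (simp_all add: Gamma24_def)
qed

text \<open>Conjugation by the scaling \<open>\<Omega> \<mapsto> \<Omega> / 2\<close> halves
  \<open>B\<close> and doubles \<open>C\<close>; evenness of \<open>B\<close> keeps the result
  integral, and the denominator is unchanged.\<close>

lemma Gamma24_halve:
  assumes N: "N \<in> Gamma24" and \<Omega>: "\<Omega> \<in> siegel_H2"
  obtains N' where "N' \<in> Gamma2" "blkA N' = blkA N" "blkC N' = blkC N + blkC N" "blkD N' = blkD N"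
    "blkB N = blkB N' + blkB N'" "siegel_act N' ((1 / 2) *\<^sub>R \<Omega>) = (1 / 2) *\<^sub>R siegel_act N \<Omega>"
    "transpose (siegel_Q N' ((1 / 2) *\<^sub>R \<Omega>)) = transpose (siegel_Q N \<Omega>)"
proof -
  define A B C D where "A = blkA N" "B = blkB N" "C = blkC N" "D = blkD N"
  note defs = this
  define B' where "B' = (\<chi> i j. B $ i $ j div 2)"
  have B: "B = B' + B'"
    using Gamma24D(3)[OF N] by (simp add: vec_eq_iff B'_def defs)
  have inj: "X = Y" if "X + X = Y + Y" for X Y :: "int ^ 2 ^ 2"
    using that by (simp add: vec_eq_iff)
  define N' where "N' = mat4_of_blocks A B' (C + C) D"
  have N2: "N \<in> Gamma2" using Gamma24D(1)[OF N] .
  have "N' \<in> Gamma2"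
    unfolding Gamma2_iff
  proof (intro conjI)
    have *: "transpose A ** C = transpose C ** A" "transpose B ** D = transpose D ** B"
      "transpose A ** D - transpose C ** B = mat 1"
      using N2 by (simp_all add: Gamma2_iff defs)
    show "transpose (blkA N') ** blkC N' = transpose (blkC N') ** blkA N'"
      unfolding N'_def blk_mat4_of_blocks transpose_arith matrix_add_ldistrib matrix_mult_add_left *(1) ..
    show "transpose (blkB N') ** blkD N' = transpose (blkD N') ** blkB N'"
      by (rule inj) (use *(2) in \<open>simp only: N'_def blk_mat4_of_blocks B transpose_arith matrix_add_ldistrib matrix_mult_add_left\<close>)
    show "transpose (blkA N') ** blkD N' - transpose (blkC N') ** blkB N' = mat 1"
      using *(3) by (simp only: N'_def blk_mat4_of_blocks B transpose_arith matrix_add_ldistrib matrix_mult_add_left)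
  qed
  have h: "(1 / 2) *\<^sub>R \<Omega> \<in> siegel_H2" by (rule siegel_H2_scaleR[OF \<Omega>]) simp
  have Q: "siegel_Q N' ((1 / 2) *\<^sub>R \<Omega>) = siegel_Q N \<Omega>"
    unfolding siegel_Q_def N'_def blk_mat4_of_blocks cmat_simps matrix_mult_add_left matrix_mult_scaleR defs
      scaleR_left_distrib[symmetric] by simp
  have P: "siegel_P N' ((1 / 2) *\<^sub>R \<Omega>) = (1 / 2) *\<^sub>R siegel_P N \<Omega>"
  proof -
    have "cmat B' = (1 / 2) *\<^sub>R cmat B"
      unfolding B cmat_simps scaleR_right_distrib scaleR_left_distrib[symmetric] by simp
    then show ?thesis
      unfolding siegel_P_def N'_def blk_mat4_of_blocks matrix_mult_scaleR defs scaleR_right_distrib by simp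
  qed
  have "siegel_act N' ((1 / 2) *\<^sub>R \<Omega>) = (1 / 2) *\<^sub>R siegel_act N \<Omega>"
    by (rule siegel_act_eqI[OF \<open>N' \<in> Gamma2\<close> h]) (simp add: Q P matrix_mult_scaleR siegel_act_Q[OF N2 \<Omega>])
  with \<open>N' \<in> Gamma2\<close> show ?thesis
    using B Q by (intro that[of N']) (simp_all add: N'_def defs)
qed

text \<open>At a half-integral \<open>w\<close> the vector \<open>R w\<close> differs from
  \<open>w\<close> by a lattice vector. The diagonal of \<open>B\<close> modulo 4 makes the
  functional equation applicable to the halved matrix, and the diagonal of \<open>C\<close> modulo 4
  makes the remaining exponential equal to 1, so that \<open>\<kappa>\<close> is the same for all
  characteristics.\<close>

lemma theta_Gamma24:
  assumes N: "N \<in> Gamma24" and \<Omega>: "\<Omega> \<in> siegel_H2"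
  obtains \<kappa> where "\<kappa> \<noteq> 0" "\<And>i. theta i ((1 / 2) *\<^sub>R siegel_act N \<Omega>) = \<kappa> * theta i ((1 / 2) *\<^sub>R \<Omega>)"
proof -
  define A B C D where "A = blkA N" "B = blkB N" "C = blkC N" "D = blkD N"
  note defs = this
  obtain N' where N': "N' \<in> Gamma2" and blk: "blkA N' = A" "blkC N' = C + C" "blkD N' = D" "B = blkB N' + blkB N'"
    and act: "siegel_act N' ((1 / 2) *\<^sub>R \<Omega>) = (1 / 2) *\<^sub>R siegel_act N \<Omega>"
    and RQ: "transpose (siegel_Q N' ((1 / 2) *\<^sub>R \<Omega>)) = transpose (siegel_Q N \<Omega>)"
    using Gamma24_halve[OF N \<Omega>] unfolding defs by metis
  define \<tau> where "\<tau> = (1 / 2) *\<^sub>R \<Omega>"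
  have \<tau>: "\<tau> \<in> siegel_H2" unfolding \<tau>_def by (rule siegel_H2_scaleR[OF \<Omega>]) simp
  then have symm: "transpose \<tau> = \<tau>" by (simp add: siegel_H2_def)
  have Aij: "[A $ i $ j = mat 1 $ i $ j] (mod 2)" "[D $ i $ j = mat 1 $ i $ j] (mod 2)" "even (C $ i $ j)" "4 dvd C $ i $ i"
     "4 dvd B $ i $ i" "even (B $ i $ j)" for i j
    using Gamma24D[OF N] by (simp_all add: defs)
  have parity: "even (A $ i $ j) \<longleftrightarrow> i \<noteq> j" "even (D $ i $ j) \<longleftrightarrow> i \<noteq> j" for i j
    using Aij(1,2)[of i j] by (cases "i = j"; simp add: mat_def cong_def; presburger)+
  have off: "even (A $ 1 $ 2)" "even (A $ 2 $ 1)" "even (D $ 1 $ 2)" "even (D $ 2 $ 1)" "odd (D $ 1 $ 1)" "odd (D $ 2 $ 2)"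
    unfolding parity by simp_all
  have bB: "B $ i $ j = 2 * (blkB N' $ i $ j)" for i j
    by (subst blk(4)) simp
  have evB: "even (blkB N' $ i $ i)" for i
    using Aij(5)[of i] unfolding bB by presburger
  have evAB: "even ((blkA N' ** transpose (blkB N')) $ i $ i)" for i
    using exhaust_2[of i] evB[of 1] evB[of 2] off
    by (auto simp: matrix_matrix_mult_def transpose_def sum_2 blk)
  have evCD: "even ((blkC N' ** transpose (blkD N')) $ i $ i)" for i
    by (simp add: matrix_matrix_mult_def transpose_def sum_2 blk algebra_simps)
  obtain \<kappa> where "\<kappa> \<noteq> 0" and \<kappa>: "\<And>w. exp (\<i> * of_real pi * bdot w (cmat (blkC N') *v (transpose (siegel_Q N' \<tau>) *v w)))
      * riemann_theta (transpose (siegel_Q N' \<tau>) *v w) \<tau> = \<kappa> * riemann_theta w (siegel_act N' \<tau>)"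
    using theta_functional_equation[OF N' \<tau> evAB evCD] by metis
  have "\<kappa> * riemann_theta (half_cvec b) (siegel_act N' \<tau>) = riemann_theta (half_cvec b) \<tau>" for b
  proof -
    define w where "w = half_cvec b"
    \<comment> \<open>Since \<open>w\<close> is half of \<open>b\<close> and the lower left block is
      \<open>C + C\<close>, this is an integral vector.\<close>
    define n where "n = transpose C *v b"
    define l where "l = (\<chi> k. ((transpose D *v b) $ k - b $ k) div 2)"
    define R where "R = transpose (siegel_Q N' \<tau>)"
    have l: "transpose D *v b = b + l + l"
    proof -
      have "even ((transpose D *v b) $ k - b $ k)" for k
        using exhaust_2[of k] off by (auto simp: matrix_vector_mult_def transpose_def sum_2)
      then show ?thesis by (simp add: l_def vec_eq_iff)
    qed
    have Dw: "transpose (cmat D) *v w = w + cvec l"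
      unfolding w_def cmat_simps(6)[symmetric] cmat_half_cvec l half_cvec_shift ..
    have Cw: "transpose (cmat (C + C)) *v w = cvec n"
      unfolding w_def cmat_simps transpose_arith matrix_vector_mult_add_rdistrib
      unfolding cmat_simps(6)[symmetric] cmat_half_cvec half_cvec_add n_def ..
    have Rw: "R *v w = w + (\<tau> *v cvec n + cvec l)"
      unfolding R_def siegel_Q_def transpose_arith matrix_transpose_mul symm matrix_vector_mult_add_rdistrib
        matrix_vector_mul_assoc[symmetric] blk Cw Dw by simp
    have j2: "bdot n (transpose D *v b) = bdot b ((C ** transpose D) *v b)"
      unfolding n_def bdot_matrix_left by (simp add: matrix_vector_mul_assoc)
    \<comment> \<open>This is the quadratic form of the symmetric matrix \<open>C D\<^sup>T\<close>
      at \<open>b\<close>: its diagonal is divisible by 4, and its even off-diagonal entry counts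
      twice.\<close>
    have "4 dvd bdot n (transpose D *v b)"
    proof -
      have S: "(C ** transpose D) $ 2 $ 1 = (C ** transpose D) $ 1 $ 2"
      proof -
        have "transpose (C ** transpose D) = C ** transpose D"
          using Gamma2_row_relations(2)[OF Gamma24D(1)[OF N]] by (simp add: matrix_transpose_mul defs)
        moreover have "transpose (C ** transpose D) $ 2 $ 1 = (C ** transpose D) $ 1 $ 2" by (simp add: transpose_def)
        ultimately show ?thesis by simp
      qed
      have "4 dvd (C ** transpose D) $ i $ i" for i
      proof -
        have "4 dvd C $ 1 $ 2 * D $ 1 $ 2" "4 dvd C $ 2 $ 1 * D $ 2 $ 1"
          using mult_dvd_mono[OF Aij(3)[of 1 2] off(3)] mult_dvd_mono[OF Aij(3)[of 2 1] off(4)] by simp_all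
        then show ?thesis
          using exhaust_2[of i] Aij(4)[of 1] Aij(4)[of 2] by (auto simp: matrix_matrix_mult_def transpose_def sum_2)
      qed
      moreover have "4 dvd 2 * (C ** transpose D) $ 1 $ 2"
      proof -
        have "even ((C ** transpose D) $ 1 $ 2)"
          using Aij(3) by (simp add: matrix_matrix_mult_def transpose_def sum_2)
        then show ?thesis by presburger
      qed
      moreover have "bdot b ((C ** transpose D) *v b) = (C ** transpose D) $ 1 $ 1 * (b $ 1)\<^sup>2
          + (C ** transpose D) $ 2 $ 2 * (b $ 2)\<^sup>2 + (2 * (C ** transpose D) $ 1 $ 2) * (b $ 1 * b $ 2)"
        unfolding bdot_def matrix_vector_mult_def[of "C ** transpose D"] sum_2 using S
        by (simp add: power2_eq_square algebra_simps)
      ultimately show ?thesis unfolding j2 by (metis dvd_add dvd_mult2)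
    qed
    then obtain j where j: "bdot n (b + l + l) = 2 * j" and "even j"
    proof -
      obtain i where "bdot n (b + l + l) = 4 * i" using \<open>4 dvd bdot n (transpose D *v b)\<close> unfolding l by blast
      then show ?thesis by (intro that[of "2 * i"]) simp_all
    qed
    \<comment> \<open>\<open>w + cvec l\<close> is half of \<open>transpose D *v b\<close>, so the
      pairing is half of a multiple of 4.\<close>
    have wl: "bdot (cvec n) (w + cvec l) = of_int j"
    proof -
      have "bdot (cvec n) (cvec (b + l + l)) = 2 * of_int j"
        unfolding bdot_cvec j by simp
      moreover have "cvec (b + l + l) = (w + cvec l) + (w + cvec l)"
        unfolding cvec_simps(1) half_cvec_add[of b, symmetric] w_def by (simp only: add_ac)
      ultimately have "bdot (cvec n) (w + cvec l) + bdot (cvec n) (w + cvec l) = 2 * of_int j"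
        by (simp only: bdot_simps(2))
      then show ?thesis by simp
    qed
    have "\<kappa> * riemann_theta w (siegel_act N' \<tau>)
        = exp (\<i> * of_real pi * bdot w (cmat (blkC N') *v (R *v w))) * riemann_theta (R *v w) \<tau>"
      unfolding R_def \<kappa> ..
    also have "\<dots> = (exp (\<i> * of_real pi * bdot (cvec n) (R *v w))
        * exp (- \<i> * of_real pi * bdot (cvec n) (\<tau> *v cvec n) - 2 * of_real pi * \<i> * bdot (cvec n) (w + cvec l)))
        * riemann_theta w \<tau>"
      unfolding bdot_matrix[of w] blk Cw unfolding Rw riemann_theta_lattice[OF symm] by simp
    also have "exp (\<i> * of_real pi * bdot (cvec n) (R *v w))
        * exp (- \<i> * of_real pi * bdot (cvec n) (\<tau> *v cvec n) - 2 * of_real pi * \<i> * bdot (cvec n) (w + cvec l)) = exp 0"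
    proof (rule exp_mult_eq_mod_2pi_i[OF _ \<open>even j\<close>])
      have "bdot (cvec n) (R *v w) = bdot (cvec n) (\<tau> *v cvec n) + of_int j"
        unfolding Rw wl[symmetric] by (simp add: bdot_simps)
      then show "\<i> * of_real pi * bdot (cvec n) (R *v w) + (- \<i> * of_real pi * bdot (cvec n) (\<tau> *v cvec n)
          - 2 * of_real pi * \<i> * bdot (cvec n) (w + cvec l)) = 0 - \<i> * of_real pi * of_int j"
        unfolding wl by (simp add: algebra_simps)
    qed
    finally show ?thesis by (simp add: w_def)
  qed
  then have "theta i ((1 / 2) *\<^sub>R siegel_act N \<Omega>) = (1 / \<kappa>) * theta i ((1 / 2) *\<^sub>R \<Omega>)" for i
    unfolding theta_eq_riemann_theta act[symmetric] \<tau>_def[symmetric] using \<open>\<kappa> \<noteq> 0\<close> by (simp add: field_simps)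
  with \<open>\<kappa> \<noteq> 0\<close> show ?thesis by (intro that[of "1 / \<kappa>"]) simp_all
qed

lemma bprime_Gamma24:
  assumes "N \<in> Gamma24" "\<Omega> \<in> siegel_H2"
  shows "bprime i (siegel_act N \<Omega>) = bprime i \<Omega>" "siegel_act N \<Omega> \<in> bprime_dom \<longleftrightarrow> \<Omega> \<in> bprime_dom"
proof -
  obtain \<kappa> where "\<kappa> \<noteq> 0" "\<And>i. theta i ((1 / 2) *\<^sub>R siegel_act N \<Omega>) = \<kappa> * theta i ((1 / 2) *\<^sub>R \<Omega>)"
    by (rule theta_Gamma24[OF assms]) blast
  then show "bprime i (siegel_act N \<Omega>) = bprime i \<Omega>" "siegel_act N \<Omega> \<in> bprime_dom \<longleftrightarrow> \<Omega> \<in> bprime_dom"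
    using siegel_act_H2[OF Gamma24D(1)[OF assms(1)] assms(2)] assms(2)
    by (simp_all add: bprime_def bprime_dom_def)
qed

text \<open>The theta constant of characteristic \<open>(b / 2, 0)\<close>; at \<open>2 \<Omega>\<close> these are the second order
  theta constants, which a suitable transformation exchanges with the \<open>\<theta>\<^sub>i (\<Omega> / 2)\<close>.\<close>

definition theta2 :: "int ^ 2 \<Rightarrow> cmat2 \<Rightarrow> complex" where
  "theta2 b \<tau> = (\<Sum>\<^sub>\<infinity>n. exp (\<i> * of_real pi * bdot (half_cvec (b + n + n)) (\<tau> *v half_cvec (b + n + n))))"

lemma theta2_eq_riemann_theta:
  assumes "transpose \<tau> = \<tau>"
  shows "theta2 b \<tau> = exp (\<i> * of_real pi * bdot (half_cvec b) (\<tau> *v half_cvec b)) * riemann_theta (\<tau> *v half_cvec b) \<tau>"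
proof -
  have "exp (\<i> * of_real pi * bdot (half_cvec (b + n + n)) (\<tau> *v half_cvec (b + n + n)))
     = exp (\<i> * of_real pi * bdot (half_cvec b) (\<tau> *v half_cvec b)) * theta_term (\<tau> *v half_cvec b) \<tau> n" for n
    unfolding theta_term_def exp_add[symmetric] half_cvec_shift
    using bdot_symmetric[OF assms, of "cvec n" "half_cvec b"]
    by (simp add: bdot_simps matrix_vector_right_distrib algebra_simps)
  then show ?thesis
    unfolding theta2_def riemann_theta_def infsum_cmult_right'[symmetric] by (intro infsum_cong)
qed

text \<open>The embedding of two by two matrices by scalar blocks; SL_2(Z) lands in
  \<open>Gamma2\<close>.\<close>

definition scalar4 :: "int \<Rightarrow> int \<Rightarrow> int \<Rightarrow> int \<Rightarrow> mat4" where
  "scalar4 a b c d = mat4_of_blocks (mat a) (mat b) (mat c) (mat d)"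

lemma mat_mult_mat: "(mat a :: int ^ 2 ^ 2) ** mat b = mat (a * b)"
  by (simp add: mat_def matrix_matrix_mult_def vec_eq_iff sum_2 forall_2)

lemma scalar4_Gamma2: "a * d - b * c = 1 \<Longrightarrow> scalar4 a b c d \<in> Gamma2"
  unfolding Gamma2_iff scalar4_def blk_mat4_of_blocks transpose_mat mat_mult_mat
  by (auto simp: mult.commute mat_def vec_eq_iff)

lemma cmat_mat: "cmat (mat a) ** X = of_int a *\<^sub>R X" "X ** cmat (mat a) = of_int a *\<^sub>R X"
   "cmat (mat a) *v x = of_int a *\<^sub>R x"
  unfolding vec_eq_iff vector_scaleR_component
  by (simp_all add: map_matrix_def mat_def matrix_matrix_mult_def matrix_vector_mult_def sum_2 forall_2
      scaleR_conv_of_real)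

lemma cvec_scaleR: "cvec (k *s b) = of_int k *\<^sub>R cvec b"
  unfolding vec_eq_iff vector_scaleR_component by (simp add: cvec_def scaleR_conv_of_real)

lemma bdot_scaleR: "bdot (r *\<^sub>R u) v = of_real r * bdot u v" "bdot u (r *\<^sub>R v) = of_real r * bdot u v"
  unfolding bdot_def vector_scaleR_component by (simp_all add: scaleR_conv_of_real algebra_simps)

text \<open>For odd \<open>c\<close> the vector \<open>c \<tau> w\<close> is \<open>\<tau> w\<close>
  up to a period, and for \<open>8 dvd d\<close> the vector \<open>d w\<close> is a period. So a
  real half-period is exchanged for a half-period in the direction of \<open>\<tau>\<close>, and the
  theta constant at the latter is \<open>theta2\<close>.\<close>

lemma theta_scalar4:
  assumes det: "a * d - b * c = 1" and ev: "even (a * b)" and c: "odd c" and d: "8 dvd d" and \<tau>: "\<tau> \<in> siegel_H2"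
  obtains \<kappa> where "\<kappa> \<noteq> 0" "\<And>i. theta2 (theta_char i) \<tau> = \<kappa> * theta i (siegel_act (scalar4 a b c d) \<tau>)"
proof -
  let ?M = "scalar4 a b c d"
  define k where "k = (c - 1) div 2"
  define e where "e = d div 8"
  have ck: "c = 2 * k + 1" unfolding k_def using c by presburger
  have de: "d = 8 * e" unfolding e_def using d by simp
  have symm: "transpose \<tau> = \<tau>" using \<tau> by (simp add: siegel_H2_def)
  define R where "R = transpose (siegel_Q ?M \<tau>)"
  have Rv: "R *v w = of_int c *\<^sub>R (\<tau> *v w) + of_int d *\<^sub>R w" for w
  proof -
    have "R = of_int c *\<^sub>R \<tau> + cmat (mat d)"
      unfolding R_def siegel_Q_def scalar4_def blk_mat4_of_blocks cmat_mat transpose_arith transpose_scalar symm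
      by (simp only: cmat_simps(6)[symmetric] transpose_mat)
    then show ?thesis by (simp only: matrix_vector_mult_add_rdistrib matrix_mult_scaleR cmat_mat)
  qed
  have evAB: "even ((blkA ?M ** transpose (blkB ?M)) $ i $ i)"
    and evCD: "even ((blkC ?M ** transpose (blkD ?M)) $ i $ i)" for i
    unfolding scalar4_def blk_mat4_of_blocks transpose_mat mat_mult_mat using ev de by (auto simp: mat_def)
  obtain \<kappa> where "\<kappa> \<noteq> 0" and \<kappa>: "\<And>w. exp (\<i> * of_real pi * bdot w (cmat (blkC ?M) *v (R *v w)))
      * riemann_theta (R *v w) \<tau> = \<kappa> * riemann_theta w (siegel_act ?M \<tau>)"
    using theta_functional_equation[OF scalar4_Gamma2[OF det] \<tau> evAB evCD] unfolding R_def by metis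
  have "theta2 b \<tau> = \<kappa> * riemann_theta (half_cvec b) (siegel_act ?M \<tau>)" for b
  proof -
    define w where "w = half_cvec b"
    let ?n = "k *s b" and ?l = "(4 * e) *s b"
    have ww: "cvec b = 2 *\<^sub>R w" unfolding half_cvec_add[symmetric] w_def by (simp only: scaleR_2)
    have Rw: "R *v w = \<tau> *v w + (\<tau> *v cvec ?n + cvec ?l)"
      unfolding Rv ck de cvec_scaleR ww
      by (simp add: matrix_mult_scaleR(4) scaleR_left_distrib algebra_simps)
    have "\<kappa> * riemann_theta w (siegel_act ?M \<tau>)
        = (exp (\<i> * of_real pi * bdot w (of_int c *\<^sub>R (R *v w)))
        * exp (- \<i> * of_real pi * bdot (cvec ?n) (\<tau> *v cvec ?n) - 2 * of_real pi * \<i> * bdot (cvec ?n) (\<tau> *v w + cvec ?l)))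
        * riemann_theta (\<tau> *v w) \<tau>"
      unfolding \<kappa>[symmetric] unfolding scalar4_def blk_mat4_of_blocks cmat_mat
      unfolding Rw riemann_theta_lattice[OF symm] by simp
    also have "exp (\<i> * of_real pi * bdot w (of_int c *\<^sub>R (R *v w)))
        * exp (- \<i> * of_real pi * bdot (cvec ?n) (\<tau> *v cvec ?n) - 2 * of_real pi * \<i> * bdot (cvec ?n) (\<tau> *v w + cvec ?l))
        = exp (\<i> * of_real pi * bdot w (\<tau> *v w))"
    \<comment> \<open>Divisibility of \<open>d\<close> by 8 is needed here: \<open>d\<close> equal
      to 4 times an odd number would leave a sign depending on \<open>bdot b b\<close>, and
      \<open>\<kappa>\<close> would vary with the characteristic.\<close>
    proof (rule exp_mult_eq_mod_2pi_i[where j = "2 * (e * (4 * k - c) * bdot b b)"])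
      have bb: "of_int (bdot b b) = 4 * bdot w w"
        unfolding bdot_cvec[symmetric] ww by (simp add: bdot_scaleR)
      show "\<i> * of_real pi * bdot w (of_int c *\<^sub>R (R *v w)) + (- \<i> * of_real pi * bdot (cvec ?n) (\<tau> *v cvec ?n)
          - 2 * of_real pi * \<i> * bdot (cvec ?n) (\<tau> *v w + cvec ?l))
          = \<i> * of_real pi * bdot w (\<tau> *v w) - \<i> * of_real pi * of_int (2 * (e * (4 * k - c) * bdot b b))"
        unfolding Rv of_int_mult bb cvec_scaleR ww bdot_simps bdot_scaleR matrix_mult_scaleR(4) ck de
        by (simp add: algebra_simps)
    qed simp
    finally show ?thesis unfolding w_def theta2_eq_riemann_theta[OF symm] by simp
  qed
  with \<open>\<kappa> \<noteq> 0\<close> show ?thesis by (intro that[of \<kappa>]) (simp_all add: theta_eq_riemann_theta)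
qed

section \<open>Degeneration at a cusp\<close>

text \<open>The excess of \<open>(b + 2 * n)\<^sup>2\<close> over \<open>b\<^sup>2\<close>, a
  natural number when \<open>b\<close> is 0 or 1.\<close>

definition theta2_gap :: "int \<Rightarrow> int \<Rightarrow> nat" where
  "theta2_gap b n = nat (4 * (n * (n + b)))"

text \<open>The second order theta constant divided by its leading monomial in \<open>q\<close> and
  \<open>r\<close>; unlike the theta constant it has a meaningful nonzero limit at
  \<open>q = r = 0\<close>.\<close>

definition theta2_fun :: "int \<Rightarrow> int \<Rightarrow> real \<Rightarrow> real \<Rightarrow> real \<Rightarrow> complex" where
  "theta2_fun a b v q r = (\<Sum>\<^sub>\<infinity>n::int ^ 2. of_real (q ^ theta2_gap a (n $ 1) * r ^ theta2_gap b (n $ 2))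
     * cis (pi * v * of_int ((a + 2 * n $ 1) * (b + 2 * n $ 2))))"

lemma theta2_gap_nonneg:
  assumes "b \<in> {0, 1}"
  shows "n * (n + b) \<ge> (0 :: int)" "(b + 2 * n)\<^sup>2 = b\<^sup>2 + int (theta2_gap b n)"
proof -
  show 1: "n * (n + b) \<ge> 0"
  proof (cases "n \<ge> 0")
    case True then show ?thesis using assms by auto
  next
    case False
    then have "n + b \<le> 0" "n \<le> 0" using assms by auto
    then show ?thesis by (rule mult_nonpos_nonpos[rotated])
  qed
  then show "(b + 2 * n)\<^sup>2 = b\<^sup>2 + int (theta2_gap b n)"
    by (simp add: theta2_gap_def power2_eq_square algebra_simps)
qed

lemma theta2_gap_ge:
  assumes "b \<in> {0, 1}"
  shows "int (theta2_gap b n) \<ge> 2 * \<bar>n\<bar> - 2"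
proof -
  have *: "(2 * x - 1) * (x - 1) \<ge> 0" "(2 * x + 1) * x \<ge> 0" "4 * x * x \<ge> 0" for x :: int
    by (cases "x \<ge> 1"; cases "x \<ge> 0"; simp add: mult_nonneg_nonneg mult_nonpos_nonpos)+
  have "4 * (n * (n + b)) \<ge> 2 * \<bar>n\<bar> - 2"
    using assms *[of n] *[of "- n"] by (auto simp: algebra_simps abs_if)
  then show ?thesis using theta2_gap_nonneg(1)[OF assms, of n] by (simp add: theta2_gap_def)
qed

lemma theta2_gap_zero:
  assumes "b \<in> {0, 1}"
  shows "theta2_gap b n = 0 \<longleftrightarrow> n = 0 \<or> n = - b"
proof -
  have "theta2_gap b n = 0 \<longleftrightarrow> n * (n + b) = 0"
    using theta2_gap_nonneg(1)[OF assms, of n] unfolding theta2_gap_def by linarith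
  then show ?thesis by (auto simp: add_eq_0_iff2)
qed

lemma power_gap_bound:
  assumes "b \<in> {0, 1}" "0 \<le> q" "q \<le> 1 / 2"
  shows "q ^ theta2_gap b n \<le> 4 * exp (- \<bar>of_int n :: real\<bar>)"
proof -
  have "q ^ theta2_gap b n \<le> (1 / 2) ^ theta2_gap b n"
    using assms by (intro power_mono) auto
  also have "\<dots> \<le> 4 * (1 / 4) ^ nat \<bar>n\<bar>"
  proof -
    have "2 * nat \<bar>n\<bar> \<le> theta2_gap b n + 2" using theta2_gap_ge[OF assms(1), of n] by linarith
    then have "(1 / 2 :: real) ^ (theta2_gap b n + 2) \<le> (1 / 2) ^ (2 * nat \<bar>n\<bar>)"
      by (intro power_decreasing) auto
    then show ?thesis by (simp add: power_add power_mult power2_eq_square)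
  qed
  also have "(1 / 4 :: real) ^ nat \<bar>n\<bar> \<le> exp (- 1) ^ nat \<bar>n\<bar>"
  proof (rule power_mono)
    have "exp 1 \<le> (4 :: real)" using exp_le by linarith
    then have "inverse 4 \<le> inverse (exp (1 :: real))" by (intro le_imp_inverse_le) auto
    then show "1 / 4 \<le> exp (- 1 :: real)" by (simp add: exp_minus inverse_eq_divide)
  qed simp
  also have "exp (- 1 :: real) ^ nat \<bar>n\<bar> = exp (- \<bar>of_int n\<bar>)"
    by (simp add: exp_of_nat_mult[symmetric])
  finally show ?thesis by simp
qed

lemma theta2_fun_term_bound:
  fixes n :: "int ^ 2"
  assumes "a \<in> {0, 1}" "b \<in> {0, 1}" "0 \<le> q" "q \<le> 1 / 2" "0 \<le> r" "r \<le> 1 / 2"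
  shows "norm (of_real (q ^ theta2_gap a (n $ 1) * r ^ theta2_gap b (n $ 2)) * cis x)
    \<le> 16 * exp (- \<bar>of_int (n $ 1)\<bar> - \<bar>of_int (n $ 2) :: real\<bar>)"
proof -
  have "q ^ theta2_gap a (n $ 1) * r ^ theta2_gap b (n $ 2)
      \<le> (4 * exp (- \<bar>of_int (n $ 1)\<bar>)) * (4 * exp (- \<bar>of_int (n $ 2)\<bar>))"
    using assms by (intro mult_mono power_gap_bound) auto
  also have "\<dots> = 16 * exp (- \<bar>of_int (n $ 1)\<bar> - \<bar>of_int (n $ 2) :: real\<bar>)"
    by (simp add: exp_diff exp_minus field_simps)
  finally show ?thesis
    unfolding norm_mult norm_of_real norm_cis using assms by simp
qed

lemma theta2_fun_summable:
  assumes "a \<in> {0, 1}" "b \<in> {0, 1}" "0 \<le> q" "q \<le> 1 / 2" "0 \<le> r" "r \<le> 1 / 2"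
  shows "(\<lambda>n::int ^ 2. of_real (q ^ theta2_gap a (n $ 1) * r ^ theta2_gap b (n $ 2)) * cis (f n)) summable_on UNIV"
proof -
  have "(\<lambda>n::int ^ 2. norm (of_real (q ^ theta2_gap a (n $ 1) * r ^ theta2_gap b (n $ 2)) * cis (f n))) summable_on UNIV"
    by (rule Infinite_Sum.abs_summable_on_comparison_test'[OF summable_on_cmult_right[OF summable_on_exp_abs_int2]])
      (rule theta2_fun_term_bound[OF assms])
  then show ?thesis by (rule abs_summable_summable)
qed

text \<open>Convergence is uniform up to the boundary point \<open>q = 0\<close>, so limits at the
  cusp are values there.\<close>

lemma theta2_fun_continuous:
  assumes ab: "a \<in> {0, 1}" "b \<in> {0, 1}" and K: "K \<ge> 1"
  shows "continuous_on {0..1 / 2} (\<lambda>q. theta2_fun a b v q (q ^ K))"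
  unfolding theta2_fun_def
proof (rule uniform_limit_theorem[OF _ Weierstrass_m_test_general[OF _ summable_on_cmult_right[OF summable_on_exp_abs_int2]]])
  show "\<forall>\<^sub>F X in finite_subsets_at_top UNIV. continuous_on {0..1 / 2} (\<lambda>q. \<Sum>n\<in>X.
      of_real (q ^ theta2_gap a (n $ 1) * (q ^ K) ^ theta2_gap b (n $ 2)) * cis (pi * v * of_int ((a + 2 * n $ 1) * (b + 2 * n $ 2))))"
    by (intro always_eventually allI continuous_intros)
  fix n :: "int ^ 2" and q :: real assume q: "q \<in> {0..1 / 2}"
  have "q ^ K \<le> q ^ 1" using q K by (intro power_decreasing) auto
  then have "q ^ K \<le> 1 / 2" using q by simp
  then show "norm (of_real (q ^ theta2_gap a (n $ 1) * (q ^ K) ^ theta2_gap b (n $ 2))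
      * cis (pi * v * of_int ((a + 2 * n $ 1) * (b + 2 * n $ 2)))) \<le> 16 * exp (- \<bar>of_int (n $ 1)\<bar> - \<bar>of_int (n $ 2) :: real\<bar>)"
    using q by (intro theta2_fun_term_bound ab) auto
qed simp

text \<open>By the convention \<open>0 ^ 0 = 1\<close> exactly the terms with both gaps equal to 0
  survive. The index set \<open>{0, - a}\<close> has one element when \<open>a = 0\<close> and two
  when \<open>a = 1\<close>.\<close>

lemma theta2_fun_zero:
  assumes ab: "a \<in> {0, 1}" "b \<in> {0, 1}"
  shows "theta2_fun a b v 0 0 = (\<Sum>m\<in>{0, - a}. \<Sum>n\<in>{0, - b}. cis (pi * v * of_int ((a + 2 * m) * (b + 2 * n))))"
proof -
  let ?S = "(\<lambda>(m, n). vector [m, n] :: int ^ 2) ` ({0, - a} \<times> {0, - b})"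
  let ?f = "\<lambda>n::int ^ 2. of_real (0 ^ theta2_gap a (n $ 1) * 0 ^ theta2_gap b (n $ 2))
     * cis (pi * v * of_int ((a + 2 * n $ 1) * (b + 2 * n $ 2)))"
  have inj: "inj_on (\<lambda>(m, n). vector [m, n] :: int ^ 2) A" for A
    by (auto simp: inj_on_def vec_eq_iff forall_2)
  have mem: "n \<in> ?S" if "n $ 1 \<in> {0, - a}" "n $ 2 \<in> {0, - b}" for n
  proof (rule image_eqI)
    show "n = (\<lambda>(m, n). vector [m, n]) (n $ 1, n $ 2)" by (simp add: vec_eq_iff forall_2)
    show "(n $ 1, n $ 2) \<in> {0, - a} \<times> {0, - b}" using that by blast
  qed
  have "theta2_fun a b v 0 0 = infsum ?f ?S"
    unfolding theta2_fun_def
  proof (rule infsum_cong_neutral)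
    fix n :: "int ^ 2" assume "n \<in> UNIV - ?S"
    then have "n $ 1 \<notin> {0, - a} \<or> n $ 2 \<notin> {0, - b}" using mem by blast
    then have "theta2_gap a (n $ 1) \<noteq> 0 \<or> theta2_gap b (n $ 2) \<noteq> 0"
      using theta2_gap_zero[OF ab(1)] theta2_gap_zero[OF ab(2)] by blast
    then show "?f n = 0" by auto
  qed simp_all
  also have "\<dots> = (\<Sum>p\<in>{0, - a} \<times> {0, - b}. ?f (vector [fst p, snd p]))"
  proof -
    have "infsum ?f ?S = sum ?f ?S" by (rule infsum_finite) blast
    then show ?thesis unfolding sum.reindex[OF inj] by (simp only: o_def case_prod_unfold)
  qed
  also have "\<dots> = (\<Sum>p\<in>{0, - a} \<times> {0, - b}. cis (pi * v * of_int ((a + 2 * fst p) * (b + 2 * snd p))))"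
  proof (rule sum.cong)
    fix p assume "p \<in> {0, - a} \<times> {0, - b}"
    then have "theta2_gap a (fst p) = 0" "theta2_gap b (snd p) = 0"
      using theta2_gap_zero[OF ab(1)] theta2_gap_zero[OF ab(2)] by auto
    then show "?f (vector [fst p, snd p]) = cis (pi * v * of_int ((a + 2 * fst p) * (b + 2 * snd p)))" by simp
  qed simp
  also have "\<dots> = (\<Sum>m\<in>{0, - a}. \<Sum>n\<in>{0, - b}. cis (pi * v * of_int ((a + 2 * m) * (b + 2 * n))))"
    by (simp only: sum.cartesian_product case_prod_unfold)
  finally show ?thesis .
qed

lemma theta2_fun_tendsto:
  assumes ab: "a \<in> {0, 1}" "b \<in> {0, 1}" and K: "K \<ge> 1"
  shows "((\<lambda>q. theta2_fun a b v q (q ^ K)) \<longlongrightarrow>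
    (\<Sum>m\<in>{0, - a}. \<Sum>n\<in>{0, - b}. cis (pi * v * of_int ((a + 2 * m) * (b + 2 * n))))) (at_right 0)"
proof -
  have "((\<lambda>q. theta2_fun a b v q (q ^ K)) \<longlongrightarrow> theta2_fun a b v 0 (0 ^ K)) (at 0 within {0..1 / 2})"
    using theta2_fun_continuous[OF assms, of v] by (auto simp: continuous_on_def)
  moreover have "at (0::real) within {0..1 / 2} = at_right 0"
    by (rule at_within_Icc_at_right) simp
  ultimately show ?thesis using K unfolding theta2_fun_zero[OF ab, symmetric] by (simp add: power_0_left)
qed

text \<open>At \<open>v = 0\<close> the phase disappears and each double series is a product of two
  one-variable series; both sides consist of the same four factors.\<close>

lemma theta2_fun_product:
  assumes "0 \<le> q" "q \<le> 1 / 2" "0 \<le> r" "r \<le> 1 / 2"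
  shows "theta2_fun 0 1 0 q r * theta2_fun 1 0 0 q r = theta2_fun 0 0 0 q r * theta2_fun 1 1 0 q r"
proof -
  define A where "A a x = (\<Sum>\<^sub>\<infinity>n. complex_of_real (x ^ theta2_gap a n))" for a and x :: real
  have "theta2_fun a b 0 q r = A a q * A b r" if ab: "a \<in> {0, 1}" "b \<in> {0, 1}" for a b
  proof -
    let ?g = "\<lambda>p. complex_of_real (q ^ theta2_gap a (fst p)) * complex_of_real (r ^ theta2_gap b (snd p))"
    have bij: "bij_betw (\<lambda>n::int ^ 2. (n $ 1, n $ 2)) UNIV UNIV"
      by (rule bij_betw_byWitness[where f' = "\<lambda>p. vector [fst p, snd p]"])
        (auto simp: vec_eq_iff forall_2)
    have "(\<lambda>n::int ^ 2. ?g (n $ 1, n $ 2)) summable_on UNIV"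
      using theta2_fun_summable[OF ab assms, of "\<lambda>_. 0"] by simp
    then have "?g summable_on UNIV"
      using summable_on_reindex_bij_betw[OF bij, of ?g] by simp
    then have summ: "?g summable_on (UNIV \<times> UNIV)" by simp
    have "theta2_fun a b 0 q r = (\<Sum>\<^sub>\<infinity>n::int ^ 2. ?g (n $ 1, n $ 2))"
      by (simp add: theta2_fun_def)
    also have "\<dots> = infsum ?g (UNIV \<times> UNIV)"
      using infsum_reindex_bij_betw[OF bij, of ?g] by simp
    also have "\<dots> = (\<Sum>\<^sub>\<infinity>x. \<Sum>\<^sub>\<infinity>y. ?g (x, y))"
      by (rule infsum_Sigma_banach[OF summ, symmetric])
    also have "\<dots> = A a q * A b r"
      by (simp add: A_def infsum_cmult_right' infsum_cmult_left')
    finally show ?thesis .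
  qed
  then show ?thesis by simp
qed

text \<open>The logarithms are scaled so that at twice this point the term of index \<open>m\<close>
  has absolute value \<open>q ^ (m\<^sub>1\<^sup>2) * r ^ (m\<^sub>2\<^sup>2)\<close>. The
  off-diagonal entry is real and contributes only a phase.\<close>

definition base_pt :: "real \<Rightarrow> real \<Rightarrow> real \<Rightarrow> cmat2" where
  "base_pt v q r = (\<chi> i j. if i = 1 \<and> j = 1 then \<i> * of_real (- 2 * ln q / pi)
     else if i = 2 \<and> j = 2 then \<i> * of_real (- 2 * ln r / pi) else of_real v)"

lemma base_pt_H2:
  assumes "0 < q" "q < 1" "0 < r" "r < 1"
  shows "base_pt v q r \<in> siegel_H2"
proof -
  have "ln q < 0" "ln r < 0" using assms by simp_all
  then have "0 < ln q * ln r" by (simp add: mult_neg_neg)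
  with \<open>ln q < 0\<close> show ?thesis
    by (simp add: siegel_H2_iff base_pt_def field_simps)
qed

text \<open>The factor \<open>c\<close> is 1 for the coordinates \<open>b'\<close> and
  \<open>p\<close> for the locus.\<close>

lemma theta2_base_pt_term:
  assumes "0 < q" "0 < r" "c > 0"
  shows "\<i> * of_real pi * bdot (half_cvec m) ((2 * c) *\<^sub>R base_pt v q r *v half_cvec m)
     = of_real (c * ln q * (of_int (m $ 1))\<^sup>2 + c * ln r * (of_int (m $ 2))\<^sup>2)
       + \<i> * of_real (pi * (c * v) * of_int (m $ 1 * m $ 2))"
  unfolding matrix_mult_scaleR bdot_scaleR
  by (simp add: bdot_def half_cvec_def base_pt_def matrix_vector_mult_def sum_2 power2_eq_square field_simps)

lemma theta2_base_pt:
  assumes ab: "a \<in> {0, 1}" "b \<in> {0, 1}" and qr: "0 < q" "0 < r"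
  shows "theta2 (vector [a, b]) (2 *\<^sub>R base_pt v q r) = of_real (q ^ nat a * r ^ nat b) * theta2_fun a b v q r"
proof -
  have pw: "exp (ln x * (of_int (a + 2 * n))\<^sup>2) = x ^ nat a * x ^ theta2_gap a n"
    if "x > 0" "a \<in> {0, 1}" for x :: real and a n
  proof -
    have "(of_int (a + 2 * n) :: real)\<^sup>2 = of_int ((a + 2 * n)\<^sup>2)" by simp
    also have "\<dots> = real (nat a + theta2_gap a n)"
      unfolding theta2_gap_nonneg(2)[OF that(2)] using that(2) by auto
    finally show ?thesis
      using that(1) by (simp only: power_add[symmetric] mult.commute[of "ln x"] exp_of_nat_mult exp_ln)
  qed
  have "exp (\<i> * of_real pi * bdot (half_cvec (vector [a, b] + n + n)) (2 *\<^sub>R base_pt v q r *v half_cvec (vector [a, b] + n + n)))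
      = of_real (q ^ nat a * r ^ nat b) * (of_real (q ^ theta2_gap a (n $ 1) * r ^ theta2_gap b (n $ 2))
        * cis (pi * v * of_int ((a + 2 * n $ 1) * (b + 2 * n $ 2))))" for n
  proof -
    let ?m = "vector [a, b] + n + n"
    have m: "?m $ 1 = a + 2 * n $ 1" "?m $ 2 = b + 2 * n $ 2" by simp_all
    have "exp (\<i> * of_real pi * bdot (half_cvec ?m) (2 *\<^sub>R base_pt v q r *v half_cvec ?m))
      = exp (of_real (ln q * (of_int (?m $ 1))\<^sup>2 + ln r * (of_int (?m $ 2))\<^sup>2))
        * cis (pi * v * of_int (?m $ 1 * ?m $ 2))"
      using theta2_base_pt_term[OF qr zero_less_one, of ?m v] by (simp add: exp_add cis_conv_exp)
    also have "exp (of_real (ln q * (of_int (?m $ 1))\<^sup>2 + ln r * (of_int (?m $ 2))\<^sup>2))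
        = complex_of_real ((q ^ nat a * q ^ theta2_gap a (n $ 1)) * (r ^ nat b * r ^ theta2_gap b (n $ 2)))"
      unfolding m exp_of_real exp_add pw[OF qr(1) ab(1)] pw[OF qr(2) ab(2)] ..
    finally show ?thesis unfolding m by simp
  qed
  then show ?thesis
    unfolding theta2_def theta2_fun_def infsum_cmult_right'[symmetric] by (rule infsum_cong)
qed

text \<open>At \<open>v = 1 / (2 c)\<close> the reflection \<open>m\<^sub>1 \<mapsto> - m\<^sub>1\<close> of the two odd summation variables changes
  the sign of every term.\<close>

lemma theta2_base_pt_vanishes:
  assumes qr: "0 < q" "0 < r" and c: "c > 0" "c * v = 1 / 2"
  shows "theta2 (vector [1, 1]) ((2 * c) *\<^sub>R base_pt v q r) = 0"
proof -
  let ?f = "\<lambda>n::int ^ 2. exp (\<i> * of_real pi * bdot (half_cvec (vector [1, 1] + n + n))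
      ((2 * c) *\<^sub>R base_pt v q r *v half_cvec (vector [1, 1] + n + n)))"
  let ?h = "\<lambda>n::int ^ 2. vector [- 1 - n $ 1, n $ 2] :: int ^ 2"
  have odd_term: "exp (\<i> * of_real pi * bdot (half_cvec m') ((2 * c) *\<^sub>R base_pt v q r *v half_cvec m'))
      = - exp (\<i> * of_real pi * bdot (half_cvec m) ((2 * c) *\<^sub>R base_pt v q r *v half_cvec m))"
    if m: "m' $ 1 = - (m $ 1)" "m' $ 2 = m $ 2" and odd: "odd (m $ 1 * m $ 2)" for m m' :: "int ^ 2"
  proof -
    obtain k where k: "m $ 1 * m $ 2 = 2 * k + 1" using odd by (rule oddE)
    let ?x = "pi * (c * v) * of_int (m $ 1 * m $ 2)"
    have "cis ?x = cis (of_int k * pi) * \<i>"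
      unfolding c(2) k by (simp add: cis_mult[symmetric] distrib_left mult.commute flip: cis_pi_half)
    moreover have "cis (- ?x) = cnj (cis ?x)" by (simp add: cis_cnj)
    moreover have "cnj (cis (of_int k * pi)) = cis (of_int k * pi)"
      by (simp add: complex_eq_iff sin_zero_iff_int2)
    ultimately have "cis (- ?x) = - cis ?x" by simp
    then show ?thesis
      unfolding theta2_base_pt_term[OF qr c(1)] exp_add cis_conv_exp m by simp
  qed
  have "?f (?h n) = - ?f n" for n
    by (rule odd_term) simp_all
  moreover have "bij_betw ?h UNIV UNIV"
    by (rule bij_betw_byWitness[where f' = ?h]) (auto simp: vec_eq_iff forall_2)
  ultimately have "infsum ?f UNIV = (\<Sum>\<^sub>\<infinity>n. - ?f n)"
    using infsum_reindex_bij_betw[of ?h UNIV UNIV ?f] by simp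
  then have "infsum ?f UNIV = - infsum ?f UNIV" by (simp add: infsum_uminus)
  then show ?thesis unfolding theta2_def by simp
qed

lemma mat_of_int_vector: "(mat (of_int k) :: cmat2) *v x = of_int k *\<^sub>R x"
  unfolding vec_eq_iff vector_scaleR_component
  by (simp add: mat_def matrix_vector_mult_def sum_2 forall_2 scaleR_conv_of_real)

text \<open>Modulo 2 the integer \<open>k * (n\<^sub>1\<^sup>2 + n\<^sub>2\<^sup>2)\<close> equals
  \<open>n\<^sub>1 + n\<^sub>2\<close>, so the characteristic changes by \<open>(1, 1)\<close>,
  which sends the index \<open>i\<close> to \<open>3 - i\<close>.\<close>

lemma theta_add_scalar:
  assumes "odd k" "i \<le> 3"
  shows "theta i (T + mat (of_int k)) = theta (3 - i) T"
proof -
  have "theta_term (half_cvec (theta_char i)) (T + mat (of_int k)) n = theta_term (half_cvec (theta_char (3 - i))) T n" for n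
  proof -
    define b where "b = theta_char i"
    have b': "theta_char (3 - i) = vector [1 - b $ 1, 1 - b $ 2]"
    proof -
      have "i \<in> {0, 1, 2, 3}" using assms(2) by auto
      then show ?thesis by (auto simp: b_def theta_char_def vec_eq_iff forall_2)
    qed
    let ?j = "n $ 1 * (k * n $ 1 + 2 * b $ 1 - 1) + n $ 2 * (k * n $ 2 + 2 * b $ 2 - 1)"
    have "even ?j" using assms(1) by auto
    have "theta_term (half_cvec b) (T + mat (of_int k)) n
        = exp (\<i> * of_real pi * bdot (cvec n) (T *v cvec n) + 2 * of_real pi * \<i> * bdot (cvec n) (half_cvec (vector [1 - b $ 1, 1 - b $ 2]))
          - \<i> * of_real pi * of_int (- ?j))"
      unfolding theta_term_def
      by (rule arg_cong[of _ _ exp])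
        (simp only: matrix_vector_mult_add_rdistrib bdot_simps mat_of_int_vector bdot_scaleR,
          simp add: bdot_def half_cvec_def cvec_def field_simps)
    also have "\<dots> = theta_term (half_cvec (vector [1 - b $ 1, 1 - b $ 2])) T n"
      unfolding theta_term_def by (rule exp_even_shift) (use \<open>even ?j\<close> in simp)
    finally show ?thesis unfolding b' b_def .
  qed
  then show ?thesis by (simp add: theta_eq_riemann_theta riemann_theta_def)
qed

lemma siegel_H2_add_scalar: "T \<in> siegel_H2 \<Longrightarrow> T + mat (of_int k) \<in> siegel_H2"
  unfolding siegel_H2_iff vector_add_component by (auto simp: mat_def)

text \<open>The determinant \<open>(1 - c) * (c + 1) + c * c\<close> is 1 for every
  \<open>c\<close>. If 8 divides \<open>c + 1\<close>, the lower row satisfies the conditions of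
  \<open>theta_scalar4\<close>, and \<open>c\<close> is still free modulo an odd prime.\<close>

definition cusp_matrix :: "int \<Rightarrow> mat4" where
  "cusp_matrix c = scalar4 (1 - c) (- c) c (c + 1)"

text \<open>The points whose theta constants \<open>\<theta>\<^sub>i (\<Omega> / 2)\<close> are proportional to the second order theta
  constants at \<open>base_pt v q r\<close>, in the opposite order.\<close>

definition cusp_pt :: "int \<Rightarrow> real \<Rightarrow> real \<Rightarrow> real \<Rightarrow> cmat2" where
  "cusp_pt c v q r = 2 *\<^sub>R (siegel_act (cusp_matrix c) (2 *\<^sub>R base_pt v q r) + mat (of_int 1))"

lemma cusp_matrix_Gamma2: "cusp_matrix c \<in> Gamma2"
  unfolding cusp_matrix_def by (rule scalar4_Gamma2) (simp add: algebra_simps)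

lemma cusp_pt_H2:
  assumes "0 < q" "q < 1" "0 < r" "r < 1"
  shows "cusp_pt c v q r \<in> siegel_H2"
  unfolding cusp_pt_def
  by (intro siegel_H2_scaleR siegel_H2_add_scalar siegel_act_H2 cusp_matrix_Gamma2 base_pt_H2 assms) simp_all

lemma theta_cusp_pt:
  assumes "8 dvd c + 1" "0 < q" "q < 1" "0 < r" "r < 1"
  obtains \<kappa> where "\<kappa> \<noteq> 0" "\<And>i. i \<le> 3 \<Longrightarrow>
    theta2 (theta_char (3 - i)) (2 *\<^sub>R base_pt v q r) = \<kappa> * theta i ((1 / 2) *\<^sub>R cusp_pt c v q r)"
proof -
  have H2: "2 *\<^sub>R base_pt v q r \<in> siegel_H2" by (intro siegel_H2_scaleR base_pt_H2 assms) simp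
  have "odd c" using assms(1) by presburger
  obtain \<kappa> where \<kappa>: "\<kappa> \<noteq> 0" "\<And>i. theta2 (theta_char i) (2 *\<^sub>R base_pt v q r)
      = \<kappa> * theta i (siegel_act (cusp_matrix c) (2 *\<^sub>R base_pt v q r))"
    by (rule theta_scalar4[of "1 - c" "c + 1" "- c" c "2 *\<^sub>R base_pt v q r"])
      (use \<open>odd c\<close> assms(1) H2 in \<open>simp_all add: cusp_matrix_def algebra_simps\<close>)
  show ?thesis
    by (rule that[OF \<kappa>(1)]) (simp only: cusp_pt_def \<kappa>(2) scaleR_scaleR, simp add: theta_add_scalar[of 1, simplified])
qed

text \<open>The reversal of the order makes the denominator \<open>theta 0\<close> proportional to
  the constant of characteristic \<open>(1, 1)\<close>, whose leading monomial \<open>q * r\<close>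
  is the smallest of the four. Hence the poles \<open>1 / q\<close>, \<open>1 / r\<close> and
  \<open>1 / (q * r)\<close>.\<close>

lemma bprime_cusp_pt:
  assumes c: "8 dvd c + 1" and qr: "0 < q" "q \<le> 1 / 2" "0 < r" "r \<le> 1 / 2" and nz: "theta2_fun 1 1 v q r \<noteq> 0"
  shows "cusp_pt c v q r \<in> bprime_dom"
    "bprime 1 (cusp_pt c v q r) * of_real q = theta2_fun 0 1 v q r / theta2_fun 1 1 v q r"
    "bprime 2 (cusp_pt c v q r) * of_real r = theta2_fun 1 0 v q r / theta2_fun 1 1 v q r"
    "bprime 3 (cusp_pt c v q r) * of_real (q * r) = theta2_fun 0 0 v q r / theta2_fun 1 1 v q r"
proof -
  have qr1: "q < 1" "r < 1" using qr by simp_all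
  obtain \<kappa> where "\<kappa> \<noteq> 0" and \<kappa>: "\<And>i. i \<le> 3 \<Longrightarrow>
    theta2 (theta_char (3 - i)) (2 *\<^sub>R base_pt v q r) = \<kappa> * theta i ((1 / 2) *\<^sub>R cusp_pt c v q r)"
    using theta_cusp_pt[OF c qr(1) qr1(1) qr(3) qr1(2)] by metis
  have ch: "theta_char 3 = vector [1, 1]" "theta_char 2 = vector [0, 1]" "theta_char (Suc 0) = vector [1, 0]"
    "theta_char 0 = vector [0, 0]"
    by (simp_all add: theta_char_def)
  have th: "\<kappa> * theta 0 ((1 / 2) *\<^sub>R cusp_pt c v q r) = of_real (q * r) * theta2_fun 1 1 v q r"
    "\<kappa> * theta 1 ((1 / 2) *\<^sub>R cusp_pt c v q r) = of_real r * theta2_fun 0 1 v q r"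
    "\<kappa> * theta 2 ((1 / 2) *\<^sub>R cusp_pt c v q r) = of_real q * theta2_fun 1 0 v q r"
    "\<kappa> * theta 3 ((1 / 2) *\<^sub>R cusp_pt c v q r) = theta2_fun 0 0 v q r"
    using \<kappa>[of 0] \<kappa>[of 1] \<kappa>[of 2] \<kappa>[of 3] theta2_base_pt[of 1 1 q r v] theta2_base_pt[of 0 1 q r v]
      theta2_base_pt[of 1 0 q r v] theta2_base_pt[of 0 0 q r v] qr
    by (simp_all add: ch)
  have nz0: "theta 0 ((1 / 2) *\<^sub>R cusp_pt c v q r) \<noteq> 0" using th(1) nz qr \<open>\<kappa> \<noteq> 0\<close> by auto
  then show "cusp_pt c v q r \<in> bprime_dom"
    using cusp_pt_H2 qr(1,3) qr1 by (simp add: bprime_dom_def)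
  have b: "bprime i (cusp_pt c v q r) = (\<kappa> * theta i ((1 / 2) *\<^sub>R cusp_pt c v q r)) / (\<kappa> * theta 0 ((1 / 2) *\<^sub>R cusp_pt c v q r))" for i
    using \<open>\<kappa> \<noteq> 0\<close> by (simp add: bprime_def)
  show "bprime 1 (cusp_pt c v q r) * of_real q = theta2_fun 0 1 v q r / theta2_fun 1 1 v q r"
    "bprime 2 (cusp_pt c v q r) * of_real r = theta2_fun 1 0 v q r / theta2_fun 1 1 v q r"
    "bprime 3 (cusp_pt c v q r) * of_real (q * r) = theta2_fun 0 0 v q r / theta2_fun 1 1 v q r"
    unfolding b th using qr nz by (simp_all add: field_simps)
qed

text \<open>Because \<open>p\<close> divides \<open>c\<close>, multiplication by \<open>p\<close>
  can be moved past the cusp matrix, and the new matrix again fits \<open>theta_scalar4\<close>. The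
  value becomes \<open>theta2\<close> of characteristic \<open>(1, 1)\<close> at
  \<open>2 * p\<close> times the base point, which vanishes by the choice of
  \<open>v\<close>.\<close>

lemma theta_cusp_pt_vanishes:
  assumes c: "8 dvd c + 1" and p: "odd p" "p > 0" "p dvd c" and qr: "0 < q" "q < 1" "0 < r" "r < 1"
    and v: "of_int p * v = 1 / 2"
  shows "theta 0 ((of_int p / 2) *\<^sub>R cusp_pt c v q r) = 0"
proof -
  obtain c0 where c0: "c = p * c0" using p(3) by blast
  have "odd c" using c by presburger
  then have "odd c0" unfolding c0 by simp
  define \<tau> where "\<tau> = 2 *\<^sub>R base_pt v q r"
  have \<tau>: "\<tau> \<in> siegel_H2" unfolding \<tau>_def by (intro siegel_H2_scaleR base_pt_H2 qr) simp
  define T where "T = siegel_act (cusp_matrix c) \<tau>"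
  \<comment> \<open>The conjugate of the cusp matrix by scaling with \<open>p\<close>: the upper
    right entry is multiplied by \<open>p\<close>, the lower left one divided by it.\<close>
  let ?N = "scalar4 (1 - c) (- (p * c)) c0 (c + 1)"
  have N: "?N \<in> Gamma2" by (rule scalar4_Gamma2) (simp add: c0 algebra_simps)
  have p\<tau>: "of_int p *\<^sub>R \<tau> \<in> siegel_H2" by (rule siegel_H2_scaleR[OF \<tau>]) (use p(2) in simp)
  have act: "siegel_act ?N (of_int p *\<^sub>R \<tau>) = of_int p *\<^sub>R T"
  proof (rule siegel_act_eqI[OF N p\<tau>])
    have Q: "siegel_Q ?N (of_int p *\<^sub>R \<tau>) = siegel_Q (cusp_matrix c) \<tau>"
      unfolding siegel_Q_def scalar4_def cusp_matrix_def blk_mat4_of_blocks cmat_mat by (simp add: c0 mult.commute)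
    have bm: "cmat (mat (- (p * c))) = of_int p *\<^sub>R cmat (mat (- c))"
      unfolding vec_eq_iff vector_scaleR_component by (simp add: map_matrix_def mat_def scaleR_conv_of_real)
    have P: "siegel_P ?N (of_int p *\<^sub>R \<tau>) = of_int p *\<^sub>R siegel_P (cusp_matrix c) \<tau>"
      unfolding siegel_P_def scalar4_def cusp_matrix_def blk_mat4_of_blocks cmat_mat bm
      by (simp add: scaleR_right_distrib mult.commute)
    show "(of_int p *\<^sub>R T) ** siegel_Q ?N (of_int p *\<^sub>R \<tau>) = siegel_P ?N (of_int p *\<^sub>R \<tau>)"
      unfolding Q P matrix_mult_scaleR T_def siegel_act_Q[OF cusp_matrix_Gamma2 \<tau>] ..
  qed
  have ev: "even ((1 - c) * - (p * c))" using \<open>odd c\<close> by simp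
  obtain \<kappa> where "\<kappa> \<noteq> 0" and \<kappa>: "\<And>i. theta2 (theta_char i) (of_int p *\<^sub>R \<tau>) = \<kappa> * theta i (of_int p *\<^sub>R T)"
    using theta_scalar4[OF _ ev \<open>odd c0\<close> c p\<tau>] unfolding act by (auto simp: c0 algebra_simps)
  have "theta2 (theta_char 3) (of_int p *\<^sub>R \<tau>) = theta2 (vector [1, 1]) ((2 * of_int p) *\<^sub>R base_pt v q r)"
    by (simp add: theta_char_def \<tau>_def mult.commute)
  also have "\<dots> = 0" by (rule theta2_base_pt_vanishes) (use qr p(2) v in simp_all)
  finally have "theta 3 (of_int p *\<^sub>R T) = 0" using \<kappa>[of 3] \<open>\<kappa> \<noteq> 0\<close> by simp
  moreover have "(of_int p / 2) *\<^sub>R cusp_pt c v q r = of_int p *\<^sub>R T + mat (of_int p)"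
  proof -
    have "of_int p *\<^sub>R (mat (of_int 1) :: cmat2) = mat (of_int p)"
      unfolding vec_eq_iff vector_scaleR_component by (simp add: mat_def scaleR_conv_of_real)
    then show ?thesis
      unfolding cusp_pt_def T_def \<tau>_def by (simp add: scaleR_right_distrib)
  qed
  ultimately show ?thesis by (simp add: theta_add_scalar[OF p(1)])
qed

section \<open>Growth of polynomials along the cusp\<close>

lemma poly_growth:
  fixes u :: "real \<Rightarrow> complex"
  assumes "((\<lambda>q. u q * of_real q) \<longlongrightarrow> c) F" "((\<lambda>q. complex_of_real q) \<longlongrightarrow> 0) F"
  shows "((\<lambda>q. poly r (u q) * of_real q ^ degree r) \<longlongrightarrow> lead_coeff r * c ^ degree r) F"
proof -
  have "poly r (u q) * of_real q ^ degree r
      = (\<Sum>i\<le>degree r. coeff r i * (u q * of_real q) ^ i * of_real q ^ (degree r - i))" for q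
    unfolding poly_altdef sum_distrib_right
  proof (intro sum.cong refl)
    fix i assume "i \<in> {..degree r}"
    then have "complex_of_real q ^ degree r = of_real q ^ i * of_real q ^ (degree r - i)"
      by (simp add: power_add[symmetric])
    then show "coeff r i * u q ^ i * of_real q ^ degree r = coeff r i * (u q * of_real q) ^ i * of_real q ^ (degree r - i)"
      by (simp add: power_mult_distrib mult_ac)
  qed
  moreover have "((\<lambda>q. \<Sum>i\<le>degree r. coeff r i * (u q * of_real q) ^ i * of_real q ^ (degree r - i))
      \<longlongrightarrow> (\<Sum>i\<le>degree r. coeff r i * c ^ i * 0 ^ (degree r - i))) F"
    by (intro tendsto_intros assms)
  moreover have "(\<Sum>i\<le>degree r. coeff r i * c ^ i * 0 ^ (degree r - i)) = (\<Sum>i\<in>{degree r}. coeff r i * c ^ i * 0 ^ (degree r - i))"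
    by (rule sum.mono_neutral_right) auto
  ultimately show ?thesis by simp
qed

lemma eval_rat_poly_sum:
  assumes "h 0 = (0 :: 'b::comm_ring_1)"
  shows "poly (map_poly h R) w = (\<Sum>j\<le>degree R. h (coeff R j) * w ^ j)"
proof -
  have "degree (map_poly h R) \<le> degree R"
    by (rule degree_le) (simp add: coeff_map_poly assms coeff_eq_0)
  then have "poly (map_poly h R) w = (\<Sum>j\<le>degree R. coeff (map_poly h R) j * w ^ j)"
    unfolding poly_altdef by (intro sum.mono_neutral_left) (auto simp: coeff_eq_0)
  then show ?thesis by (simp add: coeff_map_poly assms)
qed

text \<open>Letting the second argument grow as the \<open>K\<close>-th power of the first makes the leading
  coefficient in the second variable dominate.\<close>

lemma bivariate_nonvanishing:
  fixes R :: "rat poly poly"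
  assumes "R \<noteq> 0"
  shows "\<exists>K\<ge>1. \<forall>u w c c'. ((\<lambda>q. u q * of_real q) \<longlongrightarrow> c) (at_right 0) \<longrightarrow>
      ((\<lambda>q. w q * of_real (q ^ K)) \<longlongrightarrow> c') (at_right 0) \<longrightarrow> c \<noteq> 0 \<longrightarrow> c' \<noteq> (0::complex) \<longrightarrow>
      (\<forall>\<^sub>F q in at_right 0. poly (map_poly (\<lambda>S. poly (map_poly of_rat S) (u q)) R) (w q) \<noteq> 0)"
proof -
  define r where "r j = (map_poly of_rat (coeff R j) :: complex poly)" for j
  define J where "J = degree R"
  \<comment> \<open>Lowering the exponent of the second variable by one costs \<open>K\<close>
    powers of \<open>1 / q\<close>, more than any coefficient in the first variable can
    recover.\<close>
  define K where "K = Suc (\<Sum>j\<le>J. degree (r j))"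
  have deg: "degree (r j) < K" if "j \<le> J" for j
    unfolding K_def using member_le_sum[of j "{..J}" "\<lambda>j. degree (r j)"] that by simp
  have "r J \<noteq> 0" using assms by (simp add: r_def J_def map_poly_eq_0_iff)
  have "\<forall>\<^sub>F q in at_right 0. poly (map_poly (\<lambda>S. poly (map_poly of_rat S) (u q)) R) (w q) \<noteq> 0"
    if u: "((\<lambda>q. u q * of_real q) \<longlongrightarrow> c) (at_right 0)" and w: "((\<lambda>q. w q * of_real (q ^ K)) \<longlongrightarrow> c') (at_right 0)"
      and "c \<noteq> 0" "c' \<noteq> 0" for u w and c c' :: complex
  proof -
    have q0: "((\<lambda>q. complex_of_real q) \<longlongrightarrow> 0) (at_right 0)"
      by (rule tendsto_eq_intros refl)+ (simp add: tendsto_ident_at)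
    \<comment> \<open>The power of \<open>q\<close> left in the term of index \<open>j\<close> after
      multiplication by \<open>q ^ (K * J + degree (r J))\<close>: zero for \<open>j = J\<close> and
      positive below. The choice of \<open>K\<close> keeps the subtraction from being
      truncated.\<close>
    define e where "e j = K * (J - j) + degree (r J) - degree (r j)" for j
    have e: "K * J + degree (r J) = degree (r j) + K * j + e j" if "j \<le> J" for j
    proof (cases "j = J")
      case False
      then have "K * 1 \<le> K * (J - j)" using that by (intro mult_le_mono) auto
      moreover have "K * J = K * (J - j) + K * j" using that by (simp add: distrib_left[symmetric])
      ultimately show ?thesis using deg[OF that] unfolding e_def by linarith
    qed (simp add: e_def)
    have epos: "e j > 0" if "j < J" for j
    proof -
      have "K * 1 \<le> K * (J - j)" using that by (intro mult_le_mono) auto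
      then show ?thesis using deg[of j] that unfolding e_def by linarith
    qed
    let ?f = "\<lambda>q. poly (map_poly (\<lambda>S. poly (map_poly of_rat S) (u q)) R) (w q) * of_real q ^ (K * J + degree (r J))"
    let ?g = "\<lambda>j q. (poly (r j) (u q) * of_real q ^ degree (r j)) * (w q * of_real (q ^ K)) ^ j * of_real q ^ e j"
    let ?l = "\<lambda>j. (lead_coeff (r j) * c ^ degree (r j)) * c' ^ j * 0 ^ e j"
    have fg: "?f q = (\<Sum>j\<le>J. ?g j q)" for q
    proof -
      have "?f q = (\<Sum>j\<le>J. poly (r j) (u q) * w q ^ j * of_real q ^ (K * J + degree (r J)))"
        unfolding J_def r_def sum_distrib_right[symmetric] by (subst eval_rat_poly_sum) simp_all
      also have "\<dots> = (\<Sum>j\<le>J. ?g j q)"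
      proof (rule sum.cong)
        fix j assume "j \<in> {..J}"
        then show "poly (r j) (u q) * w q ^ j * of_real q ^ (K * J + degree (r J)) = ?g j q"
          by (subst e, simp) (simp only: power_add power_mult power_mult_distrib of_real_power mult_ac)
      qed simp
      finally show ?thesis .
    qed
    have "((\<lambda>q. \<Sum>j\<le>J. ?g j q) \<longlongrightarrow> (\<Sum>j\<le>J. ?l j)) (at_right 0)"
    proof (rule tendsto_sum)
      fix j
      note growth = poly_growth[OF u q0, of "r j"]
      note wj = tendsto_power[OF w, of j]
      note qj = tendsto_power[OF q0, of "e j"]
      show "((\<lambda>q. ?g j q) \<longlongrightarrow> ?l j) (at_right 0)"
        by (rule tendsto_mult[OF tendsto_mult[OF growth wj] qj])
    qed
    moreover have "(\<Sum>j\<le>J. ?l j) = (\<Sum>j\<in>{J}. ?l j)"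
    proof (rule sum.mono_neutral_right)
      show "\<forall>j\<in>{..J} - {J}. ?l j = 0"
      proof
        fix j assume "j \<in> {..J} - {J}"
        then have "e j > 0" by (intro epos) simp
        then show "?l j = 0" by simp
      qed
    qed simp_all
    moreover have "(\<Sum>j\<in>{J}. ?l j) \<noteq> 0"
      using \<open>c \<noteq> 0\<close> \<open>c' \<noteq> 0\<close> \<open>r J \<noteq> 0\<close> by (simp add: e_def)
    ultimately have "\<forall>\<^sub>F q in at_right 0. (\<Sum>j\<le>J. ?g j q) \<noteq> 0"
      using tendsto_imp_eventually_ne[of "\<lambda>q. \<Sum>j\<le>J. ?g j q" "\<Sum>j\<le>J. ?l j" "at_right 0" 0] by simp
    then have "\<forall>\<^sub>F q in at_right 0. ?f q \<noteq> 0" unfolding fg .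
    then show ?thesis by eventually_elim (metis mult_eq_0_iff)
  qed
  then have "\<forall>u w c c'. ((\<lambda>q. u q * of_real q) \<longlongrightarrow> c) (at_right 0) \<longrightarrow>
      ((\<lambda>q. w q * of_real (q ^ K)) \<longlongrightarrow> c') (at_right 0) \<longrightarrow> c \<noteq> 0 \<longrightarrow> c' \<noteq> (0::complex) \<longrightarrow>
      (\<forall>\<^sub>F q in at_right 0. poly (map_poly (\<lambda>S. poly (map_poly of_rat S) (u q)) R) (w q) \<noteq> 0)"
    by (intro allI impI)
  moreover have "K \<ge> 1" by (simp add: K_def)
  ultimately show ?thesis by (intro exI[of _ K] conjI)
qed

text \<open>The limit of \<open>theta2_fun 1 1\<close> is the sum of the phases at the four sign
  pairs, \<open>4 * cos (pi * v)\<close>; for the characteristics \<open>(0, 1)\<close>,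
  \<open>(1, 0)\<close>, \<open>(0, 0)\<close> the limits are 2, 2 and 1.\<close>

lemma cusp_limits:
  assumes c: "8 dvd c + 1" and K: "K \<ge> 1" and v: "cos (pi * v) \<noteq> 0"
  defines "\<Omega> \<equiv> \<lambda>q. cusp_pt c v q (q ^ K)"
  shows "\<forall>\<^sub>F q in at_right 0. 0 < q \<and> q \<le> 1 / 2 \<and> 0 < q ^ K \<and> q ^ K \<le> 1 / 2 \<and> theta2_fun 1 1 v q (q ^ K) \<noteq> 0"
    "((\<lambda>q. bprime 1 (\<Omega> q) * of_real q) \<longlongrightarrow> 1 / (2 * of_real (cos (pi * v)))) (at_right 0)"
    "((\<lambda>q. bprime 2 (\<Omega> q) * of_real (q ^ K)) \<longlongrightarrow> 1 / (2 * of_real (cos (pi * v)))) (at_right 0)"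
    "((\<lambda>q. bprime 3 (\<Omega> q) * of_real (q * q ^ K)) \<longlongrightarrow> 1 / (4 * of_real (cos (pi * v)))) (at_right 0)"
proof -
  have F11: "((\<lambda>q. theta2_fun 1 1 v q (q ^ K)) \<longlongrightarrow> 4 * of_real (cos (pi * v))) (at_right 0)"
  proof -
    have "(\<Sum>m\<in>{0, - 1}. \<Sum>n\<in>{0, - 1}. cis (pi * v * of_int ((1 + 2 * m) * (1 + 2 * n)))) = 4 * of_real (cos (pi * v))"
      by (simp add: complex_eq_iff)
    then show ?thesis using theta2_fun_tendsto[of 1 1 K v] K by simp
  qed
  have F01: "((\<lambda>q. theta2_fun 0 1 v q (q ^ K)) \<longlongrightarrow> 2) (at_right 0)"
    using theta2_fun_tendsto[of 0 1 K v] K by simp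
  have F10: "((\<lambda>q. theta2_fun 1 0 v q (q ^ K)) \<longlongrightarrow> 2) (at_right 0)"
    using theta2_fun_tendsto[of 1 0 K v] K by simp
  have F00: "((\<lambda>q. theta2_fun 0 0 v q (q ^ K)) \<longlongrightarrow> 1) (at_right 0)"
    using theta2_fun_tendsto[of 0 0 K v] K by simp
  have nz: "4 * of_real (cos (pi * v)) \<noteq> (0 :: complex)" using v by simp
  have "\<forall>\<^sub>F q in at_right (0::real). q < 1 / 2" "\<forall>\<^sub>F q in at_right (0::real). 0 < q"
    using eventually_at_right_less[of 0] by (auto simp: eventually_at_right_field intro: exI[of _ "1/2"])
  moreover have "\<forall>\<^sub>F q in at_right 0. theta2_fun 1 1 v q (q ^ K) \<noteq> 0"
    by (rule tendsto_imp_eventually_ne[OF F11 nz])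
  ultimately have good: "\<forall>\<^sub>F q in at_right 0. 0 < q \<and> q \<le> 1 / 2 \<and> 0 < q ^ K \<and> q ^ K \<le> 1 / 2 \<and> theta2_fun 1 1 v q (q ^ K) \<noteq> 0"
  proof eventually_elim
    case (elim q)
    then have "q ^ K \<le> q ^ 1" using K by (intro power_decreasing) auto
    then show ?case using elim by simp
  qed
  note b = bprime_cusp_pt[OF c]
  show "\<forall>\<^sub>F q in at_right 0. 0 < q \<and> q \<le> 1 / 2 \<and> 0 < q ^ K \<and> q ^ K \<le> 1 / 2 \<and> theta2_fun 1 1 v q (q ^ K) \<noteq> 0"
    by (rule good)
  have "\<forall>\<^sub>F q in at_right 0. theta2_fun 0 1 v q (q ^ K) / theta2_fun 1 1 v q (q ^ K) = bprime 1 (\<Omega> q) * of_real q"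
    using good by eventually_elim (unfold \<Omega>_def, rule b(2)[symmetric], auto)
  from Lim_transform_eventually[OF tendsto_divide[OF F01 F11 nz] this]
  show "((\<lambda>q. bprime 1 (\<Omega> q) * of_real q) \<longlongrightarrow> 1 / (2 * of_real (cos (pi * v)))) (at_right 0)" by simp
  have "\<forall>\<^sub>F q in at_right 0. theta2_fun 1 0 v q (q ^ K) / theta2_fun 1 1 v q (q ^ K) = bprime 2 (\<Omega> q) * of_real (q ^ K)"
    using good by eventually_elim (unfold \<Omega>_def, rule b(3)[symmetric], auto)
  from Lim_transform_eventually[OF tendsto_divide[OF F10 F11 nz] this]
  show "((\<lambda>q. bprime 2 (\<Omega> q) * of_real (q ^ K)) \<longlongrightarrow> 1 / (2 * of_real (cos (pi * v)))) (at_right 0)" by simp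
  have "\<forall>\<^sub>F q in at_right 0. theta2_fun 0 0 v q (q ^ K) / theta2_fun 1 1 v q (q ^ K) = bprime 3 (\<Omega> q) * of_real (q * q ^ K)"
    using good by eventually_elim (unfold \<Omega>_def, rule b(4)[symmetric], auto)
  from Lim_transform_eventually[OF tendsto_divide[OF F00 F11 nz] this]
  show "((\<lambda>q. bprime 3 (\<Omega> q) * of_real (q * q ^ K)) \<longlongrightarrow> 1 / (4 * of_real (cos (pi * v)))) (at_right 0)" by simp
qed

lemma eval3_const_poly: "eval3 h [:R:] v = poly (map_poly (\<lambda>S. poly (map_poly h S) (v 1)) R) (v 2)"
  by (simp add: eval3_def map_poly_pCons)

text \<open>For fixed \<open>v\<close> there are two free parameters, just enough for the
  independence of two of the functions. It is applied at \<open>v = 0\<close> and at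
  \<open>v = 1 / (2 * p)\<close>.\<close>

lemma cusp_family_independent:
  assumes c: "8 dvd c + 1" and v: "cos (pi * v) \<noteq> 0" and R: "R \<noteq> 0"
  obtains q r where "0 < q" "q \<le> 1 / 2" "0 < r" "r \<le> 1 / 2" "theta2_fun 1 1 v q r \<noteq> 0"
    "eval3 of_rat [:R:] (\<lambda>i. bprime i (cusp_pt c v q r)) \<noteq> 0"
proof -
  obtain K where K: "K \<ge> 1" and ind: "\<forall>u w c c'. ((\<lambda>q. u q * of_real q) \<longlongrightarrow> c) (at_right 0) \<longrightarrow>
      ((\<lambda>q. w q * of_real (q ^ K)) \<longlongrightarrow> c') (at_right 0) \<longrightarrow> c \<noteq> 0 \<longrightarrow> c' \<noteq> (0::complex) \<longrightarrow>
      (\<forall>\<^sub>F q in at_right 0. poly (map_poly (\<lambda>S. poly (map_poly of_rat S) (u q)) R) (w q) \<noteq> 0)"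
    using bivariate_nonvanishing[OF R] by blast
  note lim = cusp_limits[OF c K v]
  have "\<forall>\<^sub>F q in at_right 0. poly (map_poly (\<lambda>S. poly (map_poly of_rat S) (bprime 1 (cusp_pt c v q (q ^ K)))) R)
      (bprime 2 (cusp_pt c v q (q ^ K))) \<noteq> 0"
    by (rule ind[rule_format, OF lim(2,3)]) (use v in simp_all)
  with lim(1) have "\<forall>\<^sub>F q in at_right 0. (0 < q \<and> q \<le> 1 / 2 \<and> 0 < q ^ K \<and> q ^ K \<le> 1 / 2 \<and> theta2_fun 1 1 v q (q ^ K) \<noteq> 0) \<and>
      eval3 of_rat [:R:] (\<lambda>i. bprime i (cusp_pt c v q (q ^ K))) \<noteq> 0"
    unfolding eval3_const_poly by (rule eventually_conj)
  then obtain q :: real where "(0 < q \<and> q \<le> 1 / 2 \<and> 0 < q ^ K \<and> q ^ K \<le> 1 / 2 \<and> theta2_fun 1 1 v q (q ^ K) \<noteq> 0) \<and>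
      eval3 of_rat [:R:] (\<lambda>i. bprime i (cusp_pt c v q (q ^ K))) \<noteq> 0"
    using eventually_happens'[OF trivial_limit_at_right_real] by blast
  then show ?thesis by (intro that[of q "q ^ K"]) auto
qed

lemma bprime_dom_nonempty: "\<exists>\<Omega>. \<Omega> \<in> bprime_dom"
proof -
  have c: "(8 :: int) dvd - 1 + 1" by simp
  obtain q r where "0 < q" "q \<le> 1 / 2" "0 < r" "r \<le> 1 / 2" "theta2_fun 1 1 0 q r \<noteq> 0"
    by (rule cusp_family_independent[OF c, of 0 1]) (simp, simp, blast)
  then show ?thesis using bprime_cusp_pt(1)[OF c] by blast
qed

lemma bprime_product_on_diagonal:
  assumes c: "8 dvd c + 1" and qr: "0 < q" "q \<le> 1 / 2" "0 < r" "r \<le> 1 / 2" "theta2_fun 1 1 0 q r \<noteq> 0"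
  shows "bprime 3 (cusp_pt c 0 q r) = bprime 1 (cusp_pt c 0 q r) * bprime 2 (cusp_pt c 0 q r)"
proof -
  let ?b = "\<lambda>i. bprime i (cusp_pt c 0 q r)"
  note b = bprime_cusp_pt[OF c qr]
  have "(?b 1 * of_real q) * (?b 2 * of_real r) = ?b 3 * of_real (q * r)"
    unfolding b(2-4) using theta2_fun_product[of q r] qr
    by (simp add: field_simps)
  then show ?thesis using qr by simp
qed

section \<open>Algebraic independence\<close>

definition siegel_line :: "cmat2 \<Rightarrow> cmat2 \<Rightarrow> complex \<Rightarrow> cmat2" where
  "siegel_line \<Omega>\<^sub>1 \<Omega>\<^sub>2 t = (\<chi> i j. \<Omega>\<^sub>1 $ i $ j + t * (\<Omega>\<^sub>2 $ i $ j - \<Omega>\<^sub>1 $ i $ j))"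

text \<open>Holomorphy is required along complex lines joining two points; their traces in the
  half-space are open and convex, as the identity theorem needs.\<close>

definition siegel_hol :: "(cmat2 \<Rightarrow> complex) \<Rightarrow> bool" where
  "siegel_hol f \<longleftrightarrow> (\<forall>\<Omega>\<^sub>1\<in>siegel_H2. \<forall>\<Omega>\<^sub>2\<in>siegel_H2. (\<lambda>t. f (siegel_line \<Omega>\<^sub>1 \<Omega>\<^sub>2 t)) holomorphic_on {t. siegel_line \<Omega>\<^sub>1 \<Omega>\<^sub>2 t \<in> siegel_H2})"

lemma siegel_H2_iff_form:
  fixes \<tau> :: cmat2
  shows "\<tau> \<in> siegel_H2 \<longleftrightarrow> \<tau> $ 1 $ 2 = \<tau> $ 2 $ 1 \<and> (\<forall>x::real ^ 2. x \<noteq> 0 \<longrightarrow>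
    Im (\<tau> $ 1 $ 1) * (x $ 1)\<^sup>2 + 2 * Im (\<tau> $ 1 $ 2) * (x $ 1 * x $ 2) + Im (\<tau> $ 2 $ 2) * (x $ 2)\<^sup>2 > 0)"
proof -
  have sym: "transpose \<tau> = \<tau> \<longleftrightarrow> \<tau> $ 1 $ 2 = \<tau> $ 2 $ 1"
    by (auto simp: transpose_def vec_eq_iff forall_2)
  show ?thesis
    unfolding siegel_H2_def mem_Collect_eq sym
    by (auto simp: inner_vec_def matrix_vector_mult_def sum_2 map_matrix_def power2_eq_square algebra_simps)
qed

lemma open_siegel_line: "\<Omega>\<^sub>1 \<in> siegel_H2 \<Longrightarrow> \<Omega>\<^sub>2 \<in> siegel_H2 \<Longrightarrow> open {t. siegel_line \<Omega>\<^sub>1 \<Omega>\<^sub>2 t \<in> siegel_H2}"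
  unfolding siegel_H2_iff siegel_line_def vec_lambda_beta
  by (intro open_Collect_conj open_Collect_less continuous_intros) auto

lemma convex_siegel_line: "convex {t. siegel_line \<Omega>\<^sub>1 \<Omega>\<^sub>2 t \<in> siegel_H2}"
proof (rule convexI)
  fix s t u v
  assume s: "s \<in> {t. siegel_line \<Omega>\<^sub>1 \<Omega>\<^sub>2 t \<in> siegel_H2}" and t: "t \<in> {t. siegel_line \<Omega>\<^sub>1 \<Omega>\<^sub>2 t \<in> siegel_H2}"
    and uv: "0 \<le> u" "0 \<le> v" "u + v = (1 :: real)"
  let ?L = "siegel_line \<Omega>\<^sub>1 \<Omega>\<^sub>2"
  have comb: "?L (u *\<^sub>R s + v *\<^sub>R t) $ i $ j = of_real u * ?L s $ i $ j + of_real v * ?L t $ i $ j" for i j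
  proof -
    have "of_real u + of_real v = (1 :: complex)" using uv(3) by (metis of_real_1 of_real_add)
    then have "\<Omega>\<^sub>1 $ i $ j = of_real u * \<Omega>\<^sub>1 $ i $ j + of_real v * \<Omega>\<^sub>1 $ i $ j"
      by (metis distrib_right mult_1)
    then show ?thesis
      by (simp add: siegel_line_def scaleR_conv_of_real algebra_simps)
  qed
  define Q where "Q X x = Im (X $ 1 $ 1) * (x $ 1)\<^sup>2 + 2 * Im (X $ 1 $ 2) * (x $ 1 * x $ 2) + Im (X $ 2 $ 2) * (x $ 2)\<^sup>2"
    for X :: cmat2 and x :: "real ^ 2"
  have "Q (?L (u *\<^sub>R s + v *\<^sub>R t)) x > 0" if "x \<noteq> 0" for x
  proof -
    have "Q (?L (u *\<^sub>R s + v *\<^sub>R t)) x = u * Q (?L s) x + v * Q (?L t) x"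
      unfolding Q_def comb by (simp add: algebra_simps)
    moreover have "Q (?L s) x > 0" "Q (?L t) x > 0"
      using s t that unfolding siegel_H2_iff_form mem_Collect_eq Q_def by blast+
    moreover have "u > 0 \<or> v > 0" using uv by linarith
    ultimately show ?thesis
      using uv by (auto intro: add_pos_nonneg add_nonneg_pos)
  qed
  moreover have "?L (u *\<^sub>R s + v *\<^sub>R t) $ 1 $ 2 = ?L (u *\<^sub>R s + v *\<^sub>R t) $ 2 $ 1"
    using s t unfolding comb siegel_H2_iff_form mem_Collect_eq by simp
  ultimately show "u *\<^sub>R s + v *\<^sub>R t \<in> {t. siegel_line \<Omega>\<^sub>1 \<Omega>\<^sub>2 t \<in> siegel_H2}"
    unfolding siegel_H2_iff_form Q_def by simp
qed

lemma siegel_line_endpoints: "siegel_line \<Omega>\<^sub>1 \<Omega>\<^sub>2 0 = \<Omega>\<^sub>1" "siegel_line \<Omega>\<^sub>1 \<Omega>\<^sub>2 1 = \<Omega>\<^sub>2"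
  by (simp_all add: siegel_line_def vec_eq_iff)

text \<open>Restriction to a complex line reduces this to the identity theorem in one variable.\<close>

lemma siegel_hol_mult_nonzero:
  assumes f: "siegel_hol f" and g: "siegel_hol g"
    and f1: "\<Omega>\<^sub>1 \<in> siegel_H2" "f \<Omega>\<^sub>1 \<noteq> 0" and g2: "\<Omega>\<^sub>2 \<in> siegel_H2" "g \<Omega>\<^sub>2 \<noteq> 0"
  shows "\<exists>\<Omega>\<in>siegel_H2. f \<Omega> * g \<Omega> \<noteq> 0"
proof (rule ccontr)
  assume "\<not> (\<exists>\<Omega>\<in>siegel_H2. f \<Omega> * g \<Omega> \<noteq> 0)"
  then have zero: "f \<Omega> = 0 \<or> g \<Omega> = 0" if "\<Omega> \<in> siegel_H2" for \<Omega> using that by auto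
  let ?L = "siegel_line \<Omega>\<^sub>1 \<Omega>\<^sub>2"
  define S where "S = {t. ?L t \<in> siegel_H2}"
  have S: "open S" "connected S" "0 \<in> S" "1 \<in> S"
    using open_siegel_line[OF f1(1) g2(1)] convex_connected[OF convex_siegel_line] f1(1) g2(1)
    by (simp_all add: S_def siegel_line_endpoints)
  have hf: "(\<lambda>t. f (?L t)) holomorphic_on S" and hg: "(\<lambda>t. g (?L t)) holomorphic_on S"
    using f g f1(1) g2(1) unfolding siegel_hol_def S_def by blast+
  have "continuous_on S (\<lambda>t. f (?L t))" by (rule holomorphic_on_imp_continuous_on[OF hf])
  then obtain e where e: "e > 0" "\<forall>t. t \<in> S \<longrightarrow> dist 0 t < e \<longrightarrow> f (?L t) \<noteq> 0"
    using continuous_on_avoid[of S "\<lambda>t. f (?L t)" 0 0] S(3) f1(2) by (auto simp: siegel_line_endpoints)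
  define U where "U = S \<inter> ball 0 e"
  have U: "open U" "0 \<in> U" "U \<subseteq> S" using S e by (auto simp: U_def)
  have gU: "g (?L t) = 0" if "t \<in> U" for t
    using that e(2) zero[of "?L t"] by (auto simp: U_def S_def)
  have "g (?L 1) = 0"
    by (rule analytic_continuation_open[OF U(1) S(1) _ S(2) U(3) hg _ _ S(4), of "\<lambda>_. 0"])
      (use U gU in auto)
  then show False using g2(2) by (simp add: siegel_line_endpoints)
qed

lemma siegel_hol_const: "siegel_hol (\<lambda>_. c)"
  by (simp add: siegel_hol_def)

lemma siegel_hol_add: "siegel_hol f \<Longrightarrow> siegel_hol g \<Longrightarrow> siegel_hol (\<lambda>\<Omega>. f \<Omega> + g \<Omega>)"
  by (auto simp: siegel_hol_def intro!: holomorphic_intros)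

lemma siegel_hol_mult: "siegel_hol f \<Longrightarrow> siegel_hol g \<Longrightarrow> siegel_hol (\<lambda>\<Omega>. f \<Omega> * g \<Omega>)"
  by (auto simp: siegel_hol_def intro!: holomorphic_intros)

lemma siegel_hol_power: "siegel_hol f \<Longrightarrow> siegel_hol (\<lambda>\<Omega>. f \<Omega> ^ n)"
  by (auto simp: siegel_hol_def intro!: holomorphic_intros)

text \<open>The product is carried along in the induction together with its holomorphy, so that
  functions nonzero at different points acquire a common point.\<close>

lemma siegel_hol_prod_nonzero:
  assumes "finite A" "\<And>a. a \<in> A \<Longrightarrow> siegel_hol (f a)" "\<And>a. a \<in> A \<Longrightarrow> \<exists>\<Omega>\<in>siegel_H2. f a \<Omega> \<noteq> 0"
  shows "\<exists>\<Omega>\<in>siegel_H2. \<forall>a\<in>A. f a \<Omega> \<noteq> 0"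
proof -
  have "siegel_hol (\<lambda>\<Omega>. \<Prod>a\<in>A. f a \<Omega>) \<and> (\<exists>\<Omega>\<in>siegel_H2. (\<Prod>a\<in>A. f a \<Omega>) \<noteq> 0)"
    using assms
  proof (induction A)
    case empty
    show ?case using bprime_dom_nonempty by (auto simp: siegel_hol_const bprime_dom_def)
  next
    case (insert a A)
    then have IH: "siegel_hol (\<lambda>\<Omega>. \<Prod>a\<in>A. f a \<Omega>)" "\<exists>\<Omega>\<in>siegel_H2. (\<Prod>a\<in>A. f a \<Omega>) \<noteq> 0" and "siegel_hol (f a)"
      by blast+
    moreover obtain \<Omega>\<^sub>1 where "\<Omega>\<^sub>1 \<in> siegel_H2" "f a \<Omega>\<^sub>1 \<noteq> 0" using insert.prems(2) by blast
    ultimately show ?case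
      using siegel_hol_mult[of "f a" "\<lambda>\<Omega>. \<Prod>a\<in>A. f a \<Omega>"]
        siegel_hol_mult_nonzero[of "f a" "\<lambda>\<Omega>. \<Prod>a\<in>A. f a \<Omega>"] insert.hyps
      by simp blast
  qed
  then show ?thesis using assms(1) by (simp add: prod_zero_iff)
qed

lemma matrix_inv_2x2:
  fixes Q :: cmat2
  assumes "invertible Q"
  defines "d \<equiv> Q $ 1 $ 1 * Q $ 2 $ 2 - Q $ 1 $ 2 * Q $ 2 $ 1"
  shows "d \<noteq> 0" "matrix_inv Q $ 1 $ 1 = Q $ 2 $ 2 / d" "matrix_inv Q $ 1 $ 2 = - Q $ 1 $ 2 / d"
    "matrix_inv Q $ 2 $ 1 = - Q $ 2 $ 1 / d" "matrix_inv Q $ 2 $ 2 = Q $ 1 $ 1 / d"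
proof -
  define X where "X = matrix_inv Q"
  have "Q ** X = mat 1" unfolding X_def by (rule matrix_inv_mult[OF assms(1)])
  then have H: "(Q ** X) $ i $ j = (mat 1 :: cmat2) $ i $ j" for i j by simp
  then have e: "Q $ 1 $ 1 * X $ 1 $ 1 + Q $ 1 $ 2 * X $ 2 $ 1 = 1" "Q $ 1 $ 1 * X $ 1 $ 2 + Q $ 1 $ 2 * X $ 2 $ 2 = 0"
    "Q $ 2 $ 1 * X $ 1 $ 1 + Q $ 2 $ 2 * X $ 2 $ 1 = 0" "Q $ 2 $ 1 * X $ 1 $ 2 + Q $ 2 $ 2 * X $ 2 $ 2 = 1"
    using H[of 1 1] H[of 1 2] H[of 2 1] H[of 2 2] by (simp_all add: matrix_matrix_mult_def sum_2 mat_def)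
  have c: "d * X $ 1 $ 1 = Q $ 2 $ 2" "d * X $ 1 $ 2 = - Q $ 1 $ 2" "d * X $ 2 $ 1 = - Q $ 2 $ 1" "d * X $ 2 $ 2 = Q $ 1 $ 1"
    unfolding d_def using e by algebra+
  show "d \<noteq> 0"
  proof
    assume "d = 0"
    then have "Q $ 1 $ 1 = 0" "Q $ 1 $ 2 = 0" using c by auto
    then show False using e(1) by simp
  qed
  then show "matrix_inv Q $ 1 $ 1 = Q $ 2 $ 2 / d" "matrix_inv Q $ 1 $ 2 = - Q $ 1 $ 2 / d"
    "matrix_inv Q $ 2 $ 1 = - Q $ 2 $ 1 / d" "matrix_inv Q $ 2 $ 2 = Q $ 1 $ 1 / d"
    using c unfolding X_def[symmetric] by (simp_all add: field_simps)
qed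

lemma holomorphic_siegel_act:
  assumes \<gamma>: "\<gamma> \<in> Gamma2" and \<tau>: "\<And>k l. (\<lambda>t. \<tau> t $ k $ l) holomorphic_on S" and H2: "\<And>t. t \<in> S \<Longrightarrow> \<tau> t \<in> siegel_H2"
  shows "(\<lambda>t. siegel_act \<gamma> (\<tau> t) $ k $ l) holomorphic_on S"
proof -
  define Q where "Q t = siegel_Q \<gamma> (\<tau> t)" for t
  define d where "d t = Q t $ 1 $ 1 * Q t $ 2 $ 2 - Q t $ 1 $ 2 * Q t $ 2 $ 1" for t
  have P: "(\<lambda>t. siegel_P \<gamma> (\<tau> t) $ k $ l) holomorphic_on S" for k l
    unfolding siegel_P_def matrix_matrix_mult_def sum_2 vector_add_component vec_lambda_beta
    by (intro holomorphic_intros \<tau>)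
  have Q: "(\<lambda>t. Q t $ k $ l) holomorphic_on S" for k l
    unfolding Q_def siegel_Q_def matrix_matrix_mult_def sum_2 vector_add_component vec_lambda_beta
    by (intro holomorphic_intros \<tau>)
  have inv: "invertible (Q t)" if "t \<in> S" for t
    unfolding Q_def by (rule invertible_siegel_Q[OF \<gamma> H2[OF that]])
  have d: "d t \<noteq> 0" if "t \<in> S" for t unfolding d_def by (rule matrix_inv_2x2(1)[OF inv[OF that]])
  have hd: "d holomorphic_on S" unfolding d_def by (intro holomorphic_intros Q)
  have adj: "(\<lambda>t. matrix_inv (Q t) $ i $ j) holomorphic_on S" for i j
  proof -
    have "(\<lambda>t. Q t $ 2 $ 2 / d t) holomorphic_on S" "(\<lambda>t. - Q t $ 1 $ 2 / d t) holomorphic_on S"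
      "(\<lambda>t. - Q t $ 2 $ 1 / d t) holomorphic_on S" "(\<lambda>t. Q t $ 1 $ 1 / d t) holomorphic_on S"
      by (intro holomorphic_intros Q hd d; assumption)+
    then have "(\<lambda>t. matrix_inv (Q t) $ 1 $ 1) holomorphic_on S" "(\<lambda>t. matrix_inv (Q t) $ 1 $ 2) holomorphic_on S"
      "(\<lambda>t. matrix_inv (Q t) $ 2 $ 1) holomorphic_on S" "(\<lambda>t. matrix_inv (Q t) $ 2 $ 2) holomorphic_on S"
      using matrix_inv_2x2(2-5)[OF inv] unfolding d_def by (auto cong: holomorphic_cong)
    then show ?thesis using exhaust_2[of i] exhaust_2[of j] by auto
  qed
  show ?thesis
    unfolding siegel_act_PQ Q_def[symmetric] matrix_matrix_mult_def sum_2 vec_lambda_beta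
    by (intro holomorphic_intros P adj)
qed

lemma siegel_hol_theta_act:
  assumes \<gamma>: "\<gamma> \<in> Gamma2" and "c > 0"
  shows "siegel_hol (\<lambda>\<Omega>. theta i (c *\<^sub>R siegel_act \<gamma> \<Omega>))"
  unfolding siegel_hol_def theta_eq_riemann_theta
proof (intro ballI holomorphic_riemann_theta)
  fix \<Omega>\<^sub>1 \<Omega>\<^sub>2 assume "\<Omega>\<^sub>1 \<in> siegel_H2" "\<Omega>\<^sub>2 \<in> siegel_H2"
  then show "open {t. siegel_line \<Omega>\<^sub>1 \<Omega>\<^sub>2 t \<in> siegel_H2}" by (rule open_siegel_line)
  have act: "(\<lambda>t. siegel_act \<gamma> (siegel_line \<Omega>\<^sub>1 \<Omega>\<^sub>2 t) $ k $ l) holomorphic_on {t. siegel_line \<Omega>\<^sub>1 \<Omega>\<^sub>2 t \<in> siegel_H2}" for k l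
    by (rule holomorphic_siegel_act[OF \<gamma>]) (auto simp: siegel_line_def intro!: holomorphic_intros)
  show "(\<lambda>t. (c *\<^sub>R siegel_act \<gamma> (siegel_line \<Omega>\<^sub>1 \<Omega>\<^sub>2 t)) $ k $ l) holomorphic_on {t. siegel_line \<Omega>\<^sub>1 \<Omega>\<^sub>2 t \<in> siegel_H2}" for k l
    unfolding vector_scaleR_component unfolding scaleR_conv_of_real by (intro holomorphic_intros act)
qed (use siegel_act_H2[OF \<gamma>] siegel_H2_scaleR \<open>c > 0\<close> in auto)

lemma siegel_hol_theta:
  assumes "c > 0"
  shows "siegel_hol (\<lambda>\<Omega>. theta i (c *\<^sub>R \<Omega>))"
  unfolding siegel_hol_def theta_eq_riemann_theta
proof (intro ballI holomorphic_riemann_theta)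
  fix \<Omega>\<^sub>1 \<Omega>\<^sub>2 assume "\<Omega>\<^sub>1 \<in> siegel_H2" "\<Omega>\<^sub>2 \<in> siegel_H2"
  then show "open {t. siegel_line \<Omega>\<^sub>1 \<Omega>\<^sub>2 t \<in> siegel_H2}" by (rule open_siegel_line)
  show "(\<lambda>t. (c *\<^sub>R siegel_line \<Omega>\<^sub>1 \<Omega>\<^sub>2 t) $ k $ l) holomorphic_on {t. siegel_line \<Omega>\<^sub>1 \<Omega>\<^sub>2 t \<in> siegel_H2}" for k l
    unfolding vector_scaleR_component unfolding scaleR_conv_of_real siegel_line_def vec_lambda_beta by (intro holomorphic_intros)
qed (use siegel_H2_scaleR \<open>c > 0\<close> in auto)

text \<open>Poles are confined to the complement of \<open>bprime_dom\<close> and are cleared by a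
  power of one fixed theta constant, which covers all polynomials in the \<open>b'\<close>.\<close>

definition siegel_mero :: "(cmat2 \<Rightarrow> complex) \<Rightarrow> bool" where
  "siegel_mero f \<longleftrightarrow> (\<exists>d h. siegel_hol h \<and> (\<forall>\<Omega>\<in>bprime_dom. f \<Omega> * theta 0 ((1 / 2) *\<^sub>R \<Omega>) ^ d = h \<Omega>))"

lemma siegel_mero_hol: "siegel_hol h \<Longrightarrow> siegel_mero h"
  unfolding siegel_mero_def by (intro exI[of _ 0] exI[of _ h]) simp

lemma siegel_mero_mult:
  assumes "siegel_mero f" "siegel_mero g"
  shows "siegel_mero (\<lambda>\<Omega>. f \<Omega> * g \<Omega>)"
proof -
  let ?t = "\<lambda>\<Omega>. theta 0 ((1 / 2) *\<^sub>R \<Omega>)"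
  obtain d h e k where h: "siegel_hol h" "\<forall>\<Omega>\<in>bprime_dom. f \<Omega> * ?t \<Omega> ^ d = h \<Omega>"
    and k: "siegel_hol k" "\<forall>\<Omega>\<in>bprime_dom. g \<Omega> * ?t \<Omega> ^ e = k \<Omega>"
    using assms unfolding siegel_mero_def by blast
  have "(f \<Omega> * g \<Omega>) * ?t \<Omega> ^ (d + e) = h \<Omega> * k \<Omega>" if "\<Omega> \<in> bprime_dom" for \<Omega>
    unfolding h(2)[rule_format, OF that, symmetric] k(2)[rule_format, OF that, symmetric] power_add by (simp only: mult_ac)
  then show ?thesis using siegel_hol_mult[OF h(1) k(1)] unfolding siegel_mero_def by blast
qed

lemma siegel_mero_add:
  assumes "siegel_mero f" "siegel_mero g"
  shows "siegel_mero (\<lambda>\<Omega>. f \<Omega> + g \<Omega>)"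
proof -
  let ?t = "\<lambda>\<Omega>. theta 0 ((1 / 2) *\<^sub>R \<Omega>)"
  obtain d h e k where h: "siegel_hol h" "\<forall>\<Omega>\<in>bprime_dom. f \<Omega> * ?t \<Omega> ^ d = h \<Omega>"
    and k: "siegel_hol k" "\<forall>\<Omega>\<in>bprime_dom. g \<Omega> * ?t \<Omega> ^ e = k \<Omega>"
    using assms unfolding siegel_mero_def by blast
  have "siegel_hol (\<lambda>\<Omega>. h \<Omega> * ?t \<Omega> ^ e + k \<Omega> * ?t \<Omega> ^ d)"
    by (intro siegel_hol_add siegel_hol_mult siegel_hol_power siegel_hol_theta h k) simp_all
  moreover have "(f \<Omega> + g \<Omega>) * ?t \<Omega> ^ (d + e) = h \<Omega> * ?t \<Omega> ^ e + k \<Omega> * ?t \<Omega> ^ d" if "\<Omega> \<in> bprime_dom" for \<Omega>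
    unfolding h(2)[rule_format, OF that, symmetric] k(2)[rule_format, OF that, symmetric] power_add
    by (simp only: distrib_right mult_ac)
  ultimately show ?thesis unfolding siegel_mero_def by blast
qed

lemma siegel_mero_bprime: "siegel_mero (bprime i)"
  unfolding siegel_mero_def
  by (intro exI[of _ 1] exI[of _ "\<lambda>\<Omega>. theta i ((1 / 2) *\<^sub>R \<Omega>)"])
    (auto simp: bprime_def bprime_dom_def intro!: siegel_hol_theta)

lemma siegel_mero_poly:
  assumes "\<And>a. siegel_mero (h a)" "\<And>\<Omega>. h 0 \<Omega> = 0" "siegel_mero x"
  shows "siegel_mero (\<lambda>\<Omega>. poly (map_poly (\<lambda>a. h a \<Omega>) p) (x \<Omega>))"
proof (induction p)
  case 0
  show ?case by (simp add: siegel_mero_hol siegel_hol_const)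
next
  case (pCons a p)
  then show ?case
    using siegel_mero_add[OF assms(1)[of a] siegel_mero_mult[OF assms(3) pCons.IH]]
    by (simp add: map_poly_pCons assms(2))
qed

lemma siegel_mero_eval3: "siegel_mero (\<lambda>\<Omega>. eval3 of_rat P (\<lambda>i. bprime i \<Omega>))"
  unfolding eval3_def
  by (intro siegel_mero_poly siegel_mero_bprime siegel_mero_hol siegel_hol_const) simp_all

text \<open>One point that avoids all poles and all zeros of the given polynomials; there every
  domain condition of \<open>represents\<close> can be met at once.\<close>

lemma generic_point:
  assumes "finite G" "G \<subseteq> Gamma2" "p > 0" "finite PS"
    and PS: "\<And>P. P \<in> PS \<Longrightarrow> \<exists>\<Omega>\<in>bprime_dom. eval3 of_rat P (\<lambda>i. bprime i \<Omega>) \<noteq> 0"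
  obtains \<Omega> where "\<Omega> \<in> bprime_dom" "\<And>\<gamma>. \<gamma> \<in> G \<Longrightarrow> p *\<^sub>R siegel_act \<gamma> \<Omega> \<in> bprime_dom"
    "\<And>P. P \<in> PS \<Longrightarrow> eval3 of_rat P (\<lambda>i. bprime i \<Omega>) \<noteq> 0"
proof -
  let ?t = "\<lambda>\<Omega>. theta 0 ((1 / 2) *\<^sub>R \<Omega>)"
  have "\<exists>h. siegel_hol h \<and> (\<exists>d. \<forall>\<Omega>\<in>bprime_dom. eval3 of_rat P (\<lambda>i. bprime i \<Omega>) * ?t \<Omega> ^ d = h \<Omega>)" for P
    using siegel_mero_eval3[of P] unfolding siegel_mero_def by blast
  then obtain h where h: "\<And>P. siegel_hol (h P)"
    "\<And>P. \<exists>d. \<forall>\<Omega>\<in>bprime_dom. eval3 of_rat P (\<lambda>i. bprime i \<Omega>) * ?t \<Omega> ^ d = h P \<Omega>" by metis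
  define A where "A = {?t} \<union> (\<lambda>\<gamma> \<Omega>. theta 0 ((p / 2) *\<^sub>R siegel_act \<gamma> \<Omega>)) ` G \<union> h ` PS"
  obtain \<Omega>\<^sub>0 where \<Omega>0: "\<Omega>\<^sub>0 \<in> bprime_dom" using bprime_dom_nonempty by blast
  then have \<Omega>0': "\<Omega>\<^sub>0 \<in> siegel_H2" "?t \<Omega>\<^sub>0 \<noteq> 0" by (auto simp: bprime_dom_def)
  have "\<exists>\<Omega>\<in>siegel_H2. \<forall>f\<in>A. f \<Omega> \<noteq> 0"
  proof (rule siegel_hol_prod_nonzero)
    show "finite A" using assms by (simp add: A_def)
    fix f assume "f \<in> A"
    then consider "f = ?t" | \<gamma> where "\<gamma> \<in> G" "f = (\<lambda>\<Omega>. theta 0 ((p / 2) *\<^sub>R siegel_act \<gamma> \<Omega>))" | P where "P \<in> PS" "f = h P"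
      by (auto simp: A_def)
    then have "siegel_hol f \<and> (\<exists>\<Omega>\<in>siegel_H2. f \<Omega> \<noteq> 0)"
    proof cases
      case 1
      then show ?thesis using siegel_hol_theta[of "1 / 2" 0] \<Omega>0' by auto
    next
      case (2 \<gamma>)
      then have \<gamma>: "\<gamma> \<in> Gamma2" using assms(2) by blast
      have q: "(1 / p) *\<^sub>R \<Omega>\<^sub>0 \<in> siegel_H2" using siegel_H2_scaleR[OF \<Omega>0'(1)] \<open>p > 0\<close> by simp
      \<comment> \<open>Chosen so that \<open>p\<close> times its image under
        \<open>\<gamma>\<close> is \<open>\<Omega>\<^sub>0\<close>, where the theta constant does
        not vanish.\<close>
      let ?\<Omega> = "siegel_act (sympl_inv \<gamma>) ((1 / p) *\<^sub>R \<Omega>\<^sub>0)"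
      have "siegel_act \<gamma> ?\<Omega> = (1 / p) *\<^sub>R \<Omega>\<^sub>0"
        by (simp add: siegel_act_mult[symmetric] \<gamma> q sympl_inv_Gamma2 sympl_inv_right siegel_act_one)
      then have "f ?\<Omega> \<noteq> 0" using 2 \<Omega>0' \<open>p > 0\<close> by simp
      moreover have "?\<Omega> \<in> siegel_H2" by (rule siegel_act_H2[OF sympl_inv_Gamma2[OF \<gamma>] q])
      ultimately show ?thesis using 2 siegel_hol_theta_act[OF \<gamma>, of "p / 2" 0] \<open>p > 0\<close> by auto
    next
      case (3 P)
      obtain \<Omega> where "\<Omega> \<in> bprime_dom" "eval3 of_rat P (\<lambda>i. bprime i \<Omega>) \<noteq> 0" using PS 3 by blast
      moreover obtain d where "\<forall>\<Omega>\<in>bprime_dom. eval3 of_rat P (\<lambda>i. bprime i \<Omega>) * ?t \<Omega> ^ d = h P \<Omega>" using h(2) by blast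
      ultimately have "h P \<Omega> \<noteq> 0" "\<Omega> \<in> siegel_H2" by (auto simp: bprime_dom_def)
      then show ?thesis using 3 h(1) by blast
    qed
    then show "siegel_hol f" "\<exists>\<Omega>\<in>siegel_H2. f \<Omega> \<noteq> 0" by blast+
  qed
  then obtain \<Omega> where \<Omega>: "\<Omega> \<in> siegel_H2" and nz: "\<And>f. f \<in> A \<Longrightarrow> f \<Omega> \<noteq> 0" by blast
  have dom: "\<Omega> \<in> bprime_dom" using nz[of ?t] \<Omega> by (simp add: A_def bprime_dom_def)
  show ?thesis
  proof (rule that[OF dom])
    fix \<gamma> assume "\<gamma> \<in> G"
    then have "theta 0 ((p / 2) *\<^sub>R siegel_act \<gamma> \<Omega>) \<noteq> 0" and "\<gamma> \<in> Gamma2"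
      using nz[of "\<lambda>\<Omega>. theta 0 ((p / 2) *\<^sub>R siegel_act \<gamma> \<Omega>)"] assms(2) by (auto simp: A_def)
    then show "p *\<^sub>R siegel_act \<gamma> \<Omega> \<in> bprime_dom"
      using siegel_H2_scaleR[OF siegel_act_H2[OF _ \<Omega>] \<open>p > 0\<close>] by (simp add: bprime_dom_def)
  next
    fix P assume "P \<in> PS"
    then have "h P \<Omega> \<noteq> 0" using nz[of "h P"] by (simp add: A_def)
    then show "eval3 of_rat P (\<lambda>i. bprime i \<Omega>) \<noteq> 0" using h(2)[of P] dom by force
  qed
qed

lemma eval3_subst_product:
  assumes "is_hom h" "v 3 = v 1 * v 2"
  shows "eval3 h P v = eval3 h [:poly P [:0, [:0, 1:]:]:] v"
proof (rule qpoly3_hom_eq[where f = "\<lambda>P. eval3 h P v" and g = "\<lambda>P. eval3 h [:poly P [:0, [:0, 1:]:]:] v"])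
  show "is_hom (\<lambda>P. eval3 h P v)" by (rule is_hom_eval3[OF assms(1)])
  show "is_hom (\<lambda>P. eval3 h [:poly P [:0, [:0, 1:]:]:] v)"
  proof -
    have "is_hom (\<lambda>P. poly P ([:0, [:0, 1:]:] :: rat poly poly))" by (simp add: is_hom_def)
    then show ?thesis by (rule is_hom_comp[OF is_hom_comp[OF is_hom_eval3[OF assms(1)] is_hom_pCons0]])
  qed
  show "eval3 h (qconst c) v = eval3 h [:poly (qconst c) [:0, [:0, 1:]:]:] v" for c
    by (simp add: qconst_def)
  have x3: "eval3 h [:[:0, [:0, 1:]:]:] v = v 1 * v 2"
    by (simp add: eval3_const_poly map_poly_pCons is_hom_simps[OF assms(1)])
  show "eval3 h (qvar i) v = eval3 h [:poly (qvar i) [:0, [:0, 1:]:]:] v" if "i \<in> {1, 2, 3}" for i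
    using that x3 assms(2) eval3_qvar[OF assms(1), of i v] by (auto simp: qvar_def)
qed

text \<open>After normalization \<open>b'\<^sub>3\<close> tends to
  \<open>1 / (4 * cos (pi * v))\<close> and \<open>b'\<^sub>1 b'\<^sub>2\<close> to
  \<open>1 / (4 * (cos (pi * v))\<^sup>2)\<close>. At \<open>v = 1 / 3\<close> these are 1/2 and
  1.\<close>

lemma bprime_product_fails:
  "\<exists>\<Omega>\<in>bprime_dom. bprime 3 \<Omega> \<noteq> bprime 1 \<Omega> * bprime 2 \<Omega>"
proof -
  have c: "(8 :: int) dvd - 1 + 1" by simp
  have cos: "cos (pi * (1 / 3)) = 1 / 2" using cos_60 by simp
  note lim = cusp_limits[OF c, of 1 "1 / 3", unfolded cos]
  let ?\<Omega> = "\<lambda>q. cusp_pt (- 1) (1 / 3) q (q ^ 1)"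
  have "((\<lambda>q. bprime 3 (?\<Omega> q) * of_real (q * q ^ 1) - (bprime 1 (?\<Omega> q) * of_real q) * (bprime 2 (?\<Omega> q) * of_real (q ^ 1)))
      \<longlongrightarrow> 1 / (4 * of_real (1 / 2)) - (1 / (2 * of_real (1 / 2))) * (1 / (2 * of_real (1 / 2)))) (at_right 0)"
    by (intro tendsto_diff tendsto_mult lim) simp_all
  then have "\<forall>\<^sub>F q in at_right 0. bprime 3 (?\<Omega> q) * of_real (q * q ^ 1)
      - (bprime 1 (?\<Omega> q) * of_real q) * (bprime 2 (?\<Omega> q) * of_real (q ^ 1)) \<noteq> 0"
    by (rule tendsto_imp_eventually_ne) simp
  moreover have "\<forall>\<^sub>F q in at_right 0. 0 < q \<and> q \<le> 1 / 2 \<and> 0 < q ^ 1 \<and> q ^ 1 \<le> 1 / 2 \<and> theta2_fun 1 1 (1 / 3) q (q ^ 1) \<noteq> 0"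
    by (rule lim(1)) simp_all
  ultimately have "\<forall>\<^sub>F q in at_right 0. ?\<Omega> q \<in> bprime_dom \<and> bprime 3 (?\<Omega> q) \<noteq> bprime 1 (?\<Omega> q) * bprime 2 (?\<Omega> q)"
  proof eventually_elim
    case (elim q)
    then show ?case using bprime_cusp_pt(1)[OF c, of q "q ^ 1" "1 / 3"] by auto
  qed
  then show ?thesis
    using eventually_happens'[OF trivial_limit_at_right_real] by blast
qed

text \<open>On the diagonal \<open>v = 0\<close> the theta constants are products, so that \<open>b'\<^sub>3 = b'\<^sub>1 b'\<^sub>2\<close> there, while
  \<open>b'\<^sub>1\<close> and \<open>b'\<^sub>2\<close> are independent: a relation is divisible by \<open>x\<^sub>3 - x\<^sub>1 x\<^sub>2\<close>, and one of least
  degree cannot be.\<close>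

lemma bprime_algebraically_independent:
  assumes "P \<noteq> 0"
  shows "\<exists>\<Omega>\<in>bprime_dom. eval3 of_rat P (\<lambda>i. bprime i \<Omega>) \<noteq> 0"
  using assms
proof (induction "degree P" arbitrary: P rule: less_induct)
  case less
  \<comment> \<open>The product of the first two variables; \<open>poly P ?xy\<close> sets the third
    variable equal to it.\<close>
  let ?xy = "[:0, [:0, 1:]:] :: rat poly poly"
  let ?ev = "\<lambda>P \<Omega>. eval3 of_rat P (\<lambda>i. bprime i \<Omega>) :: complex"
  have c: "(8 :: int) dvd - 1 + 1" by simp
  show ?case
  proof (cases "poly P ?xy = 0")
    case False
    have "cos (pi * 0) \<noteq> 0" by simp
    from cusp_family_independent[OF c this False]
    obtain q r where qr: "0 < q" "q \<le> 1 / 2" "0 < r" "r \<le> 1 / 2" "theta2_fun 1 1 0 q r \<noteq> 0"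
      and nz: "?ev [:poly P ?xy:] (cusp_pt (- 1) 0 q r) \<noteq> 0" by metis
    have "?ev P (cusp_pt (- 1) 0 q r) \<noteq> 0"
      using nz eval3_subst_product[OF is_hom_of_rat bprime_product_on_diagonal[OF c qr], of P] by simp
    then show ?thesis using bprime_cusp_pt(1)[OF c qr] by blast
  next
    case True
    then obtain P1 where P1: "P = [:- ?xy, 1:] * P1" by (auto simp: poly_eq_0_iff_dvd dvd_def)
    have "P1 \<noteq> 0" using P1 less.prems by auto
    then have "degree P1 < degree P" unfolding P1 by (subst degree_mult_eq) auto
    then obtain \<Omega>1 where \<Omega>1: "\<Omega>1 \<in> bprime_dom" "?ev P1 \<Omega>1 \<noteq> 0" using less.hyps \<open>P1 \<noteq> 0\<close> by blast
    have xy: "?ev [:- ?xy, 1:] \<Omega> = bprime 3 \<Omega> - bprime 1 \<Omega> * bprime 2 \<Omega>" for \<Omega>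
      by (simp add: eval3_def map_poly_pCons)
    obtain \<Omega>2 where \<Omega>2: "\<Omega>2 \<in> bprime_dom" "?ev [:- ?xy, 1:] \<Omega>2 \<noteq> 0"
      using bprime_product_fails unfolding xy by auto
    have "\<exists>\<Omega>\<in>bprime_dom. ?ev R \<Omega> \<noteq> 0" if "R \<in> {P1, [:- ?xy, 1:]}" for R
      using that \<Omega>1 \<Omega>2 by blast
    then obtain \<Omega> where "\<Omega> \<in> bprime_dom" "\<And>R. R \<in> {P1, [:- ?xy, 1:]} \<Longrightarrow> ?ev R \<Omega> \<noteq> 0"
      using generic_point[of "{}" 1 "{P1, [:- ?xy, 1:]}"] by (metis empty_subsetI finite.emptyI finite.insertI zero_less_one)
    then show ?thesis
      unfolding P1 is_hom_simps(4)[OF is_hom_eval3[OF is_hom_of_rat]] by (intro bexI[of _ \<Omega>]) auto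
  qed
qed

lemma generic_bprime_point:
  assumes "finite G" "G \<subseteq> Gamma2" "p > 0" "finite PS" "0 \<notin> PS"
  obtains \<Omega> where "\<Omega> \<in> bprime_dom" "\<And>\<gamma>. \<gamma> \<in> G \<Longrightarrow> p *\<^sub>R siegel_act \<gamma> \<Omega> \<in> bprime_dom"
    "\<And>P. P \<in> PS \<Longrightarrow> eval3 of_rat P (\<lambda>i. bprime i \<Omega>) \<noteq> 0"
proof (rule generic_point[OF assms(1-4)])
  show "\<exists>\<Omega>\<in>bprime_dom. eval3 of_rat P (\<lambda>i. bprime i \<Omega>) \<noteq> 0" if "P \<in> PS" for P
    by (rule bprime_algebraically_independent) (use that assms(5) in auto)
qed (rule that)

section \<open>Permutations of the characteristics\<close>

text \<open>For an involution \<open>U\<close> the transpose is also the inverse transpose, so the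
  matrix is symplectic, acts by \<open>\<Omega> \<mapsto> U \<Omega> U\<^sup>T\<close>, and is
  itself an involution.\<close>

definition conj_matrix :: "int ^ 2 ^ 2 \<Rightarrow> mat4" where
  "conj_matrix U = mat4_of_blocks U 0 0 (transpose U)"

lemma conj_matrix_Gamma2:
  assumes "U ** U = mat 1"
  shows "conj_matrix U \<in> Gamma2" "conj_matrix U ** conj_matrix U = mat 1"
proof -
  have t: "transpose U ** transpose U = mat 1"
    unfolding matrix_transpose_mul[symmetric] assms by simp
  show "conj_matrix U \<in> Gamma2"
    unfolding Gamma2_iff conj_matrix_def blk_mat4_of_blocks by (simp add: t matrix_mult_zero transpose_arith)
  show "conj_matrix U ** conj_matrix U = mat 1"
    by (simp add: mat4_eq_iff blk_mult blk_one conj_matrix_def assms t matrix_mult_zero)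
qed

lemma siegel_act_conj_matrix:
  assumes U: "U ** U = mat 1" and "\<tau> \<in> siegel_H2"
  shows "siegel_act (conj_matrix U) \<tau> = cmat U ** \<tau> ** transpose (cmat U)"
proof (rule siegel_act_eqI[OF conj_matrix_Gamma2(1)[OF U] assms(2)])
  have "transpose (cmat U) ** transpose (cmat U) = mat 1"
    unfolding matrix_transpose_mul[symmetric] cmat_simps(1)[symmetric] U by (simp add: cmat_simps)
  then have "cmat U ** \<tau> ** transpose (cmat U) ** transpose (cmat U) = cmat U ** \<tau>"
    by (simp add: matrix_mul_assoc[symmetric])
  then show "cmat U ** \<tau> ** transpose (cmat U) ** siegel_Q (conj_matrix U) \<tau> = siegel_P (conj_matrix U) \<tau>"
    by (simp add: siegel_Q_def siegel_P_def conj_matrix_def cmat_simps matrix_mult_zero)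
qed

text \<open>Reindexing by the transpose of \<open>U\<close> moves \<open>U\<close> onto the
  characteristic, and an even change of the characteristic is a period.\<close>

lemma riemann_theta_conj:
  assumes U: "U ** U = mat 1" and b: "U *v b = b' + m + m"
  shows "riemann_theta (half_cvec b) (cmat U ** \<tau> ** transpose (cmat U)) = riemann_theta (half_cvec b') \<tau>"
proof -
  let ?h = "\<lambda>n. transpose U *v n"
  have UU: "transpose U ** transpose U = mat 1"
    unfolding matrix_transpose_mul[symmetric] U by simp
  have bij: "bij_betw ?h UNIV UNIV"
    by (rule bij_betw_byWitness[where f' = ?h]) (auto simp: matrix_vector_mul_assoc UU)
  have "theta_term (half_cvec b) (cmat U ** \<tau> ** transpose (cmat U)) n = theta_term (half_cvec (U *v b)) \<tau> (?h n)" for n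
  proof -
    have "bdot (cvec n) ((cmat U ** \<tau> ** transpose (cmat U)) *v cvec n) = bdot (cvec (?h n)) (\<tau> *v cvec (?h n))"
      unfolding cvec_transpose[symmetric] by (simp add: bdot_matrix_left matrix_vector_mul_assoc matrix_mul_assoc)
    moreover have "bdot (cvec (?h n)) (half_cvec (U *v b)) = bdot (cvec n) (half_cvec b)"
      unfolding cvec_transpose[symmetric] cmat_half_cvec[symmetric]
      by (simp add: bdot_matrix_left matrix_vector_mul_assoc U cmat_simps(5) flip: cmat_simps(1))
    ultimately show ?thesis by (simp add: theta_term_def)
  qed
  then have "riemann_theta (half_cvec b) (cmat U ** \<tau> ** transpose (cmat U))
      = (\<Sum>\<^sub>\<infinity>n. theta_term (half_cvec (U *v b)) \<tau> (?h n))"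
    unfolding riemann_theta_def by (rule infsum_cong)
  also have "\<dots> = riemann_theta (half_cvec (U *v b)) \<tau>"
    unfolding riemann_theta_def by (rule infsum_reindex_bij_betw[OF bij])
  also have "\<dots> = riemann_theta (half_cvec b') \<tau>"
    unfolding b half_cvec_shift riemann_theta_periodic ..
  finally show ?thesis .
qed

text \<open>\<open>GL\<^sub>2(\<F>\<^sub>2)\<close> permutes the three nonzero characteristics; each transposition lifts to an
  integral involution.\<close>

definition lifts_swap :: "int ^ 2 ^ 2 \<Rightarrow> nat \<Rightarrow> nat \<Rightarrow> bool" where
  "lifts_swap U i j \<longleftrightarrow> U ** U = mat 1 \<and>
     (\<forall>k\<le>3. \<exists>m. U *v theta_char k = theta_char (Transposition.transpose i j k) + m + m)"

lemma lifts_swap_sym: "lifts_swap U i j \<Longrightarrow> lifts_swap U j i"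
  by (simp add: lifts_swap_def transpose_commute)

lemma exists_lifts_swap:
  assumes "i \<in> {1, 2, 3}" "j \<in> {1, 2, 3}" "i \<noteq> j"
  shows "\<exists>U. lifts_swap U i j"
proof -
  have k: "(\<forall>k\<le>3. P k) \<longleftrightarrow> P 0 \<and> P 1 \<and> P 2 \<and> P 3" for P :: "nat \<Rightarrow> bool"
  proof -
    have "k \<le> 3 \<longleftrightarrow> k = 0 \<or> k = 1 \<or> k = 2 \<or> k = 3" for k :: nat by auto
    then show ?thesis by (simp only:) blast
  qed
  have ex: "\<exists>m. v = w + m + m" if "even (v $ 1 - w $ 1)" "even (v $ 2 - w $ 2)" for v w :: "int ^ 2"
    using that by (intro exI[of _ "\<chi> k. (v $ k - w $ k) div 2"]) (simp add: vec_eq_iff forall_2)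
  have c: "theta_char 0 = vector [0, 0]" "theta_char 1 = vector [1, 0]" "theta_char 2 = vector [0, 1]" "theta_char 3 = vector [1, 1]"
    by (simp_all add: theta_char_def)
  let ?U = "\<lambda>a b c d. \<chi> i j. if i = (1::2) then (if j = (1::2) then a else b) else (if j = 1 then c else (d::int))"
  have mv: "(?U a b c d *v v) $ 1 = a * v $ 1 + b * v $ 2" "(?U a b c d *v v) $ 2 = c * v $ 1 + d * v $ 2" for a b c d and v :: "int ^ 2"
    by (simp_all add: matrix_vector_mult_def sum_2)
  \<comment> \<open>The entry \<open>- 1\<close> turns matrices that are unipotent modulo 2 into
    involutions over the integers.\<close>
  have "lifts_swap (?U 0 1 1 0) 1 2" "lifts_swap (?U 1 1 0 (- 1)) 2 3" "lifts_swap (?U 1 0 1 (- 1)) 1 3"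
    unfolding lifts_swap_def k
    by (intro conjI ex;
        simp add: vec_eq_iff forall_2 matrix_matrix_mult_def sum_2 mat_def mv c Transposition.transpose_def theta_char_def)+
  then show ?thesis using assms lifts_swap_sym by auto
qed

lemma theta_conj:
  assumes U: "lifts_swap U i j" and "k \<le> 3" and \<tau>: "\<tau> \<in> siegel_H2"
  shows "theta k (c *\<^sub>R siegel_act (conj_matrix U) \<tau>) = theta (Transposition.transpose i j k) (c *\<^sub>R \<tau>)"
proof -
  have UU: "U ** U = mat 1" using U by (simp add: lifts_swap_def)
  obtain m where m: "U *v theta_char k = theta_char (Transposition.transpose i j k) + m + m"
    using U \<open>k \<le> 3\<close> unfolding lifts_swap_def by blast
  have "c *\<^sub>R siegel_act (conj_matrix U) \<tau> = cmat U ** (c *\<^sub>R \<tau>) ** transpose (cmat U)"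
    by (simp add: siegel_act_conj_matrix[OF UU \<tau>] matrix_mult_scaleR)
  then show ?thesis
    by (simp only: theta_eq_riemann_theta riemann_theta_conj[OF UU m])
qed

lemma bprime_conj:
  assumes U: "lifts_swap U i j" and ij: "i \<in> {1, 2, 3}" "j \<in> {1, 2, 3}" and \<tau>: "\<tau> \<in> siegel_H2" and "p > 0"
  shows "k \<le> 3 \<Longrightarrow> bprime k (p *\<^sub>R siegel_act (conj_matrix U) \<tau>) = bprime (Transposition.transpose i j k) (p *\<^sub>R \<tau>)"
    "p *\<^sub>R siegel_act (conj_matrix U) \<tau> \<in> bprime_dom \<longleftrightarrow> p *\<^sub>R \<tau> \<in> bprime_dom"
proof -
  have t0: "Transposition.transpose i j 0 = 0" using ij by (auto simp: Transposition.transpose_def)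
  have UU: "U ** U = mat 1" using U by (simp add: lifts_swap_def)
  show "k \<le> 3 \<Longrightarrow> bprime k (p *\<^sub>R siegel_act (conj_matrix U) \<tau>) = bprime (Transposition.transpose i j k) (p *\<^sub>R \<tau>)"
    by (simp add: bprime_def theta_conj[OF U _ \<tau>] t0)
  show "p *\<^sub>R siegel_act (conj_matrix U) \<tau> \<in> bprime_dom \<longleftrightarrow> p *\<^sub>R \<tau> \<in> bprime_dom"
    using siegel_H2_scaleR[OF siegel_act_H2[OF conj_matrix_Gamma2(1)[OF UU] \<tau>] \<open>p > 0\<close>] siegel_H2_scaleR[OF \<tau> \<open>p > 0\<close>]
    by (simp add: bprime_dom_def theta_conj[OF U _ \<tau>] t0)
qed

section \<open>Congruence subgroups under conjugation and scaling\<close>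

lemma Gamma24I:
  assumes "M \<in> Gamma2" "blkA M = mat 1 + A' + A'" "blkB M = B' + B'" "blkC M = C' + C'" "blkD M = mat 1 + D' + D'"
    "\<And>i. 4 dvd blkB M $ i $ i" "\<And>i. 4 dvd blkC M $ i $ i"
  shows "M \<in> Gamma24"
proof -
  have "[M $ i $ j = mat 1 $ i $ j] (mod 2)" for i j
  proof (cases i; cases j)
    fix k l
    have cong: "[x + y + y = x] (mod 2)" for x y :: int
      by (simp add: cong_iff_dvd_diff)
    have A: "M $ Inl k $ Inl l = blkA M $ k $ l" "M $ Inl k $ Inr l = blkB M $ k $ l"
      "M $ Inr k $ Inl l = blkC M $ k $ l" "M $ Inr k $ Inr l = blkD M $ k $ l"
      by (simp_all add: blkA_def blkB_def blkC_def blkD_def)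
    have m: "(mat 1 :: mat4) $ Inl k $ Inl l = mat 1 $ k $ l" "(mat 1 :: mat4) $ Inr k $ Inr l = mat 1 $ k $ l"
      "(mat 1 :: mat4) $ Inl k $ Inr l = 0" "(mat 1 :: mat4) $ Inr k $ Inl l = 0"
      by (simp_all add: mat_def)
    show "i = Inl k \<Longrightarrow> j = Inl l \<Longrightarrow> ?thesis" "i = Inr k \<Longrightarrow> j = Inr l \<Longrightarrow> ?thesis"
      "i = Inl k \<Longrightarrow> j = Inr l \<Longrightarrow> ?thesis" "i = Inr k \<Longrightarrow> j = Inl l \<Longrightarrow> ?thesis"
      by (simp_all only: A m assms(2-5) vector_add_component cong) (simp_all add: cong_0_iff)
  qed
  then show ?thesis using assms(1,6,7) by (simp add: Gamma24_def)
qed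

lemma even_matrix_halve: "(\<And>i j. even (X $ i $ j)) \<Longrightarrow> \<exists>Y. X = Y + (Y :: int ^ 2 ^ 2)"
  by (rule exI[of _ "\<chi> i j. X $ i $ j div 2"]) (simp add: vec_eq_iff)

lemma Gamma24E:
  assumes "M \<in> Gamma24"
  obtains A' B' C' D' where "blkA M = mat 1 + A' + A'" "blkB M = B' + B'" "blkC M = C' + C'" "blkD M = mat 1 + D' + D'"
proof -
  have "even ((blkA M - mat 1) $ i $ j)" "even ((blkD M - mat 1) $ i $ j)" for i j
    using Gamma24D(2,5)[OF assms, of i j] by (simp_all add: cong_iff_dvd_diff)
  then obtain A' D' where "blkA M - mat 1 = A' + A'" "blkD M - mat 1 = D' + D'"
    using even_matrix_halve[of "blkA M - mat 1"] even_matrix_halve[of "blkD M - mat 1"] by blast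
  moreover obtain B' C' where "blkB M = B' + B'" "blkC M = C' + C'"
    using even_matrix_halve[of "blkB M"] even_matrix_halve[of "blkC M"] Gamma24D(3,4)[OF assms] by blast
  ultimately show ?thesis by (intro that[of A' B' C' D']) (simp_all add: algebra_simps)
qed

lemma dvd_diag_congruence:
  fixes U B :: "int ^ 2 ^ 2"
  assumes "\<And>i. 4 dvd B $ i $ i" "4 dvd B $ 1 $ 2 + B $ 2 $ 1"
  shows "4 dvd (U ** B ** transpose U) $ i $ i"
proof -
  have "(U ** B ** transpose U) $ i $ i = (U $ i $ 1)\<^sup>2 * B $ 1 $ 1 + (U $ i $ 2)\<^sup>2 * B $ 2 $ 2
      + U $ i $ 1 * U $ i $ 2 * (B $ 1 $ 2 + B $ 2 $ 1)"
    by (simp add: matrix_matrix_mult_def transpose_def sum_2 power2_eq_square algebra_simps)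
  then show ?thesis using assms by (simp add: dvd_add dvd_mult)
qed

text \<open>The matrix \<open>X Y\<^sup>T\<close> is symmetric and \<open>X\<close> is the identity
  modulo 2, so the even matrix \<open>Y\<close> is symmetric modulo 4; the two off-diagonal entries
  then add up to twice an even number. This keeps the diagonal condition modulo 4 stable under
  congruence by \<open>U\<close>.\<close>

lemma dvd4_off_diagonal:
  fixes X Y :: "int ^ 2 ^ 2"
  assumes "X ** transpose Y = Y ** transpose X" "X = mat 1 + X' + X'" "\<And>i j. even (Y $ i $ j)"
  shows "4 dvd Y $ 1 $ 2 + Y $ 2 $ 1"
proof -
  obtain Z where Y: "Y = Z + Z" using even_matrix_halve[of Y] assms(3) by blast
  have "(X ** transpose Y) $ 1 $ 2 = (Y ** transpose X) $ 1 $ 2" using assms(1) by simp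
  then have "(1 + 2 * X' $ 1 $ 1) * (2 * Z $ 2 $ 1) + (2 * X' $ 1 $ 2) * (2 * Z $ 2 $ 2)
     = (2 * Z $ 1 $ 1) * (2 * X' $ 2 $ 1) + (2 * Z $ 1 $ 2) * (1 + 2 * X' $ 2 $ 2)"
    unfolding assms(2) Y by (simp add: matrix_matrix_mult_def transpose_def sum_2 mat_def algebra_simps)
  then have "2 * Z $ 1 $ 2 + 2 * Z $ 2 $ 1 = 4 * (Z $ 2 $ 1 + (X' $ 1 $ 1 * Z $ 2 $ 1 + X' $ 1 $ 2 * Z $ 2 $ 2
      - Z $ 1 $ 1 * X' $ 2 $ 1 - Z $ 1 $ 2 * X' $ 2 $ 2))"
    by (simp add: algebra_simps)
  then have "4 dvd 2 * Z $ 1 $ 2 + 2 * Z $ 2 $ 1" by (rule dvdI)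
  then show ?thesis unfolding Y by simp
qed

lemma blk_conj:
  "blkA (conj_matrix U ** M ** conj_matrix U) = U ** blkA M ** U"
  "blkB (conj_matrix U ** M ** conj_matrix U) = U ** blkB M ** transpose U"
  "blkC (conj_matrix U ** M ** conj_matrix U) = transpose U ** blkC M ** U"
  "blkD (conj_matrix U ** M ** conj_matrix U) = transpose U ** blkD M ** transpose U"
  by (simp_all add: blk_mult conj_matrix_def matrix_mult_zero)

lemma Gamma24_conj:
  assumes U: "U ** U = mat 1" and M: "M \<in> Gamma24"
  shows "conj_matrix U ** M ** conj_matrix U \<in> Gamma24"
proof -
  obtain A' B' C' D' where M': "blkA M = mat 1 + A' + A'" "blkB M = B' + B'" "blkC M = C' + C'" "blkD M = mat 1 + D' + D'"
    by (rule Gamma24E[OF M])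
  note M2 = Gamma24D(1)[OF M]
  have UU: "transpose U ** transpose U = mat 1"
    unfolding matrix_transpose_mul[symmetric] U by simp
  have offB: "4 dvd blkB M $ 1 $ 2 + blkB M $ 2 $ 1"
    by (rule dvd4_off_diagonal[OF Gamma2_row_relations(1)[OF M2] M'(1)]) (rule Gamma24D(3)[OF M])
  have offC: "4 dvd blkC M $ 1 $ 2 + blkC M $ 2 $ 1"
    by (rule dvd4_off_diagonal[OF Gamma2_row_relations(2)[OF M2, symmetric] M'(4)]) (rule Gamma24D(4)[OF M])
  show ?thesis
  proof (rule Gamma24I[where A' = "U ** A' ** U" and B' = "U ** B' ** transpose U"
        and C' = "transpose U ** C' ** U" and D' = "transpose U ** D' ** transpose U"])
    show "conj_matrix U ** M ** conj_matrix U \<in> Gamma2"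
      by (intro Gamma2_mult conj_matrix_Gamma2 U M2)
    show "4 dvd blkB (conj_matrix U ** M ** conj_matrix U) $ i $ i" for i
      unfolding blk_conj by (rule dvd_diag_congruence[OF Gamma24D(6)[OF M] offB])
    show "4 dvd blkC (conj_matrix U ** M ** conj_matrix U) $ i $ i" for i
      unfolding blk_conj using dvd_diag_congruence[OF Gamma24D(7)[OF M] offC, of "transpose U" i] by simp
  qed (simp_all only: blk_conj M' matrix_add_ldistrib matrix_mult_add_left matrix_mul_rid U UU)
qed

lemma Gamma0_conj:
  assumes U: "U ** U = mat 1" and M: "M \<in> Gamma0 p"
  shows "conj_matrix U ** M ** conj_matrix U \<in> Gamma0 p"
proof -
  have "int p dvd (transpose U ** blkC M ** U) $ i $ j" for i j
    using M by (auto simp: Gamma0_def matrix_matrix_mult_def sum_2 intro!: dvd_add)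
  then show ?thesis
    using M by (auto simp: Gamma0_def blk_conj intro!: Gamma2_mult conj_matrix_Gamma2 U)
qed

lemma sympl_inv_Gamma24_Gamma0:
  assumes M: "M \<in> Gamma24 \<inter> Gamma0 p"
  shows "sympl_inv M \<in> Gamma24 \<inter> Gamma0 p"
proof
  have M24: "M \<in> Gamma24" using M by blast
  obtain A' B' C' D' where M': "blkA M = mat 1 + A' + A'" "blkB M = B' + B'" "blkC M = C' + C'" "blkD M = mat 1 + D' + D'"
    by (rule Gamma24E[OF M24])
  show "sympl_inv M \<in> Gamma24"
  proof (rule Gamma24I[where A' = "transpose D'" and B' = "- transpose B'" and C' = "- transpose C'" and D' = "transpose A'"])
    show "sympl_inv M \<in> Gamma2" by (rule sympl_inv_Gamma2[OF Gamma24D(1)[OF M24]])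
    show "4 dvd blkB (sympl_inv M) $ i $ i" "4 dvd blkC (sympl_inv M) $ i $ i" for i
      using Gamma24D(6,7)[OF M24] by (simp_all add: sympl_inv_def transpose_def)
  qed (simp_all only: sympl_inv_def blk_mat4_of_blocks M' transpose_arith transpose_mat minus_add_distrib)
  show "sympl_inv M \<in> Gamma0 p"
    using M sympl_inv_Gamma2[OF Gamma24D(1)[OF M24]] by (simp add: Gamma0_def sympl_inv_def transpose_def)
qed

text \<open>Scaling by \<open>p\<close> turns \<open>N\<close> into the matrix with blocks
  \<open>A\<close>, \<open>p B\<close>, \<open>C / p\<close>, \<open>D\<close>. It is integral
  because \<open>N\<close> lies in \<open>Gamma0 p\<close>, and it stays in \<open>Gamma24\<close>
  because dividing by the odd \<open>p\<close> respects divisibility by 2 and 4. Hence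
  \<open>bprime_p\<close> depends only on the coset.\<close>

lemma bprime_level_p:
  assumes N: "N \<in> Gamma24 \<inter> Gamma0 p" and p: "odd p" and \<tau>: "\<tau> \<in> siegel_H2"
  shows "bprime i (real p *\<^sub>R siegel_act N \<tau>) = bprime i (real p *\<^sub>R \<tau>)"
    "real p *\<^sub>R siegel_act N \<tau> \<in> bprime_dom \<longleftrightarrow> real p *\<^sub>R \<tau> \<in> bprime_dom"
proof -
  define A B C D where "A = blkA N" "B = blkB N" "C = blkC N" "D = blkD N"
  note defs = this
  have N24: "N \<in> Gamma24" using N by blast
  note N2 = Gamma24D(1)[OF N24]
  have "p > 0" using p by (rule odd_pos)
  obtain A' B' C' D' where N': "A = mat 1 + A' + A'" "B = B' + B'" "C = C' + C'" "D = mat 1 + D' + D'"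
    unfolding defs by (rule Gamma24E[OF N24])
  define E where "E = (\<chi> i j. C $ i $ j div int p)"
  have C: "C $ i $ j = int p * E $ i $ j" for i j
    using N by (simp add: E_def defs Gamma0_def)
  have evE: "even (E $ i $ j)" for i j
    using Gamma24D(4)[OF N24, of i j] p unfolding defs[symmetric] C by simp
  then obtain E' where E': "E = E' + E'" using even_matrix_halve[of E] by blast
  have E4: "4 dvd E $ i $ i" for i
  proof -
    have "coprime 4 (int p)" using p by (simp add: coprime_power_left_iff[of 2 2, simplified])
    then show ?thesis
      using Gamma24D(7)[OF N24, of i] unfolding defs[symmetric] C by (simp add: coprime_dvd_mult_right_iff)
  qed
  define pB where "pB = (\<chi> i j. int p * B $ i $ j)"
  define M where "M = mat4_of_blocks A pB E D"
  have rel: "transpose A ** C = transpose C ** A" "transpose B ** D = transpose D ** B"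
    "transpose A ** D - transpose C ** B = mat 1"
    using N2 by (simp_all add: Gamma2_iff defs)
  have scaleC: "X ** C = (\<chi> i j. int p * (X ** E) $ i $ j)" "transpose C ** X = (\<chi> i j. int p * (transpose E ** X) $ i $ j)" for X
    by (simp_all add: vec_eq_iff matrix_matrix_mult_def transpose_def C sum_distrib_left mult_ac)
  have scaleB: "X ** pB = (\<chi> i j. int p * (X ** B) $ i $ j)" "transpose pB ** X = (\<chi> i j. int p * (transpose B ** X) $ i $ j)" for X
    by (simp_all add: vec_eq_iff matrix_matrix_mult_def transpose_def pB_def sum_distrib_left mult_ac)
  have "M \<in> Gamma2"
    unfolding Gamma2_iff M_def blk_mat4_of_blocks
  proof (intro conjI)
    show "transpose A ** E = transpose E ** A"
      using rel(1) \<open>p > 0\<close> unfolding scaleC by (simp add: vec_eq_iff)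
    show "transpose pB ** D = transpose D ** pB"
      unfolding scaleB rel(2) ..
    show "transpose A ** D - transpose E ** pB = mat 1"
      using rel(3) unfolding scaleB scaleC .
  qed
  moreover have "M \<in> Gamma24"
  proof (rule Gamma24I[OF \<open>M \<in> Gamma2\<close>, where A' = A' and B' = "\<chi> i j. int p * B' $ i $ j" and C' = E' and D' = D'])
    show "blkB M = (\<chi> i j. int p * B' $ i $ j) + (\<chi> i j. int p * B' $ i $ j)"
      by (simp add: M_def pB_def N'(2) vec_eq_iff distrib_left)
    show "4 dvd blkB M $ i $ i" "4 dvd blkC M $ i $ i" for i
      using Gamma24D(6)[OF N24, of i] E4 by (simp_all add: M_def pB_def defs)
  qed (simp_all only: M_def blk_mat4_of_blocks N' E')
  moreover have p\<tau>: "real p *\<^sub>R \<tau> \<in> siegel_H2" using \<open>p > 0\<close> by (intro siegel_H2_scaleR[OF \<tau>]) simp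
  moreover have "siegel_act M (real p *\<^sub>R \<tau>) = real p *\<^sub>R siegel_act N \<tau>"
  proof (rule siegel_act_eqI[OF \<open>M \<in> Gamma2\<close> p\<tau>])
    have cE: "cmat C = real p *\<^sub>R cmat E"
      unfolding vec_eq_iff vector_scaleR_component map_matrix_def vec_lambda_beta C by (simp add: scaleR_conv_of_real)
    have cB: "cmat pB = real p *\<^sub>R cmat B"
      unfolding vec_eq_iff vector_scaleR_component map_matrix_def vec_lambda_beta pB_def by (simp add: scaleR_conv_of_real)
    have Q: "siegel_Q M (real p *\<^sub>R \<tau>) = siegel_Q N \<tau>"
      unfolding siegel_Q_def M_def blk_mat4_of_blocks defs[symmetric] cE matrix_mult_scaleR ..
    have P: "siegel_P M (real p *\<^sub>R \<tau>) = real p *\<^sub>R siegel_P N \<tau>"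
      unfolding siegel_P_def M_def blk_mat4_of_blocks defs[symmetric] cB matrix_mult_scaleR scaleR_right_distrib ..
    show "real p *\<^sub>R siegel_act N \<tau> ** siegel_Q M (real p *\<^sub>R \<tau>) = siegel_P M (real p *\<^sub>R \<tau>)"
      unfolding Q P matrix_mult_scaleR siegel_act_Q[OF N2 \<tau>] ..
  qed
  ultimately show "bprime i (real p *\<^sub>R siegel_act N \<tau>) = bprime i (real p *\<^sub>R \<tau>)"
    "real p *\<^sub>R siegel_act N \<tau> \<in> bprime_dom \<longleftrightarrow> real p *\<^sub>R \<tau> \<in> bprime_dom"
    using bprime_Gamma24[of M "real p *\<^sub>R \<tau>"] by metis+
qed

section \<open>Symmetry of the modular polynomials\<close>

text \<open>Two representatives that agree modulo \<open>4 * p\<close> differ by an element of the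
  subgroup and so coincide; reduction is therefore injective on \<open>C\<close>.\<close>

lemma coset_reps_finite:
  assumes C: "coset_reps p C" and "p > 0"
  shows "finite C"
proof -
  define m where "m = int (4 * p)"
  have "m > 0" using \<open>p > 0\<close> by (simp add: m_def)
  define f where "f M = (\<lambda>(i, j). M $ i $ j mod m)" for M :: mat4
  have "inj_on f C"
  proof (rule inj_onI)
    fix M N assume MN: "M \<in> C" "N \<in> C" "f M = f N"
    then have M24: "M \<in> Gamma24" and N24: "N \<in> Gamma24" using C by (auto simp: coset_reps_def)
    note M2 = Gamma24D(1)[OF M24] and N2 = Gamma24D(1)[OF N24]
    let ?X = "M ** sympl_inv N"
    have cong: "[M $ i $ j = N $ i $ j] (mod m)" for i j
      using fun_cong[OF MN(3), of "(i, j)"] by (simp add: f_def cong_def)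
    have X: "[?X $ i $ j = mat 1 $ i $ j] (mod m)" for i j
    proof -
      have "[?X $ i $ j = (N ** sympl_inv N) $ i $ j] (mod m)"
        unfolding matrix_matrix_mult_def vec_lambda_beta by (intro cong_sum cong_mult cong cong_refl)
      then show ?thesis by (simp add: sympl_inv_right[OF N2])
    qed
    have X2: "?X \<in> Gamma2" by (intro Gamma2_mult M2 sympl_inv_Gamma2 N2)
    have d2: "2 dvd m" and d4: "4 dvd m" and dp: "int p dvd m" by (simp_all add: m_def)
    have BC: "m dvd blkB ?X $ i $ j" "m dvd blkC ?X $ i $ j" for i j
      using X[of "Inl i" "Inr j"] X[of "Inr i" "Inl j"] by (simp_all add: blkB_def blkC_def mat_def cong_0_iff)
    have "?X \<in> Gamma24 \<inter> Gamma0 p"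
      unfolding Gamma24_def Gamma0_def using X2 cong_dvd_modulus[OF X d2] BC dvd_trans[OF d4] dvd_trans[OF dp] by blast
    moreover have "M = ?X ** N" by (simp add: matrix_mul_assoc[symmetric] sympl_inv_left[OF N2])
    moreover have "mat 1 \<in> Gamma24 \<inter> Gamma0 p"
      by (simp add: Gamma24_def Gamma0_def Gamma2_def blk_one)
    moreover have "M = mat 1 ** M" by simp
    ultimately show "M = N"
      using C M24 MN(1,2) unfolding coset_reps_def by blast
  qed
  moreover have "finite (f ` C)"
  proof (rule finite_subset)
    show "f ` C \<subseteq> Pi\<^sub>E UNIV (\<lambda>_. {0..<m})"
      using \<open>m > 0\<close> by (auto simp: f_def PiE_def)
    show "finite (Pi\<^sub>E (UNIV :: ((2 + 2) \<times> (2 + 2)) set) (\<lambda>_. {0..<m}))"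
      by (intro finite_PiE) simp_all
  qed
  ultimately show ?thesis using finite_imageD by blast
qed

text \<open>Conjugation by an involution preserves the subgroup, so the induced map on
  representatives is its own inverse, hence onto, and by finiteness bijective.\<close>

lemma coset_reps_conj:
  assumes C: "coset_reps p C" and "p > 0" and U: "U ** U = mat 1"
  obtains \<pi> where "bij_betw \<pi> C C"
    "\<And>\<gamma>. \<gamma> \<in> C \<Longrightarrow> \<exists>N\<in>Gamma24 \<inter> Gamma0 p. conj_matrix U ** \<gamma> ** conj_matrix U = N ** \<pi> \<gamma>"
proof -
  let ?c = "\<lambda>M. conj_matrix U ** M ** conj_matrix U" and ?H = "Gamma24 \<inter> Gamma0 p"
  have cc: "?c (M ** N) = ?c M ** ?c N" "?c (?c M) = M" for M N
  proof -
    have "?c M ** ?c N = conj_matrix U ** M ** (conj_matrix U ** conj_matrix U) ** N ** conj_matrix U"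
      by (simp only: matrix_mul_assoc)
    then show "?c (M ** N) = ?c M ** ?c N"
      by (simp add: conj_matrix_Gamma2(2)[OF U] matrix_mul_assoc)
    have "?c (?c M) = (conj_matrix U ** conj_matrix U) ** M ** (conj_matrix U ** conj_matrix U)"
      by (simp only: matrix_mul_assoc)
    then show "?c (?c M) = M" by (simp add: conj_matrix_Gamma2(2)[OF U])
  qed
  have uniq: "\<exists>!\<gamma>. \<gamma> \<in> C \<and> (\<exists>N\<in>?H. M = N ** \<gamma>)" if "M \<in> Gamma24" for M
    using C that by (simp add: coset_reps_def)
  have CG: "\<gamma> \<in> C \<Longrightarrow> \<gamma> \<in> Gamma24" for \<gamma> using C by (auto simp: coset_reps_def)
  define \<pi> where "\<pi> M = (THE \<gamma>. \<gamma> \<in> C \<and> (\<exists>N\<in>?H. ?c M = N ** \<gamma>))" for M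
  have \<pi>: "\<pi> \<gamma> \<in> C" "\<exists>N\<in>?H. ?c \<gamma> = N ** \<pi> \<gamma>" if "\<gamma> \<in> C" for \<gamma>
    using theI'[OF uniq[OF Gamma24_conj[OF U CG[OF that]]]] unfolding \<pi>_def by blast+
  have "C \<subseteq> \<pi> ` C"
  proof
    fix \<delta> assume \<delta>: "\<delta> \<in> C"
    obtain N where N: "N \<in> ?H" "?c \<delta> = N ** \<pi> \<delta>" using \<pi>(2)[OF \<delta>] by blast
    have N2: "N \<in> Gamma2" using N(1) Gamma24D(1) by blast
    have "?c (\<pi> \<delta>) = ?c (sympl_inv N) ** \<delta>"
    proof -
      have "\<pi> \<delta> = sympl_inv N ** ?c \<delta>"
        unfolding N(2) by (simp add: matrix_mul_assoc sympl_inv_left[OF N2])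
      then show ?thesis using cc by metis
    qed
    moreover have "?c (sympl_inv N) \<in> ?H"
      using sympl_inv_Gamma24_Gamma0[OF N(1)] Gamma24_conj[OF U] Gamma0_conj[OF U] by blast
    ultimately have "\<pi> (\<pi> \<delta>) = \<delta>"
      using \<pi>[OF \<pi>(1)[OF \<delta>]] \<delta> uniq[OF Gamma24_conj[OF U CG[OF \<pi>(1)[OF \<delta>]]]] by blast
    then show "\<delta> \<in> \<pi> ` C" using \<pi>(1)[OF \<delta>] by (metis imageI)
  qed
  moreover have "\<pi> ` C \<subseteq> C" using \<pi>(1) by blast
  ultimately have "\<pi> ` C = C" by blast
  then have "bij_betw \<pi> C C"
    using coset_reps_finite[OF C \<open>p > 0\<close>] by (simp add: bij_betw_def finite_surj_inj)
  then show ?thesis using \<pi>(2) by (rule that)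
qed

text \<open>With \<open>K\<close> the matrix of \<open>U\<close>,
  \<open>\<gamma> K = K (K \<gamma> K) = K N (\<pi> \<gamma>)\<close>. The outer \<open>K\<close>
  permutes the functions, and \<open>N\<close> is absorbed by invariance at level
  \<open>p\<close>.\<close>

lemma bprime_p_conj:
  assumes C: "coset_reps p C" and p: "odd p" and U: "lifts_swap U i j" and ij: "i \<in> {1, 2, 3}" "j \<in> {1, 2, 3}"
  obtains \<pi> where "bij_betw \<pi> C C"
    "\<And>\<gamma> k \<Omega>. \<gamma> \<in> C \<Longrightarrow> k \<le> 3 \<Longrightarrow> \<Omega> \<in> siegel_H2 \<Longrightarrow>
       bprime_p p k \<gamma> (siegel_act (conj_matrix U) \<Omega>) = bprime_p p (Transposition.transpose i j k) (\<pi> \<gamma>) \<Omega>"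
    "\<And>\<gamma> \<Omega>. \<gamma> \<in> C \<Longrightarrow> \<Omega> \<in> siegel_H2 \<Longrightarrow>
       real p *\<^sub>R siegel_act \<gamma> (siegel_act (conj_matrix U) \<Omega>) \<in> bprime_dom \<longleftrightarrow> real p *\<^sub>R siegel_act (\<pi> \<gamma>) \<Omega> \<in> bprime_dom"
proof -
  have UU: "U ** U = mat 1" using U by (simp add: lifts_swap_def)
  have "p > 0" using p by (rule odd_pos)
  then have rp: "real p > 0" by simp
  let ?M = "conj_matrix U"
  note M2 = conj_matrix_Gamma2[OF UU]
  obtain \<pi> where \<pi>: "bij_betw \<pi> C C" "\<And>\<gamma>. \<gamma> \<in> C \<Longrightarrow> \<exists>N\<in>Gamma24 \<inter> Gamma0 p. ?M ** \<gamma> ** ?M = N ** \<pi> \<gamma>"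
    using coset_reps_conj[OF C \<open>p > 0\<close> UU] by metis
  have act: "\<exists>N\<in>Gamma24 \<inter> Gamma0 p. siegel_act \<gamma> (siegel_act ?M \<Omega>) = siegel_act ?M (siegel_act N (siegel_act (\<pi> \<gamma>) \<Omega>))
      \<and> siegel_act (\<pi> \<gamma>) \<Omega> \<in> siegel_H2" if g: "\<gamma> \<in> C" and \<Omega>: "\<Omega> \<in> siegel_H2" for \<gamma> \<Omega>
  proof -
    obtain N where N: "N \<in> Gamma24 \<inter> Gamma0 p" "?M ** \<gamma> ** ?M = N ** \<pi> \<gamma>" using \<pi>(2)[OF g] by blast
    have "\<pi> \<gamma> \<in> C" using \<pi>(1) g by (auto simp: bij_betw_def)
    then have g2: "\<gamma> \<in> Gamma2" "\<pi> \<gamma> \<in> Gamma2" "N \<in> Gamma2"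
      using g C N(1) Gamma24D(1) by (auto simp: coset_reps_def)
    have "\<gamma> ** ?M = ?M ** (?M ** \<gamma> ** ?M)"
      by (simp add: matrix_mul_assoc M2(2))
    also have "\<dots> = ?M ** (N ** \<pi> \<gamma>)" unfolding N(2) ..
    finally have "siegel_act (\<gamma> ** ?M) \<Omega> = siegel_act (?M ** (N ** \<pi> \<gamma>)) \<Omega>" by simp
    then show ?thesis
      using g2 M2(1) \<Omega> N(1) by (intro bexI[of _ N]) (simp_all add: siegel_act_mult Gamma2_mult siegel_act_H2)
  qed
  show ?thesis
  proof (rule that[OF \<pi>(1)])
    fix \<gamma> k \<Omega> assume g: "\<gamma> \<in> C" and \<Omega>: "\<Omega> \<in> siegel_H2"
    obtain N where N: "N \<in> Gamma24 \<inter> Gamma0 p"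
      "siegel_act \<gamma> (siegel_act ?M \<Omega>) = siegel_act ?M (siegel_act N (siegel_act (\<pi> \<gamma>) \<Omega>))"
      and H: "siegel_act (\<pi> \<gamma>) \<Omega> \<in> siegel_H2" using act[OF g \<Omega>] by blast
    have NH: "siegel_act N (siegel_act (\<pi> \<gamma>) \<Omega>) \<in> siegel_H2"
      by (rule siegel_act_H2[OF Gamma24D(1) H]) (use N(1) in blast)
    show "k \<le> 3 \<Longrightarrow> bprime_p p k \<gamma> (siegel_act ?M \<Omega>) = bprime_p p (Transposition.transpose i j k) (\<pi> \<gamma>) \<Omega>"
      unfolding bprime_p_def N(2) by (simp only: bprime_conj(1)[OF U ij NH rp] bprime_level_p(1)[OF N(1) p H])
    show "real p *\<^sub>R siegel_act \<gamma> (siegel_act ?M \<Omega>) \<in> bprime_dom \<longleftrightarrow> real p *\<^sub>R siegel_act (\<pi> \<gamma>) \<Omega> \<in> bprime_dom"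
      unfolding N(2) by (simp only: bprime_conj(2)[OF U ij NH rp] bprime_level_p(2)[OF N(1) p H])
  qed
qed

lemma Phi_at_conj:
  assumes "bij_betw \<pi> C C" "\<And>\<gamma>. \<gamma> \<in> C \<Longrightarrow> bprime_p p 1 \<gamma> \<Omega>' = bprime_p p 1 (\<pi> \<gamma>) \<Omega>"
  shows "Phi_at p C \<Omega>' = Phi_at p C \<Omega>"
  unfolding Phi_at_def prod.reindex_bij_betw[OF assms(1), of "\<lambda>\<gamma>. [:- bprime_p p 1 \<gamma> \<Omega>, 1:]", symmetric]
  by (rule prod.cong[OF refl]) (simp only: assms(2))

lemma Psi_at_conj:
  assumes \<pi>: "bij_betw \<pi> C C" and 1: "\<And>\<gamma>. \<gamma> \<in> C \<Longrightarrow> bprime_p p 1 \<gamma> \<Omega>' = bprime_p p 1 (\<pi> \<gamma>) \<Omega>"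
    and kl: "\<And>\<gamma>. \<gamma> \<in> C \<Longrightarrow> bprime_p p k \<gamma> \<Omega>' = bprime_p p l (\<pi> \<gamma>) \<Omega>"
  shows "Psi_at p C k \<Omega>' = Psi_at p C l \<Omega>"
proof -
  have "Psi_at p C k \<Omega>' = (\<Sum>\<gamma>\<in>C. smult (bprime_p p l (\<pi> \<gamma>) \<Omega>) (\<Prod>\<gamma>'\<in>C - {\<pi> \<gamma>}. [:- bprime_p p 1 \<gamma>' \<Omega>, 1:]))"
    unfolding Psi_at_def
  proof (rule sum.cong[OF refl])
    fix \<gamma> assume \<gamma>: "\<gamma> \<in> C"
    have "bij_betw \<pi> (C - {\<gamma>}) (C - {\<pi> \<gamma>})"
      using \<pi> \<gamma> by (auto simp: bij_betw_def inj_on_def)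
    from prod.reindex_bij_betw[OF this, of "\<lambda>\<gamma>. [:- bprime_p p 1 \<gamma> \<Omega>, 1:]"]
    have "(\<Prod>\<gamma>'\<in>C - {\<gamma>}. [:- bprime_p p 1 \<gamma>' \<Omega>', 1:]) = (\<Prod>\<gamma>'\<in>C - {\<pi> \<gamma>}. [:- bprime_p p 1 \<gamma>' \<Omega>, 1:])"
      by (rule trans[rotated], intro prod.cong[OF refl]) (simp only: 1 Diff_iff)
    then show "smult (bprime_p p k \<gamma> \<Omega>') (\<Prod>\<gamma>'\<in>C - {\<gamma>}. [:- bprime_p p 1 \<gamma>' \<Omega>', 1:])
        = smult (bprime_p p l (\<pi> \<gamma>) \<Omega>) (\<Prod>\<gamma>'\<in>C - {\<pi> \<gamma>}. [:- bprime_p p 1 \<gamma>' \<Omega>, 1:])"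
      by (simp only: kl[OF \<gamma>])
  qed
  also have "\<dots> = Psi_at p C l \<Omega>"
    unfolding Psi_at_def by (rule sum.reindex_bij_betw[OF \<pi>])
  finally show ?thesis .
qed

section \<open>Exchanging variables in the fraction field\<close>

abbreviation trp :: "nat \<Rightarrow> nat \<Rightarrow> nat \<Rightarrow> nat" where
  "trp \<equiv> Transposition.transpose"

lemma trp_maps: "i \<in> {1, 2, 3} \<Longrightarrow> j \<in> {1, 2, 3} \<Longrightarrow> trp i j \<in> {1, 2, 3} \<rightarrow> {1, 2, 3}"
  by (auto simp: Transposition.transpose_def)

lemma qsubst_trp_involution:
  assumes "i \<in> {1, 2, 3}" "j \<in> {1, 2, 3}"
  shows "qsubst (trp i j) (qsubst (trp i j) P) = P"
  unfolding qsubst_comp[OF trp_maps[OF assms]] by (simp add: qsubst_id)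

lemma swap23_coeff:
  "coeff (swap23 F) n = to_fract (qsubst (trp 2 3) (fst (quot_of_fract (coeff F n))))
     / to_fract (qsubst (trp 2 3) (snd (quot_of_fract (coeff F n))))"
proof -
  have v: "(\<lambda>i. to_fract (qvar i))(2 := to_fract (qvar 3), 3 := to_fract (qvar 2)) = (\<lambda>i. to_fract (qvar (trp 2 3 i)))"
    by (auto simp: Transposition.transpose_def)
  have m: "trp 2 3 \<in> {1, 2, 3} \<rightarrow> {1, 2, 3}" by (rule trp_maps) simp_all
  have e: "eval_frac3 q (\<lambda>i. to_fract (qvar (trp 2 3 i))) = to_fract (qsubst (trp 2 3) (fst (quot_of_fract q)))
     / to_fract (qsubst (trp 2 3) (snd (quot_of_fract q)))" for q
    unfolding eval_frac3_def to_fract_qsubst[OF m] ..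
  show ?thesis
    unfolding swap23_def v by (subst coeff_map_poly) (simp_all add: e is_hom_simps[OF is_hom_qsubst])
qed

lemma fract_eq_quot: "q = to_fract (fst (quot_of_fract q)) / to_fract (snd (quot_of_fract q))"
proof -
  have "to_fract (fst (quot_of_fract q)) / to_fract (snd (quot_of_fract q)) = Fract (fst (quot_of_fract q)) (snd (quot_of_fract q))"
    by (simp add: to_fract_def)
  then show ?thesis by simp
qed

text \<open>\<open>X\<close> and \<open>Y\<close> are kept abstract so that one argument serves both
  identities; all that is needed from them is the transport \<open>XY\<close> along a permutation of
  the cosets.\<close>

lemma represents_swap23:
  assumes C: "coset_reps p C" and p: "odd p"
    and F: "represents p C F X" and G: "represents p C G Y"
    and XY: "\<And>\<pi> \<Omega> \<Omega>'. bij_betw \<pi> C C \<Longrightarrow>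
      (\<And>\<gamma> k. \<gamma> \<in> C \<Longrightarrow> k \<le> 3 \<Longrightarrow> bprime_p p k \<gamma> \<Omega>' = bprime_p p (trp 2 3 k) (\<pi> \<gamma>) \<Omega>) \<Longrightarrow> X \<Omega>' = Y \<Omega>"
  shows "F = swap23 G"
proof (rule poly_eqI)
  fix n
  let ?s = "qsubst (trp 2 3)"
  have s: "trp 2 3 \<in> {1, 2, 3} \<rightarrow> {1, 2, 3}" by (rule trp_maps) simp_all
  have ss: "?s (?s P) = P" for P by (rule qsubst_trp_involution) simp_all
  note sD = is_hom_simps[OF is_hom_qsubst, of "trp 2 3"]
  have s0: "?s P = 0 \<longleftrightarrow> P = 0" for P using ss[of P] sD(1) by metis
  define nf df ng dg where "nf m = fst (quot_of_fract (coeff F m))" and "df m = snd (quot_of_fract (coeff F m))"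
    and "ng m = fst (quot_of_fract (coeff G m))" and "dg m = snd (quot_of_fract (coeff G m))" for m
  have nz: "df m \<noteq> 0" "dg m \<noteq> 0" for m by (simp_all add: df_def dg_def)
  \<comment> \<open>Zero has denominator 1 in lowest terms, so only finitely many denominators have
    to be avoided although \<open>represents\<close> asks about all coefficients.\<close>
  have triv: "m > degree F \<Longrightarrow> df m = 1" "m > degree G \<Longrightarrow> dg m = 1" for m
    by (simp_all add: df_def dg_def coeff_eq_0)
  \<comment> \<open>The cross-multiplied difference of the two coefficients; it vanishes at every
    generic point, hence identically.\<close>
  define R where "R = ?s (nf n) * dg n - ng n * ?s (df n)"
  obtain U where U: "lifts_swap U 2 3" using exists_lifts_swap[of 2 3] by auto
  have UU: "U ** U = mat 1" using U by (simp add: lifts_swap_def)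
  obtain \<pi> where \<pi>: "bij_betw \<pi> C C"
    and val: "\<And>\<gamma> k \<Omega>. \<gamma> \<in> C \<Longrightarrow> k \<le> 3 \<Longrightarrow> \<Omega> \<in> siegel_H2 \<Longrightarrow>
       bprime_p p k \<gamma> (siegel_act (conj_matrix U) \<Omega>) = bprime_p p (trp 2 3 k) (\<pi> \<gamma>) \<Omega>"
    and dom: "\<And>\<gamma> \<Omega>. \<gamma> \<in> C \<Longrightarrow> \<Omega> \<in> siegel_H2 \<Longrightarrow>
       real p *\<^sub>R siegel_act \<gamma> (siegel_act (conj_matrix U) \<Omega>) \<in> bprime_dom \<longleftrightarrow> real p *\<^sub>R siegel_act (\<pi> \<gamma>) \<Omega> \<in> bprime_dom"
    using bprime_p_conj[OF C p U, simplified] by metis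
  have "p > 0" using p by (rule odd_pos)
  have "R = 0"
  proof (rule ccontr)
    assume "R \<noteq> 0"
    define PS where "PS = {R, 1} \<union> (\<lambda>m. ?s (df m)) ` {..degree F} \<union> dg ` {..degree G}"
    have "finite PS" "0 \<notin> PS" using \<open>R \<noteq> 0\<close> nz s0 by (auto simp: PS_def)
    moreover have "C \<subseteq> Gamma2" using C Gamma24D(1) by (auto simp: coset_reps_def)
    ultimately obtain \<Omega> where \<Omega>: "\<Omega> \<in> bprime_dom" "\<And>\<gamma>. \<gamma> \<in> C \<Longrightarrow> real p *\<^sub>R siegel_act \<gamma> \<Omega> \<in> bprime_dom"
      and PS: "\<And>P. P \<in> PS \<Longrightarrow> eval3 of_rat P (\<lambda>i. bprime i \<Omega>) \<noteq> 0"
      using generic_bprime_point[OF coset_reps_finite[OF C \<open>p > 0\<close>], of "real p" PS] \<open>p > 0\<close> by auto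
    let ?b = "\<lambda>i. bprime i \<Omega>"
    define \<Omega>' where "\<Omega>' = siegel_act (conj_matrix U) \<Omega>"
    have H: "\<Omega> \<in> siegel_H2" using \<Omega>(1) by (simp add: bprime_dom_def)
    have "eval3 of_rat P (\<lambda>i. bprime i \<Omega>') = eval3 of_rat P (?b \<circ> trp 2 3)" for P
      using bprime_conj(1)[OF U _ _ H zero_less_one, of 1] bprime_conj(1)[OF U _ _ H zero_less_one, of 2]
        bprime_conj(1)[OF U _ _ H zero_less_one, of 3]
      unfolding \<Omega>'_def eval3_def by simp
    then have ev: "eval3 of_rat P (\<lambda>i. bprime i \<Omega>') = eval3 of_rat (?s P) ?b" for P
      unfolding eval3_qsubst[OF is_hom_of_rat s] .
    have dF: "eval3 of_rat (?s (df m)) ?b \<noteq> 0" and dG: "eval3 of_rat (dg m) ?b \<noteq> 0" for m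
    proof -
      have one: "eval3 of_rat 1 ?b \<noteq> 0" by (simp add: is_hom_simps[OF is_hom_eval3[OF is_hom_of_rat]])
      show "eval3 of_rat (?s (df m)) ?b \<noteq> 0"
        by (cases "m \<le> degree F") (use one triv(1)[of m] in \<open>auto simp: PS_def sD intro!: PS\<close>)
      show "eval3 of_rat (dg m) ?b \<noteq> 0"
        by (cases "m \<le> degree G") (use one triv(2)[of m] in \<open>auto simp: PS_def intro!: PS\<close>)
    qed
    have "\<Omega>' \<in> bprime_dom"
      using bprime_conj(2)[OF U _ _ H zero_less_one] \<Omega>(1) by (simp add: \<Omega>'_def)
    moreover have "\<forall>\<gamma>\<in>C. real p *\<^sub>R siegel_act \<gamma> \<Omega>' \<in> bprime_dom"
      using dom[OF _ H] \<Omega>(2) \<pi> unfolding \<Omega>'_def bij_betw_def by blast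
    moreover have "\<forall>m. frac_defined_at (coeff F m) (\<lambda>i. bprime i \<Omega>')"
      using dF unfolding frac_defined_at_def ev df_def by blast
    ultimately have "map_poly (\<lambda>q. eval_frac3 q (\<lambda>i. bprime i \<Omega>')) F = X \<Omega>'"
      using F unfolding represents_def by blast
    also have "X \<Omega>' = Y \<Omega>"
      by (rule XY[OF \<pi>]) (simp add: \<Omega>'_def val H)
    also have "Y \<Omega> = map_poly (\<lambda>q. eval_frac3 q ?b) G"
      using G \<Omega> dG unfolding represents_def frac_defined_at_def dg_def by metis
    finally have "coeff (map_poly (\<lambda>q. eval_frac3 q (\<lambda>i. bprime i \<Omega>')) F) n = coeff (map_poly (\<lambda>q. eval_frac3 q ?b) G) n"
      by simp
    moreover have "eval_frac3 0 v = (0 :: complex)" for v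
      by (simp add: eval_frac3_def is_hom_simps[OF is_hom_eval3[OF is_hom_of_rat]])
    ultimately have "eval3 of_rat (?s (nf n)) ?b / eval3 of_rat (?s (df n)) ?b = eval3 of_rat (ng n) ?b / eval3 of_rat (dg n) ?b"
      by (simp add: coeff_map_poly) (simp add: eval_frac3_def ev nf_def df_def ng_def dg_def)
    then have "eval3 of_rat R ?b = 0"
      using dF[of n] dG[of n] unfolding R_def is_hom_simps(4,6)[OF is_hom_eval3[OF is_hom_of_rat]]
      by (simp add: field_simps)
    then show False using PS[of R] by (simp add: PS_def)
  qed
  \<comment> \<open>Exchanging the variables once more moves the substitution from \<open>F\<close>
    to \<open>G\<close>.\<close>
  then have "?s (?s (nf n) * dg n) = ?s (ng n * ?s (df n))" by (simp add: R_def)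
  then have eq: "nf n * ?s (dg n) = ?s (ng n) * df n" by (simp add: sD ss)
  have "coeff F n = to_fract (nf n) / to_fract (df n)"
    unfolding nf_def df_def by (rule fract_eq_quot)
  also have "\<dots> = to_fract (?s (ng n)) / to_fract (?s (dg n))"
    using eq nz s0 by (simp add: frac_eq_eq flip: to_fract_mult)
  also have "\<dots> = coeff (swap23 G) n" unfolding swap23_coeff ng_def dg_def ..
  finally show "coeff F n = coeff (swap23 G) n" .
qed

section \<open>Symmetry of the equation of the locus\<close>

definition in_locus :: "nat \<Rightarrow> cmat2 \<Rightarrow> bool" where
  "in_locus p \<Omega> \<longleftrightarrow> (\<exists>M\<in>Gamma24. theta 0 ((real p / 2) *\<^sub>R siegel_act M \<Omega>) = 0)"

lemma orbit24_locus_iff: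
  assumes "\<Omega> \<in> siegel_H2"
  shows "orbit24 \<Omega> \<in> locus p \<longleftrightarrow> in_locus p \<Omega>"
proof
  assume "orbit24 \<Omega> \<in> locus p"
  then obtain \<Omega>' M where "orbit24 \<Omega> = orbit24 \<Omega>'" "M \<in> Gamma24" "theta 0 ((real p / 2) *\<^sub>R siegel_act M \<Omega>') = 0"
    by (auto simp: locus_def)
  then have "siegel_act M \<Omega>' \<in> orbit24 \<Omega>" by (simp add: orbit24_def)
  then obtain N where "N \<in> Gamma24" "siegel_act M \<Omega>' = siegel_act N \<Omega>" by (auto simp: orbit24_def)
  then show "in_locus p \<Omega>" unfolding in_locus_def
    using \<open>theta 0 ((real p / 2) *\<^sub>R siegel_act M \<Omega>') = 0\<close> by auto
next
  assume "in_locus p \<Omega>"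
  then show "orbit24 \<Omega> \<in> locus p" using assms by (auto simp: locus_def in_locus_def)
qed

lemma in_locus_conj:
  assumes U: "lifts_swap U i j" and ij: "i \<in> {1, 2, 3}" "j \<in> {1, 2, 3}" and \<Omega>: "\<Omega> \<in> siegel_H2"
  shows "in_locus p (siegel_act (conj_matrix U) \<Omega>) \<longleftrightarrow> in_locus p \<Omega>"
proof -
  have UU: "U ** U = mat 1" using U by (simp add: lifts_swap_def)
  let ?M = "conj_matrix U"
  note M2 = conj_matrix_Gamma2[OF UU]
  have t0: "trp i j 0 = 0" using ij by (auto simp: Transposition.transpose_def)
  have imp: "in_locus p (siegel_act ?M \<Omega>)" if \<Omega>: "\<Omega> \<in> siegel_H2" and "in_locus p \<Omega>" for \<Omega>
  proof -
    obtain N where N: "N \<in> Gamma24" "theta 0 ((real p / 2) *\<^sub>R siegel_act N \<Omega>) = 0"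
      using \<open>in_locus p \<Omega>\<close> by (auto simp: in_locus_def)
    note N2 = Gamma24D(1)[OF N(1)]
    let ?N = "?M ** N ** ?M"
    have "?N ** ?M = ?M ** N" by (simp add: matrix_mul_assoc[symmetric] M2(2))
    then have "siegel_act ?N (siegel_act ?M \<Omega>) = siegel_act ?M (siegel_act N \<Omega>)"
      using M2(1) N2 \<Omega> by (metis Gamma2_mult siegel_act_mult)
    moreover have "theta 0 ((real p / 2) *\<^sub>R siegel_act ?M (siegel_act N \<Omega>)) = 0"
      using theta_conj[OF U _ siegel_act_H2[OF N2 \<Omega>], of 0 "real p / 2"] N(2) t0 by simp
    ultimately show ?thesis unfolding in_locus_def using Gamma24_conj[OF UU N(1)] by metis
  qed
  \<comment> \<open>The matrix is an involution, so the implication at the image point is the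
    converse.\<close>
  have "siegel_act ?M (siegel_act ?M \<Omega>) = \<Omega>"
    using M2 \<Omega> by (metis siegel_act_mult siegel_act_one)
  then show ?thesis using imp[OF \<Omega>] imp[OF siegel_act_H2[OF M2(1) \<Omega>]] by metis
qed

lemma is_L_qsubst_zero:
  assumes L: "is_L p L" and ij: "i \<in> {1, 2, 3}" "j \<in> {1, 2, 3}" "i \<noteq> j" and \<Omega>: "\<Omega> \<in> bprime_dom"
  shows "eval3 of_rat (qsubst (trp i j) L) (\<lambda>k. bprime k \<Omega>) = 0 \<longleftrightarrow> in_locus p \<Omega>"
proof -
  obtain U where U: "lifts_swap U i j" using exists_lifts_swap[OF ij] by blast
  have UU: "U ** U = mat 1" using U by (simp add: lifts_swap_def)
  have H: "\<Omega> \<in> siegel_H2" using \<Omega> by (simp add: bprime_dom_def)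
  let ?\<Omega> = "siegel_act (conj_matrix U) \<Omega>"
  note b = bprime_conj[OF U ij(1,2) H zero_less_one, unfolded scaleR_one]
  have dom: "?\<Omega> \<in> bprime_dom" using b(2) \<Omega> by blast
  have "eval3 of_rat (qsubst (trp i j) L) (\<lambda>k. bprime k \<Omega>) = eval3 of_rat L (\<lambda>k. bprime k ?\<Omega>)"
    unfolding eval3_qsubst[OF is_hom_of_rat trp_maps[OF ij(1,2)]] unfolding eval3_def o_apply by (simp add: b(1))
  also have "\<dots> = 0 \<longleftrightarrow> orbit24 ?\<Omega> \<in> locus p" using L dom by (simp add: is_L_def)
  also have "\<dots> \<longleftrightarrow> in_locus p \<Omega>"
    by (simp only: orbit24_locus_iff[OF siegel_act_H2[OF conj_matrix_Gamma2(1)[OF UU] H]] in_locus_conj[OF U ij(1,2) H])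
  finally show ?thesis .
qed

text \<open>The witness lies on the surface \<open>v = 1 / (2 p)\<close>, on which \<open>\<theta>\<^sub>0 (p \<Omega> / 2)\<close> vanishes identically
  while \<open>b'\<^sub>1\<close> and \<open>b'\<^sub>2\<close> remain independent.\<close>

lemma locus_independent:
  assumes p: "odd p" "p > 1" and R: "R \<noteq> 0"
  obtains \<Omega> where "\<Omega> \<in> bprime_dom" "in_locus p \<Omega>" "eval3 of_rat [:R:] (\<lambda>i. bprime i \<Omega>) \<noteq> 0"
proof -
  \<comment> \<open>The two congruences for \<open>c\<close>, namely -1 modulo 8 and 0 modulo
    \<open>p\<close>, are solved together by inverting 8 modulo \<open>p\<close>.\<close>
  have "coprime (8 :: int) (int p)" using p(1) by (simp add: coprime_power_left_iff[of 2 3, simplified])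
  then obtain e where "[8 * e = 1] (mod int p)" using cong_solve_coprime_int by blast
  then have pc: "int p dvd 8 * e - 1" by (simp add: cong_iff_dvd_diff)
  define c where "c = 8 * e - 1"
  have c: "8 dvd c + 1" by (simp add: c_def)
  \<comment> \<open>This is where the reflection in the odd summation variables kills the theta
    constant at level \<open>p\<close>. The angle \<open>pi * v\<close> remains strictly between 0
    and \<open>pi / 2\<close>, so at level 1 the limits at the cusp are finite and nonzero.\<close>
  define v where "v = 1 / (2 * real p)"
  have v: "of_int (int p) * v = 1 / 2" using p(2) by (simp add: v_def)
  have "cos (pi * v) > 0"
  proof (rule cos_gt_zero_pi)
    have "pi * v < pi * (1 / 2)" unfolding v_def using p(2) by (intro mult_strict_left_mono) (auto simp: field_simps)
    then show "pi * v < pi / 2" by simp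
    show "- (pi / 2) < pi * v" using p(2) pi_gt_zero by (simp add: v_def less_le_trans[of _ 0])
  qed
  then have cos: "cos (pi * v) \<noteq> 0" by simp
  obtain q r where qr: "0 < q" "q \<le> 1 / 2" "0 < r" "r \<le> 1 / 2" "theta2_fun 1 1 v q r \<noteq> 0"
    and nz: "eval3 of_rat [:R:] (\<lambda>i. bprime i (cusp_pt c v q r)) \<noteq> (0 :: complex)"
    using cusp_family_independent[OF c cos R] by metis
  let ?\<Omega> = "cusp_pt c v q r"
  have dom: "?\<Omega> \<in> bprime_dom" by (rule bprime_cusp_pt(1)[OF c qr])
  then have H: "?\<Omega> \<in> siegel_H2" by (simp add: bprime_dom_def)
  have "theta 0 ((of_int (int p) / 2) *\<^sub>R ?\<Omega>) = 0"
    by (rule theta_cusp_pt_vanishes[OF c _ _ _ qr(1) _ qr(3) _ v]) (use p pc qr in \<open>simp_all add: c_def\<close>)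
  moreover have "mat 1 \<in> Gamma24" by (simp add: Gamma24_def Gamma2_def blk_one)
  ultimately have "in_locus p ?\<Omega>"
    unfolding in_locus_def by (intro bexI[of _ "mat 1"]) (simp_all add: siegel_act_one[OF H])
  with dom nz that show ?thesis by blast
qed

lemma irreducible_qsubst:
  assumes "irreducible L" "i \<in> {1, 2, 3}" "j \<in> {1, 2, 3}"
  shows "irreducible (qsubst (trp i j) L)"
proof -
  let ?s = "qsubst (trp i j)"
  have ss: "?s (?s P) = P" for P by (rule qsubst_trp_involution[OF assms(2,3)])
  note sD = is_hom_simps[OF is_hom_qsubst, of "trp i j"]
  have unit: "P dvd 1 \<Longrightarrow> ?s P dvd 1" for P using sD(2,4) by (metis dvd_def)
  show ?thesis
  proof (rule irreducibleI)
    show "?s L \<noteq> 0" using ss[of L] sD(1) assms(1) by auto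
    show "\<not> ?s L dvd 1" using unit[of "?s L"] ss irreducible_not_unit[OF assms(1)] by auto
    fix a b assume "?s L = a * b"
    then have "L = ?s a * ?s b" using ss sD(4) by metis
    then have "?s a dvd 1 \<or> ?s b dvd 1" using assms(1) irreducibleD by blast
    then show "a dvd 1 \<or> b dvd 1" using unit[of "?s a"] unit[of "?s b"] ss by metis
  qed
qed

lemma unit_qpoly3: "u dvd 1 \<Longrightarrow> \<exists>k. u = qconst k \<and> k \<noteq> 0"
  unfolding qconst_def is_unit_poly_iff by auto

lemma qconst_eq_iff: "qconst a = qconst b \<longleftrightarrow> a = b"
  by (simp add: qconst_def)

lemma is_L_qsubst:
  assumes L: "is_L p L" and p: "odd p" "p > 1" and ij: "i \<in> {1, 2, 3}" "j \<in> {1, 2, 3}" "i \<noteq> j"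
  shows "qsubst (trp i j) L = L \<or> qsubst (trp i j) L = - L"
proof -
  let ?s = "qsubst (trp i j)"
  have irr: "irreducible L" using L by (simp add: is_L_def)
  have irr': "irreducible (?s L)" by (rule irreducible_qsubst[OF irr ij(1,2)])
  note sD = is_hom_simps[OF is_hom_qsubst, of "trp i j"]
  have "L dvd ?s L"
  proof (rule ccontr)
    assume "\<not> L dvd ?s L"
    from irreducible_elimination[OF irr irr' this] obtain a b R where R: "R \<noteq> 0" "a * L + b * ?s L = [:R:]" by metis
    obtain \<Omega> where \<Omega>: "\<Omega> \<in> bprime_dom" "in_locus p \<Omega>" "eval3 of_rat [:R:] (\<lambda>i. bprime i \<Omega>) \<noteq> (0 :: complex)"
      by (rule locus_independent[OF p R(1)])
    have "eval3 of_rat (?s L) (\<lambda>i. bprime i \<Omega>) = 0" using is_L_qsubst_zero[OF L ij \<Omega>(1)] \<Omega>(2) by blast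
    moreover have "eval3 of_rat L (\<lambda>i. bprime i \<Omega>) = 0"
      using L \<Omega>(1,2) orbit24_locus_iff[of \<Omega> p] by (auto simp: is_L_def bprime_dom_def)
    ultimately show False
      using \<Omega>(3) unfolding R(2)[symmetric] is_hom_simps(3,4)[OF is_hom_eval3[OF is_hom_of_rat]] by simp
  qed
  then obtain u where u: "?s L = L * u" by blast
  then have "u dvd 1" using irr irr' irreducibleD[OF irr' u] irreducible_not_unit by blast
  then obtain k where k: "u = qconst k" using unit_qpoly3 by blast
  \<comment> \<open>Exchanging twice multiplies \<open>L\<close> by the square of the constant
    \<open>u\<close>, so only a sign is left.\<close>
  have "L = ?s (?s L)" by (rule qsubst_trp_involution[OF ij(1,2), symmetric])
  also have "\<dots> = L * (u * u)" unfolding u sD(4) k qsubst_qconst using u k by (simp add: mult.assoc)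
  finally have "L * (u * u) = L * 1" by simp
  then have "u * u = 1" using irr by (simp only: mult_cancel_left) auto
  then have "qconst (k * k) = qconst 1" unfolding k by (simp add: is_hom_simps[OF is_hom_qconst])
  then have "k * k = 1" by (simp add: qconst_eq_iff)
  then have "k = 1 \<or> k = - 1" by (rule square_eq_1_iff[THEN iffD1])
  then show ?thesis unfolding u k by (auto simp: is_hom_simps[OF is_hom_qconst])
qed

text \<open>An antisymmetric \<open>L\<close> would be divisible by, hence associated to, \<open>x\<^sub>3 - x\<^sub>2\<close>, which is not
  semi-invariant under the other transpositions.\<close>

lemma is_L_qsubst23:
  assumes L: "is_L p L" and p: "odd p" "p > 1"
  shows "qsubst (trp 2 3) L = L"
proof (rule ccontr)
  assume "qsubst (trp 2 3) L \<noteq> L"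
  then have anti: "qsubst (trp 2 3) L = - L" using is_L_qsubst[OF L p, of 2 3] by auto
  have irr: "irreducible L" using L by (simp add: is_L_def)
  let ?x2 = "[:0, 1:] :: rat poly poly"
  have he: "is_hom (\<lambda>P. poly P ?x2)" by (simp add: is_hom_def)
  \<comment> \<open>On the hyperplane \<open>x\<^sub>3 = x\<^sub>2\<close> the exchange has no
    effect, so an antisymmetric polynomial equals its own negative there and vanishes.\<close>
  have "poly (qsubst (trp 2 3) P) ?x2 = poly P ?x2" for P
  proof (rule qpoly3_hom_eq[where f = "\<lambda>P. poly (qsubst (trp 2 3) P) ?x2" and g = "\<lambda>P. poly P ?x2"])
    show "is_hom (\<lambda>P. poly (qsubst (trp 2 3) P) ?x2)" by (rule is_hom_comp[OF he is_hom_qsubst])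
    show "poly (qsubst (trp 2 3) (qvar i)) ?x2 = poly (qvar i) ?x2" if "i \<in> {1, 2, 3}" for i
      unfolding qsubst_qvar[OF that] using that by (auto simp: qvar_def Transposition.transpose_def)
  qed (simp_all add: he qsubst_qconst)
  from this[of L] have "poly L ?x2 = 0" unfolding anti by simp
  then have "[:- ?x2, 1:] dvd L" by (simp add: poly_eq_0_iff_dvd)
  then obtain u where "L = [:- ?x2, 1:] * u" by blast
  moreover have D: "[:- ?x2, 1:] = qvar 3 - qvar 2" by (simp add: qvar_def)
  moreover have "\<not> [:- ?x2, 1:] dvd 1" by (auto simp: is_unit_poly_iff)
  ultimately have "u dvd 1" using irreducibleD[OF irr] by blast
  then obtain k where "u = qconst k" "k \<noteq> 0" using unit_qpoly3 by blast
  with \<open>L = [:- ?x2, 1:] * u\<close> have Lk: "L = (qvar 3 - qvar 2) * qconst k" unfolding D by simp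
  have "qsubst (trp 1 2) L = (qvar 3 - qvar 1) * qconst k"
    unfolding Lk is_hom_simps(4,6)[OF is_hom_qsubst] by (simp add: qsubst_qvar qsubst_qconst Transposition.transpose_def)
  moreover have "(qvar 3 - qvar 1) * qconst k \<noteq> L" "(qvar 3 - qvar 1) * qconst k \<noteq> - L"
    unfolding Lk using \<open>k \<noteq> 0\<close> by (simp_all add: qvar_def qconst_def)
  ultimately show False using is_L_qsubst[OF L p, of 1 2] by auto
qed

text \<open>The other transpositions are conjugates of the exchange of 2 and 3. The conjugating
  transposition occurs twice, so its possible sign cancels.\<close>

lemma is_L_qsubst_trp:
  assumes L: "is_L p L" and p: "odd p" "p > 1" and ij: "i \<in> {1, 2, 3}" "j \<in> {1, 2, 3}" "i \<noteq> j"
  shows "qsubst (trp i j) L = L"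
proof -
  note L23 = is_L_qsubst23[OF L p]
  have conj: "qsubst (trp a b) (qsubst (trp 2 3) (qsubst (trp a b) L)) = L"
    if "a \<in> {1, 2, 3}" "b \<in> {1, 2, 3}" "a \<noteq> b" for a b
    using is_L_qsubst[OF L p that]
  proof
    assume "qsubst (trp a b) L = L"
    then show ?thesis by (simp add: L23)
  next
    assume "qsubst (trp a b) L = - L"
    then show ?thesis by (simp add: L23 is_hom_simps[OF is_hom_qsubst])
  qed
  have comp: "qsubst (trp a b) (qsubst (trp 2 3) (qsubst (trp a b) L)) = qsubst (trp a b \<circ> trp 2 3 \<circ> trp a b) L"
    if "a \<in> {1, 2, 3}" "b \<in> {1, 2, 3}" for a b
  proof -
    have m: "trp a b \<in> {1, 2, 3} \<rightarrow> {1, 2, 3}" by (rule trp_maps[OF that])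
    have "trp 2 3 \<in> {1, 2, 3} \<rightarrow> {1, 2, 3}" by (rule trp_maps) simp_all
    then have m2: "trp 2 3 \<circ> trp a b \<in> {1, 2, 3} \<rightarrow> {1, 2, 3}" using m by fastforce
    show ?thesis unfolding qsubst_comp[OF m] qsubst_comp[OF m2] o_assoc ..
  qed
  have "trp 1 3 \<circ> trp 2 3 \<circ> trp 1 3 = trp 1 2" "trp 1 2 \<circ> trp 2 3 \<circ> trp 1 2 = trp 1 3"
    by (auto simp: fun_eq_iff Transposition.transpose_def)
  then have "qsubst (trp 1 2) L = L" "qsubst (trp 1 3) L = L"
    using conj[of 1 3] comp[of 1 3] conj[of 1 2] comp[of 1 2] by simp_all
  then show ?thesis using ij L23 by (auto simp: transpose_commute)
qed

lemma is_L_symmetric: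
  assumes L: "is_L p L" and p: "odd p" "p > 1"
  shows "symmetric3 L"
  unfolding symmetric3_def
proof (intro allI impI)
  fix \<pi> :: "nat \<Rightarrow> nat" assume "\<pi> permutes {1, 2, 3}"
  moreover have "finite {1, 2, 3 :: nat}" by simp
  ultimately have "qsubst \<pi> L = L"
  proof (induction rule: permutes_induct)
    case id
    show ?case by (rule qsubst_id)
  next
    case (swap a b \<pi>)
    have "\<pi> \<in> {1, 2, 3} \<rightarrow> {1, 2, 3}" by (rule Pi_I) (simp only: permutes_in_image[OF \<open>\<pi> permutes {1, 2, 3}\<close>])
    then have "qsubst (trp a b \<circ> \<pi>) L = qsubst (trp a b) (qsubst \<pi> L)"
      by (rule qsubst_comp[symmetric])
    also have "\<dots> = qsubst (trp a b) L" unfolding \<open>qsubst \<pi> L = L\<close> ..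
    also have "\<dots> = L" by (rule is_L_qsubst_trp[OF L p]) fact+
    finally show ?case .
  qed
  then show "eval3 qconst L (\<lambda>i. qvar (\<pi> i)) = L" by (simp add: qsubst_def)
qed

theorem theorem44:
  fixes p :: nat and C :: "mat4 set"
  assumes "prime p" and "p > 2"
    and "coset_reps p C"
  shows "(\<forall>\<Phi>. is_Phi p C \<Phi> \<longrightarrow> \<Phi> = swap23 \<Phi>) \<and>
         (\<forall>\<Psi>2 \<Psi>3. is_Psi p C 2 \<Psi>2 \<longrightarrow> is_Psi p C 3 \<Psi>3 \<longrightarrow> \<Psi>2 = swap23 \<Psi>3) \<and>
         (\<forall>L. is_L p L \<longrightarrow> symmetric3 L)"
proof (intro conjI allI impI)
  have p: "odd p" "p > 1" using assms(1,2) by (simp_all add: prime_odd_nat)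
  have trp: "trp 2 3 1 = 1" "trp 2 3 2 = 3" by (simp_all add: Transposition.transpose_def)
  show "\<Phi> = swap23 \<Phi>" if "is_Phi p C \<Phi>" for \<Phi>
  proof (rule represents_swap23[OF assms(3) p(1)])
    show "represents p C \<Phi> (Phi_at p C)" "represents p C \<Phi> (Phi_at p C)"
      using that by (simp_all add: is_Phi_def)
    fix \<pi> \<Omega> \<Omega>'
    assume "bij_betw \<pi> C C" "\<And>\<gamma> k. \<gamma> \<in> C \<Longrightarrow> k \<le> 3 \<Longrightarrow> bprime_p p k \<gamma> \<Omega>' = bprime_p p (trp 2 3 k) (\<pi> \<gamma>) \<Omega>"
    then show "Phi_at p C \<Omega>' = Phi_at p C \<Omega>"
      by (intro Phi_at_conj) (simp_all only: trp one_le_numeral)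
  qed
  show "\<Psi>2 = swap23 \<Psi>3" if "is_Psi p C 2 \<Psi>2" "is_Psi p C 3 \<Psi>3" for \<Psi>2 \<Psi>3
  proof (rule represents_swap23[OF assms(3) p(1)])
    show "represents p C \<Psi>2 (Psi_at p C 2)" "represents p C \<Psi>3 (Psi_at p C 3)"
      using that by (simp_all add: is_Psi_def)
    fix \<pi> \<Omega> \<Omega>'
    assume \<pi>: "bij_betw \<pi> C C"
      and val: "\<And>\<gamma> k. \<gamma> \<in> C \<Longrightarrow> k \<le> 3 \<Longrightarrow> bprime_p p k \<gamma> \<Omega>' = bprime_p p (trp 2 3 k) (\<pi> \<gamma>) \<Omega>"
    show "Psi_at p C 2 \<Omega>' = Psi_at p C 3 \<Omega>"
    proof (rule Psi_at_conj[OF \<pi>])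
      show "bprime_p p 1 \<gamma> \<Omega>' = bprime_p p 1 (\<pi> \<gamma>) \<Omega>" "bprime_p p 2 \<gamma> \<Omega>' = bprime_p p 3 (\<pi> \<gamma>) \<Omega>"
        if "\<gamma> \<in> C" for \<gamma>
        using val[OF that, of 1] val[OF that, of 2] by (simp_all add: trp[unfolded One_nat_def])
    qed
  qed
  show "symmetric3 L" if "is_L p L" for L
    by (rule is_L_symmetric[OF that p])
qed

end
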